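(* Let $T>0$ and $\frac12<H_1<H_2<1$. Let $K(u,s)$ be the kernel given by $K=K_-$ for $0<s<u<T$ and $K=K_+$ for $0<u<s<T$, where $K_\pm$ are defined in the context. Then for $u,s\in(0,T)$, $u\ne s$, $$K(u,s)=|u-s|^{2H_2-2H_1-1}L(u,s),\qquad L(u,s)=\begin{cases}L_-(u,s),&0<s<u<T,\\L_+(u,s),&0<u<s<T,\end{cases}$$ where $$\begin{aligned}L_-(u,s)&=(T-u)^{\frac12-H_1}(u-s)^{H_1-\frac12}\Bigl[(D_3+D_5\tfrac su)F_3(\tfrac su)+D_4(\tfrac su)^{2H_2-H_1-\frac12}(1-\tfrac su)F_4(\tfrac su)\\&\qquad-D_5(\tfrac su)^{2H_2-H_1-\frac12}F_5(\tfrac su)\Bigr]+(H_1-\tfrac12)\sum_{j=1}^3\Psi_j\bigl(\tfrac su,\tfrac{T-u}{u-s}\bigr),\end{aligned}$$ and $$\begin{aligned}L_+(u,s)&=D_1u^{\frac12-H_1}s^{2H_2-2}(s-u)^{\frac32+H_1-2H_2}\Bigl[F_1(\tfrac us)+(H_1-\tfrac12)\Phi_1(\tfrac us)\Bigr]+D_2(\tfrac us)^{\frac32-H_1}F_2(\tfrac us)\\&\quad+(H_1-\tfrac12)D_2(\tfrac us)^{\frac12-H_1}\Phi_2(\tfrac us)-(H_1-\tfrac12)(\tfrac us)^{\frac12-H_1}\sum_{j=1}^3\Lambda_j\bigl(\tfrac us,\tfrac{T-s}{s-u}\bigr).\end{aligned}$$ Both one-sided limits $$\lim_{\substack{(u,s)\to(t,t)\\0<s<u<T}}L_-(u,s),\qquad\lim_{\substack{(u,s)\to(t,t)\\0<u<s<T}}L_+(u,s),\qquad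 t\in(0,T),$$ exist, are independent of $t$, and coincide. Hence $L$ admits a continuous extension to the diagonal $\{(t,t):t\in(0,T)\}$.
   Context: $B$ is the beta function and ${}_2F_1(a,b;c;z)$ the Gauss hypergeometric function, given for $c>b>0$, $z<1$ by $\frac{\Gamma(c)}{\Gamma(b)\Gamma(c-b)}\int_0^1t^{b-1}(1-t)^{c-b-1}(1-zt)^{-a}dt$. Kernel. Define $$\psi(u,s)=\frac{\partial}{\partial u}\left(\int_0^u(u-t)^{\frac12-H_1}t^{\frac12-H_1}(s-t)^{2H_2-2}dt\right),\ 0<u<s<T,$$ $$\varphi(u,s)=\frac{\partial}{\partial u}\left(\int_s^u(u-t)^{\frac12-H_1}t^{\frac12-H_1}(t-s)^{2H_2-2}dt\right),\quad\tau(u,s)=\frac{\partial}{\partial u}\left(\int_0^s(u-t)^{\frac12-H_1}t^{\frac12-H_1}(s-t)^{2H_2-2}dt\right)$$ for $0<s<u<T$, and $\rho=\varphi+\tau$. Then $$K_-(u,s)=u^{H_1-\frac12}(T-u)^{\frac12-H_1}\rho(u,s)+(H_1-\tfrac12)u^{\frac12-H_1}\int_u^T\frac{u^{2H_1-1}\rho(u,s)-t^{2H_1-1}\rho(t,s)}{(t-u)^{H_1+\frac12}}dt,\quad 0<s<u<T,$$ $$\begin{aligned}K_+(u,s)&=u^{H_1-\frac12}(s-u)^{\frac12-H_1}\psi(u,s)+(H_1-\tfrac12)u^{\frac12-H_1}\int_u^s\frac{u^{2H_1-1}\psi(u,s)-t^{2H_1-1}\psi(t,s)}{(t-u)^{H_1+\frac12}}dt\\&\quad-(H_1-\tfrac12)u^{\frac12-H_1}\int_s^T(t-u)^{-\frac12-H_1}t^{2H_1-1}\rho(t,s)dt,\quad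 0<u<s<T.\end{aligned}$$ Constants: $D_1=2(1-H_1)B(\frac32-H_1,\frac32-H_1)$, $D_2=(1-H_2)B(\frac32-H_1,\frac32-H_1)$, $D_3=2(H_2-H_1)B(\frac32-H_1,2H_2-1)$, $D_4=\frac{(H_1-\frac12)(\frac32-H_1)}{2H_2-H_1+\frac12}B(\frac32-H_1,2H_2-1)$, $D_5=(H_1-\frac12)B(\frac32-H_1,2H_2-1)$. Functions $F_1,\dots,F_5$ (each extended continuously to $[0,1]$): $F_1(z)={}_2F_1(2-2H_2,\frac32-H_1;3-2H_1;z)$, $F_2(z)={}_2F_1(1+2H_2-2H_1,\frac32-H_1;4-2H_1;z)$, $F_3(z)={}_2F_1(H_1-\frac12,\frac32-H_1;2H_2-H_1+\frac12;1-z)$, $F_4(z)={}_2F_1(2H_2-2H_1+1,2H_2-1;2H_2-H_1+\frac32;1-z)$, $F_5(z)={}_2F_1(2H_2-2H_1,2H_2-1;2H_2-H_1+\frac12;z)$. Functions $\Phi_1,\Phi_2$ on $[0,1]$: $$\Phi_1(z)=\int_0^1\frac{F_1(z)-F_1(z+(1-z)y)}{y^{H_1+\frac12}}dy,$$ $$\Phi_2(z)=\int_0^1\frac{zF_2(z)-(z+(1-z)y)(1-y)^{2H_2-H_1-\frac32}F_2(z+(1-z)y)}{y^{H_1+\frac12}}dy.$$ Functions $\Psi_j(z,R)$, $z\in(0,1)$, $R>0$, with $z_x=\frac{z}{1+(1-z)x}$: $$\Psi_1(z,R)=\int_0^Rx^{-H_1-\frac12}\Bigl((D_3+D_5z)F_3(z)-(1+x)^{2H_2-H_1-\frac32}(1+(1-z)x)^{H_1-\frac12}(D_3+D_5z_x)F_3(z_x)\Bigr)dx,$$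 $$\Psi_2(z,R)=D_4z^{2H_2-H_1-\frac12}(1-z)\int_0^R\frac{F_4(z)-(1+x)^{2H_2-H_1-\frac12}(1+(1-z)x)^{2H_1-2H_2-1}F_4(z_x)}{x^{H_1+\frac12}}dx,$$ $$\Psi_3(z,R)=-D_5z^{2H_2-H_1-\frac12}\int_0^R\frac{F_5(z)-(1+x)^{2H_2-H_1-\frac32}(1+(1-z)x)^{2H_1-2H_2}F_5(z_x)}{x^{H_1+\frac12}}dx.$$ Functions $\Lambda_j(z,R)$, $z\in(0,1)$, $R>0$, with $y_x=\frac1{1+(1-z)x}$: $$\Lambda_1(z,R)=\int_0^Rx^{2H_2-H_1-\frac32}(1+x)^{-H_1-\frac12}(1+(1-z)x)^{H_1-\frac32}\bigl[(D_3+D_5)+D_3(1-z)x\bigr]F_3(y_x)dx,$$ $$\Lambda_2(z,R)=D_4(1-z)\int_0^Rx^{2H_2-H_1-\frac12}(1+x)^{-H_1-\frac12}(1+(1-z)x)^{2H_1-2H_2-1}F_4(y_x)dx,$$ $$\Lambda_3(z,R)=-D_5\int_0^Rx^{2H_2-H_1-\frac32}(1+x)^{-H_1-\frac12}(1+(1-z)x)^{2H_1-2H_2}F_5(y_x)dx.$$ *)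

theory Defs
  imports "HOL-Analysis.Analysis"
begin

text \<open>
  All integrals are Lebesgue integrals over open intervals; for \<open>1/2 < H1 < H2 < 1\<close> the
  integrands below are absolutely integrable.  Real powers are written with \<open>powr\<close>; in the
  relevant ranges all bases are positive in the interior of the domain of integration.
\<close>

definition hyp2F1 :: "real \<Rightarrow> real \<Rightarrow> real \<Rightarrow> real \<Rightarrow> real" where
  "hyp2F1 a b c z = Gamma c / (Gamma b * Gamma (c - b)) *
     (LBINT t:{0<..<1}. t powr (b - 1) * (1 - t) powr (c - b - 1) * (1 - z * t) powr (- a))"

text \<open>Extension to the endpoint \<open>z = 1\<close> by the left-hand limit.\<close>

definition hyp2F1_ext :: "real \<Rightarrow> real \<Rightarrow> real \<Rightarrow> real \<Rightarrow> real" where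
  "hyp2F1_ext a b c z = (if z < 1 then hyp2F1 a b c z else Lim (at_left 1) (hyp2F1 a b c))"


subsection \<open>The kernel\<close>

definition psi :: "real \<Rightarrow> real \<Rightarrow> real \<Rightarrow> real \<Rightarrow> real" where
  "psi H1 H2 u s = deriv (\<lambda>v. LBINT t:{0<..<v}.
     (v - t) powr (1/2 - H1) * t powr (1/2 - H1) * (s - t) powr (2 * H2 - 2)) u"

definition phi :: "real \<Rightarrow> real \<Rightarrow> real \<Rightarrow> real \<Rightarrow> real" where
  "phi H1 H2 u s = deriv (\<lambda>v. LBINT t:{s<..<v}.
     (v - t) powr (1/2 - H1) * t powr (1/2 - H1) * (t - s) powr (2 * H2 - 2)) u"

definition tau :: "real \<Rightarrow> real \<Rightarrow> real \<Rightarrow> real \<Rightarrow> real" where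
  "tau H1 H2 u s = deriv (\<lambda>v. LBINT t:{0<..<s}.
     (v - t) powr (1/2 - H1) * t powr (1/2 - H1) * (s - t) powr (2 * H2 - 2)) u"

definition rho :: "real \<Rightarrow> real \<Rightarrow> real \<Rightarrow> real \<Rightarrow> real" where
  "rho H1 H2 u s = phi H1 H2 u s + tau H1 H2 u s"

definition K_minus :: "real \<Rightarrow> real \<Rightarrow> real \<Rightarrow> real \<Rightarrow> real \<Rightarrow> real" where
  "K_minus H1 H2 T u s =
     u powr (H1 - 1/2) * (T - u) powr (1/2 - H1) * rho H1 H2 u s
     + (H1 - 1/2) * u powr (1/2 - H1) *
       (LBINT t:{u<..<T}.
          (u powr (2 * H1 - 1) * rho H1 H2 u s - t powr (2 * H1 - 1) * rho H1 H2 t s)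
          / (t - u) powr (H1 + 1/2))"

definition K_plus :: "real \<Rightarrow> real \<Rightarrow> real \<Rightarrow> real \<Rightarrow> real \<Rightarrow> real" where
  "K_plus H1 H2 T u s =
     u powr (H1 - 1/2) * (s - u) powr (1/2 - H1) * psi H1 H2 u s
     + (H1 - 1/2) * u powr (1/2 - H1) *
       (LBINT t:{u<..<s}.
          (u powr (2 * H1 - 1) * psi H1 H2 u s - t powr (2 * H1 - 1) * psi H1 H2 t s)
          / (t - u) powr (H1 + 1/2))
     - (H1 - 1/2) * u powr (1/2 - H1) *
       (LBINT t:{s<..<T}. (t - u) powr (- 1/2 - H1) * t powr (2 * H1 - 1) * rho H1 H2 t s)"

text \<open>Only used off the diagonal; the value for \<open>u = s\<close> is irrelevant.\<close>

definition kernel_K :: "real \<Rightarrow> real \<Rightarrow> real \<Rightarrow> real \<Rightarrow> real \<Rightarrow> real" where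
  "kernel_K H1 H2 T u s = (if s < u then K_minus H1 H2 T u s else K_plus H1 H2 T u s)"


subsection \<open>Constants and auxiliary functions\<close>

definition D1 :: "real \<Rightarrow> real" where
  "D1 H1 = 2 * (1 - H1) * Beta (3/2 - H1) (3/2 - H1)"

definition D2 :: "real \<Rightarrow> real \<Rightarrow> real" where
  "D2 H1 H2 = (1 - H2) * Beta (3/2 - H1) (3/2 - H1)"

definition D3 :: "real \<Rightarrow> real \<Rightarrow> real" where
  "D3 H1 H2 = 2 * (H2 - H1) * Beta (3/2 - H1) (2 * H2 - 1)"

definition D4 :: "real \<Rightarrow> real \<Rightarrow> real" where
  "D4 H1 H2 = (H1 - 1/2) * (3/2 - H1) / (2 * H2 - H1 + 1/2) * Beta (3/2 - H1) (2 * H2 - 1)"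

definition D5 :: "real \<Rightarrow> real \<Rightarrow> real" where
  "D5 H1 H2 = (H1 - 1/2) * Beta (3/2 - H1) (2 * H2 - 1)"

definition F1 :: "real \<Rightarrow> real \<Rightarrow> real \<Rightarrow> real" where
  "F1 H1 H2 z = hyp2F1_ext (2 - 2 * H2) (3/2 - H1) (3 - 2 * H1) z"

definition F2 :: "real \<Rightarrow> real \<Rightarrow> real \<Rightarrow> real" where
  "F2 H1 H2 z = hyp2F1_ext (1 + 2 * H2 - 2 * H1) (3/2 - H1) (4 - 2 * H1) z"

definition F3 :: "real \<Rightarrow> real \<Rightarrow> real \<Rightarrow> real" where
  "F3 H1 H2 z = hyp2F1_ext (H1 - 1/2) (3/2 - H1) (2 * H2 - H1 + 1/2) (1 - z)"

definition F4 :: "real \<Rightarrow> real \<Rightarrow> real \<Rightarrow> real" where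
  "F4 H1 H2 z = hyp2F1_ext (2 * H2 - 2 * H1 + 1) (2 * H2 - 1) (2 * H2 - H1 + 3/2) (1 - z)"

definition F5 :: "real \<Rightarrow> real \<Rightarrow> real \<Rightarrow> real" where
  "F5 H1 H2 z = hyp2F1_ext (2 * H2 - 2 * H1) (2 * H2 - 1) (2 * H2 - H1 + 1/2) z"

definition Phi1 :: "real \<Rightarrow> real \<Rightarrow> real \<Rightarrow> real" where
  "Phi1 H1 H2 z =
     (LBINT y:{0<..<1}. (F1 H1 H2 z - F1 H1 H2 (z + (1 - z) * y)) / y powr (H1 + 1/2))"

definition Phi2 :: "real \<Rightarrow> real \<Rightarrow> real \<Rightarrow> real" where
  "Phi2 H1 H2 z =
     (LBINT y:{0<..<1}.
        (z * F2 H1 H2 z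
         - (z + (1 - z) * y) * (1 - y) powr (2 * H2 - H1 - 3/2) * F2 H1 H2 (z + (1 - z) * y))
        / y powr (H1 + 1/2))"

definition zx :: "real \<Rightarrow> real \<Rightarrow> real" where
  "zx z x = z / (1 + (1 - z) * x)"

definition yx :: "real \<Rightarrow> real \<Rightarrow> real" where
  "yx z x = 1 / (1 + (1 - z) * x)"

definition Psi1 :: "real \<Rightarrow> real \<Rightarrow> real \<Rightarrow> real \<Rightarrow> real" where
  "Psi1 H1 H2 z R =
     (LBINT x:{0<..<R}. x powr (- H1 - 1/2) *
        ((D3 H1 H2 + D5 H1 H2 * z) * F3 H1 H2 z
         - (1 + x) powr (2 * H2 - H1 - 3/2) * (1 + (1 - z) * x) powr (H1 - 1/2)
           * (D3 H1 H2 + D5 H1 H2 * zx z x) * F3 H1 H2 (zx z x)))"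

definition Psi2 :: "real \<Rightarrow> real \<Rightarrow> real \<Rightarrow> real \<Rightarrow> real" where
  "Psi2 H1 H2 z R = D4 H1 H2 * z powr (2 * H2 - H1 - 1/2) * (1 - z) *
     (LBINT x:{0<..<R}.
        (F4 H1 H2 z
         - (1 + x) powr (2 * H2 - H1 - 1/2) * (1 + (1 - z) * x) powr (2 * H1 - 2 * H2 - 1)
           * F4 H1 H2 (zx z x))
        / x powr (H1 + 1/2))"

definition Psi3 :: "real \<Rightarrow> real \<Rightarrow> real \<Rightarrow> real \<Rightarrow> real" where
  "Psi3 H1 H2 z R = - D5 H1 H2 * z powr (2 * H2 - H1 - 1/2) *
     (LBINT x:{0<..<R}.
        (F5 H1 H2 z
         - (1 + x) powr (2 * H2 - H1 - 3/2) * (1 + (1 - z) * x) powr (2 * H1 - 2 * H2)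
           * F5 H1 H2 (zx z x))
        / x powr (H1 + 1/2))"

definition Lambda1 :: "real \<Rightarrow> real \<Rightarrow> real \<Rightarrow> real \<Rightarrow> real" where
  "Lambda1 H1 H2 z R =
     (LBINT x:{0<..<R}.
        x powr (2 * H2 - H1 - 3/2) * (1 + x) powr (- H1 - 1/2)
        * (1 + (1 - z) * x) powr (H1 - 3/2)
        * ((D3 H1 H2 + D5 H1 H2) + D3 H1 H2 * (1 - z) * x) * F3 H1 H2 (yx z x))"

definition Lambda2 :: "real \<Rightarrow> real \<Rightarrow> real \<Rightarrow> real \<Rightarrow> real" where
  "Lambda2 H1 H2 z R = D4 H1 H2 * (1 - z) *
     (LBINT x:{0<..<R}.
        x powr (2 * H2 - H1 - 1/2) * (1 + x) powr (- H1 - 1/2)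
        * (1 + (1 - z) * x) powr (2 * H1 - 2 * H2 - 1) * F4 H1 H2 (yx z x))"

definition Lambda3 :: "real \<Rightarrow> real \<Rightarrow> real \<Rightarrow> real \<Rightarrow> real" where
  "Lambda3 H1 H2 z R = - D5 H1 H2 *
     (LBINT x:{0<..<R}.
        x powr (2 * H2 - H1 - 3/2) * (1 + x) powr (- H1 - 1/2)
        * (1 + (1 - z) * x) powr (2 * H1 - 2 * H2) * F5 H1 H2 (yx z x))"


subsection \<open>The factor \<open>L\<close>\<close>

definition L_minus :: "real \<Rightarrow> real \<Rightarrow> real \<Rightarrow> real \<Rightarrow> real \<Rightarrow> real" where
  "L_minus H1 H2 T u s =
     (T - u) powr (1/2 - H1) * (u - s) powr (H1 - 1/2) *
       ((D3 H1 H2 + D5 H1 H2 * (s / u)) * F3 H1 H2 (s / u)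
        + D4 H1 H2 * (s / u) powr (2 * H2 - H1 - 1/2) * (1 - s / u) * F4 H1 H2 (s / u)
        - D5 H1 H2 * (s / u) powr (2 * H2 - H1 - 1/2) * F5 H1 H2 (s / u))
     + (H1 - 1/2) *
       (Psi1 H1 H2 (s / u) ((T - u) / (u - s))
        + Psi2 H1 H2 (s / u) ((T - u) / (u - s))
        + Psi3 H1 H2 (s / u) ((T - u) / (u - s)))"

definition L_plus :: "real \<Rightarrow> real \<Rightarrow> real \<Rightarrow> real \<Rightarrow> real \<Rightarrow> real" where
  "L_plus H1 H2 T u s =
     D1 H1 * u powr (1/2 - H1) * s powr (2 * H2 - 2) * (s - u) powr (3/2 + H1 - 2 * H2) *
       (F1 H1 H2 (u / s) + (H1 - 1/2) * Phi1 H1 H2 (u / s))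
     + D2 H1 H2 * (u / s) powr (3/2 - H1) * F2 H1 H2 (u / s)
     + (H1 - 1/2) * D2 H1 H2 * (u / s) powr (1/2 - H1) * Phi2 H1 H2 (u / s)
     - (H1 - 1/2) * (u / s) powr (1/2 - H1) *
       (Lambda1 H1 H2 (u / s) ((T - s) / (s - u))
        + Lambda2 H1 H2 (u / s) ((T - s) / (s - u))
        + Lambda3 H1 H2 (u / s) ((T - s) / (s - u)))"

definition kernel_L :: "real \<Rightarrow> real \<Rightarrow> real \<Rightarrow> real \<Rightarrow> real \<Rightarrow> real" where
  "kernel_L H1 H2 T u s = (if s < u then L_minus H1 H2 T u s else L_plus H1 H2 T u s)"

end

theory Submission
  imports Defs
begin

text \<open>
  Put \<open>h = H1 - 1/2\<close> and \<open>b = 2 H2 - 1\<close>, so that \<open>0 < 2 h < b < 1\<close>.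

  \<^bold>\<open>Factorisation.\<close>  Scaling the variable of integration turns the integrals inside \<open>psi\<close>,
  \<open>phi\<close>, \<open>tau\<close> into powers times Euler integrals for the hypergeometric function.  Differentiating
  produces contiguous hypergeometric functions whose value at the endpoint is infinite, and Euler's
  transformation (\<open>hyp2F1_euler\<close>) extracts the singular power of \<open>1 - z\<close>.  The result is that
  \<open>rho u s = (u - s) powr (b - h - 1) * u powr (- h) * G (s / u)\<close> for a single bounded profile \<open>G\<close>
  (\<open>rho_eq\<close>), and that \<open>psi\<close> is a similar combination of \<open>F1\<close> and \<open>F2\<close> (\<open>psi_eq\<close>).  The outer
  integrals become the integrals \<open>Psi\<close>, \<open>Phi\<close>, \<open>Lambda\<close> after the substitutions
  \<open>t = u + \<bar>u - s\<bar> x\<close> and \<open>t = s + \<bar>u - s\<bar> x\<close>, which pull out the power of \<open>\<bar>u - s\<bar>\<close>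
  (\<open>K_minus_eq\<close>, \<open>K_plus_eq\<close>).

  \<^bold>\<open>Continuity.\<close>  All \<open>F1\<close>, ..., \<open>F5\<close> are Hoelder continuous on the closed unit interval with a common
  exponent \<open>g > h\<close> (\<open>holder_f\<close>): an increment of order \<open>g\<close> in \<open>z\<close> costs only a factor
  \<open>(1 - t) powr (- g)\<close> under the Euler integral.  Since \<open>g > h\<close>, the increments tame the singular
  weights \<open>x powr (- h - 1)\<close>, and dominated convergence applies up to and including the diagonal
  (\<open>continuous_Lbar_minus\<close>, \<open>continuous_Lbar_plus\<close>).

  \<^bold>\<open>Coincidence.\<close>  At \<open>u = s\<close> only Beta integrals survive.  One side gives
  \<open>G 1 * (1 + h - b) * Beta (1 - h) (1 + 2 h - b)\<close>, the other a combination of \<open>F2 1\<close> and \<open>G 1\<close>.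
  Writing everything in Gamma functions and using the reflection formula four times, the equality of
  the two is \<open>sin\<^sup>2 (\<pi> (b - h)) - sin\<^sup>2 (\<pi> h) = sin (\<pi> b) sin (\<pi> (b - 2 h))\<close>
  (\<open>diagonal_values_coincide\<close>).
\<close>

section \<open>Integrals with parameters\<close>

lemma set_integral_affine:
  fixes f :: "real \<Rightarrow> real"
  assumes "c > 0"
  shows "(LBINT t:{a<..<b}. f t) = c * (LBINT x:{0<..<(b - a) / c}. f (a + c * x))"
proof -
  have ind: "indicator {a<..<b} (a + c * x) = (indicator {0<..<(b - a) / c} x :: real)" for x
    using assms by (auto simp: indicator_def field_simps zero_less_mult_iff)
  show ?thesis
    unfolding set_lebesgue_integral_def
    using assms by (subst lborel_integral_real_affine[of c _ a]) (simp_all add: ind)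
qed

lemma set_integral_reflect:
  fixes f :: "real \<Rightarrow> real"
  shows "(LBINT x:{0<..<1}. f (1 - x)) = (LBINT x:{0<..<1}. f x)"
proof -
  have ind: "indicator {0<..<1} (1 - x) = (indicator {0<..<1} x :: real)" for x :: real
    by (auto simp: indicator_def)
  show ?thesis
    unfolding set_lebesgue_integral_def
    by (subst (2) lborel_integral_real_affine[of "-1" _ 1]) (simp_all add: ind)
qed

text \<open>
  Dominated convergence with domains of integration that move with the parameter: after extension
  by 0 the moving domains are part of the pointwise convergence.  In this form a cut-off that
  converges and a cut-off that escapes to infinity are handled by the same statement.
\<close>

lemma tendsto_set_integral_dominated:
  fixes g :: "'a::first_countable_topology \<Rightarrow> real \<Rightarrow> real"
  assumes w: "set_integrable lborel W w"
    and dom: "\<forall>\<^sub>F y in at y0 within S. open (A y) \<and> continuous_on (A y) (g y) \<and> A y \<subseteq> W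
                \<and> (\<forall>x\<in>A y. \<bar>g y x\<bar> \<le> w x)"
    and lim0: "open A0" "continuous_on A0 g0"
    and lim: "AE x in lborel. ((\<lambda>y. indicator (A y) x * g y x) \<longlongrightarrow> indicator A0 x * g0 x) (at y0 within S)"
  shows "((\<lambda>y. LBINT x:A y. g y x) \<longlongrightarrow> (LBINT x:A0. g0 x)) (at y0 within S)"
  unfolding tendsto_at_iff_sequentially comp_def
proof (intro allI impI)
  fix X assume X: "\<forall>i. X i \<in> S - {y0}" "X \<longlonglongrightarrow> y0"
  have fl: "filterlim X (at y0 within S) sequentially"
    using X by (simp add: filterlim_at)
  from filterlim_iff[THEN iffD1, OF fl, rule_format, OF dom]
  obtain N where N: "\<And>n. n \<ge> N \<Longrightarrow> open (A (X n)) \<and> continuous_on (A (X n)) (g (X n)) \<and> A (X n) \<subseteq> W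
                \<and> (\<forall>x\<in>A (X n). \<bar>g (X n) x\<bar> \<le> w x)"
    unfolding eventually_sequentially by blast
  have meas: "(\<lambda>x. indicator B x *\<^sub>R f x) \<in> borel_measurable lborel"
    if "open B" "continuous_on B f" for B and f :: "real \<Rightarrow> real"
    using borel_measurable_continuous_on_indicator[of B f] that by simp
  have "(\<lambda>n. \<integral>x. indicator (A (X (n + N))) x *\<^sub>R g (X (n + N)) x \<partial>lborel)
          \<longlonglongrightarrow> (\<integral>x. indicator A0 x *\<^sub>R g0 x \<partial>lborel)"
  proof (rule integral_dominated_convergence)
    show "integrable lborel (\<lambda>x. \<bar>indicator W x *\<^sub>R w x\<bar>)"
      using w unfolding set_integrable_def by (rule integrable_abs)
    show "(\<lambda>x. indicator A0 x *\<^sub>R g0 x) \<in> borel_measurable lborel"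
      using lim0 by (rule meas)
    show "(\<lambda>x. indicator (A (X (n + N))) x *\<^sub>R g (X (n + N)) x) \<in> borel_measurable lborel" for n
      using N[of "n + N"] by (intro meas) auto
    show "AE x in lborel. (\<lambda>n. indicator (A (X (n + N))) x *\<^sub>R g (X (n + N)) x)
             \<longlonglongrightarrow> indicator A0 x *\<^sub>R g0 x"
      using lim
    proof eventually_elim
      case (elim x)
      from filterlim_compose[OF elim fl]
      have "(\<lambda>n. indicator (A (X n)) x * g (X n) x) \<longlonglongrightarrow> indicator A0 x * g0 x" .
      from LIMSEQ_ignore_initial_segment[OF this, of N] show ?case by simp
    qed
    show "AE x in lborel. norm (indicator (A (X (n + N))) x *\<^sub>R g (X (n + N)) x) \<le> \<bar>indicator W x *\<^sub>R w x\<bar>" for n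
    proof (rule AE_I2)
      fix x
      have N': "x \<in> A (X (n + N)) \<Longrightarrow> x \<in> W \<and> \<bar>g (X (n + N)) x\<bar> \<le> w x"
        using N[of "n + N"] by auto
      show "norm (indicator (A (X (n + N))) x *\<^sub>R g (X (n + N)) x) \<le> \<bar>indicator W x *\<^sub>R w x\<bar>"
        using N' by (cases "x \<in> A (X (n + N))") (auto simp: indicator_def)
    qed
  qed
  from LIMSEQ_offset[OF this]
  show "(\<lambda>n. LBINT x:A (X n). g (X n) x) \<longlonglongrightarrow> (LBINT x:A0. g0 x)"
    unfolding set_lebesgue_integral_def .
qed

lemma set_integrable_dominated_continuous:
  fixes g :: "real \<Rightarrow> real"
  assumes "set_integrable lborel W w" "A \<subseteq> W" "open A" "continuous_on A g"
    and "\<And>x. x \<in> A \<Longrightarrow> \<bar>g x\<bar> \<le> w x"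
  shows "set_integrable lborel A g"
proof (rule set_integrable_bound)
  show "set_integrable lborel A w"
    using assms by (intro set_integrable_subset[OF assms(1)]) auto
  show "set_borel_measurable lborel A g"
    unfolding set_borel_measurable_def
    using borel_measurable_continuous_on_indicator[of A g] assms by simp
  show "AE x in lborel. x \<in> A \<longrightarrow> norm (g x) \<le> norm (w x)"
    using assms(5) by (intro AE_I2) fastforce
qed

text \<open>
  By the mean value theorem every difference quotient of \<open>\<phi>\<close> is a value of \<open>\<phi>'\<close>, hence bounded
  by \<open>M\<close>; so \<open>\<bar>k\<bar> * M\<close> dominates the difference quotients of the integrand.
\<close>

lemma has_real_derivative_set_integral:
  fixes k :: "real \<Rightarrow> real"
  assumes k: "set_integrable lborel A k" "open A" "continuous_on A k" and e: "e > 0"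
    and der: "\<And>v x. \<bar>v - u\<bar> < e \<Longrightarrow> x \<in> A \<Longrightarrow> ((\<lambda>v. \<phi> v x) has_real_derivative \<phi>' v x) (at v)"
    and cont: "\<And>v. \<bar>v - u\<bar> < e \<Longrightarrow> continuous_on A (\<phi> v)" "continuous_on A (\<phi>' u)"
    and bd: "\<And>v x. \<bar>v - u\<bar> < e \<Longrightarrow> x \<in> A \<Longrightarrow> \<bar>\<phi> v x\<bar> \<le> N"
    and bd': "\<And>v x. \<bar>v - u\<bar> < e \<Longrightarrow> x \<in> A \<Longrightarrow> \<bar>\<phi>' v x\<bar> \<le> M"
  shows "((\<lambda>v. LBINT x:A. k x * \<phi> v x) has_real_derivative (LBINT x:A. k x * \<phi>' u x)) (at u)"
proof -
  have ka: "set_integrable lborel A (\<lambda>x. \<bar>k x\<bar> * C)" for C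
    using set_integrable_mult_left[OF set_integrable_abs[OF k(1)]] by simp
  have int: "set_integrable lborel A (\<lambda>x. k x * \<phi> v x)" if "\<bar>v - u\<bar> < e" for v
    by (rule set_integrable_dominated_continuous[OF ka[of N]])
       (use k cont that bd[OF that] in \<open>auto intro!: continuous_intros mult_left_mono simp: abs_mult\<close>)
  have near: "\<forall>\<^sub>F v in at u. \<bar>v - u\<bar> < e \<and> v \<noteq> u"
    using e by (auto simp: eventually_at dist_real_def)
  have "((\<lambda>v. LBINT x:A. k x * ((\<phi> v x - \<phi> u x) / (v - u))) \<longlongrightarrow> (LBINT x:A. k x * \<phi>' u x)) (at u)"
  proof (rule tendsto_set_integral_dominated[OF ka[of M]])
    show "\<forall>\<^sub>F v in at u. open A \<and> continuous_on A (\<lambda>x. k x * ((\<phi> v x - \<phi> u x) / (v - u))) \<and> A \<subseteq> A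
            \<and> (\<forall>x\<in>A. \<bar>k x * ((\<phi> v x - \<phi> u x) / (v - u))\<bar> \<le> \<bar>k x\<bar> * M)"
      using near
    proof eventually_elim
      case (elim v)
      have "\<bar>(\<phi> v x - \<phi> u x) / (v - u)\<bar> \<le> M" if x: "x \<in> A" for x
      proof (cases "u < v")
        case True
        obtain z where "u < z" "z < v" "\<phi> v x - \<phi> u x = (v - u) * \<phi>' z x"
          using MVT2[OF True, of "\<lambda>v. \<phi> v x" "\<lambda>v. \<phi>' v x"] der[OF _ x] elim by force
        thus ?thesis using bd'[OF _ x, of z] elim by auto
      next
        case False
        hence vu: "v < u" using elim by auto
        obtain z where "v < z" "z < u" "\<phi> u x - \<phi> v x = (u - v) * \<phi>' z x"
          using MVT2[OF vu, of "\<lambda>v. \<phi> v x" "\<lambda>v. \<phi>' v x"] der[OF _ x] elim by force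
        moreover from this have "(\<phi> v x - \<phi> u x) / (v - u) = \<phi>' z x"
          using elim by (simp add: field_simps)
        ultimately show ?thesis using bd'[OF _ x, of z] elim by auto
      qed
      hence "\<bar>k x * ((\<phi> v x - \<phi> u x) / (v - u))\<bar> \<le> \<bar>k x\<bar> * M" if "x \<in> A" for x
        using that unfolding abs_mult by (intro mult_left_mono) auto
      thus ?case using k elim e by (auto intro!: continuous_intros cont)
    qed
    show "AE x in lborel. ((\<lambda>v. indicator A x * (k x * ((\<phi> v x - \<phi> u x) / (v - u))))
             \<longlongrightarrow> indicator A x * (k x * \<phi>' u x)) (at u)"
    proof (rule AE_I2)
      fix x
      have "((\<lambda>v. (\<phi> v x - \<phi> u x) / (v - u)) \<longlongrightarrow> \<phi>' u x) (at u)" if "x \<in> A"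
        using der[of u x] e that by (simp add: has_field_derivative_iff)
      thus "((\<lambda>v. indicator A x * (k x * ((\<phi> v x - \<phi> u x) / (v - u))))
             \<longlongrightarrow> indicator A x * (k x * \<phi>' u x)) (at u)"
        by (cases "x \<in> A") (auto intro!: tendsto_mult_left simp del: times_divide_eq_right)
    qed
  qed (use k cont in \<open>auto intro!: continuous_intros\<close>)
  moreover have "\<forall>\<^sub>F v in at u. (LBINT x:A. k x * ((\<phi> v x - \<phi> u x) / (v - u)))
                   = ((LBINT x:A. k x * \<phi> v x) - (LBINT x:A. k x * \<phi> u x)) / (v - u)"
    using near
  proof eventually_elim
    case (elim v)
    have "(LBINT x:A. k x * \<phi> v x) - (LBINT x:A. k x * \<phi> u x)
             = (LBINT x:A. k x * \<phi> v x - k x * \<phi> u x)"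
      using elim e by (intro set_integral_diff(2)[symmetric] int) auto
    thus ?case by (simp add: field_simps flip: set_integral_divide_zero)
  qed
  ultimately show ?thesis
    unfolding has_field_derivative_iff by (rule Lim_transform_eventually)
qed

lemma beta_integrable:
  assumes "a > 0" "b > (0::real)"
  shows "set_integrable lborel {0<..<1} (\<lambda>t. t powr (a - 1) * (1 - t) powr (b - 1))"
  by (rule set_integrable_subset[OF integrable_Beta[OF assms]]) auto

lemma beta_integral:
  assumes "a > 0" "b > (0::real)"
  shows "(LBINT t:{0<..<1}. t powr (a - 1) * (1 - t) powr (b - 1)) = Beta a b"
proof -
  have "((\<lambda>t. t powr (a - 1) * (1 - t) powr (b - 1)) has_integral Beta a b) {0<..<1}"
    using has_integral_Beta_real[OF assms] by (simp add: has_integral_Icc_iff_Ioo)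
  with set_borel_integral_eq_integral(2)[OF beta_integrable[OF assms]] show ?thesis
    by (simp add: integral_unique)
qed

text \<open>
  The map \<open>y \<mapsto> y / (1 - y)\<close> carries the unit interval to the half-line, which reduces the
  integrals over the half-line below to Beta integrals.
\<close>

lemma set_integral_half_line_substitution:
  fixes f :: "real \<Rightarrow> real"
  assumes cont: "continuous_on {0<..} f" and nn: "\<And>x. 0 < x \<Longrightarrow> 0 \<le> f x"
    and int: "set_integrable lborel {0<..<1} (\<lambda>y. f (y / (1 - y)) / (1 - y)\<^sup>2)"
  shows "set_integrable lborel {0<..} f"
    and "(LBINT x:{0<..}. f x) = (LBINT y:{0<..<1}. f (y / (1 - y)) / (1 - y)\<^sup>2)"
proof -
  have deriv: "DERIV (\<lambda>y. y / (1 - y)) y :> 1 / (1 - y)\<^sup>2"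
    and fcont: "isCont f (y / (1 - y))" and dcont: "isCont (\<lambda>y. 1 / (1 - y)\<^sup>2) y"
    and fnn: "0 \<le> f (y / (1 - y))"
    if "ereal 0 < ereal y" "ereal y < ereal 1" for y
  proof -
    have y: "0 < y" "y < 1" using that by auto
    show "DERIV (\<lambda>y. y / (1 - y)) y :> 1 / (1 - y)\<^sup>2"
      using y by (auto intro!: derivative_eq_intros simp: power2_eq_square field_simps)
    show "isCont f (y / (1 - y))"
      using cont y by (intro continuous_on_interior[of "{0<..}"]) (auto simp: interior_open)
    show "isCont (\<lambda>y. 1 / (1 - y)\<^sup>2) y" using y by (intro continuous_intros) auto
    show "0 \<le> f (y / (1 - y))" using y by (intro nn) auto
  qed
  have "((\<lambda>y::real. y / (1 - y)) \<longlongrightarrow> 0 / (1 - 0)) (at_right 0)"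
    by (intro tendsto_intros) auto
  hence lim0: "((ereal \<circ> (\<lambda>y. y / (1 - y)) \<circ> real_of_ereal) \<longlongrightarrow> ereal 0) (at_right (ereal 0))"
    unfolding ereal_tendsto_simps by simp
  have "filterlim (\<lambda>y::real. 1 - y) (at_right 0) (at_left 1)"
    by (auto simp: filterlim_at eventually_at_filter intro!: tendsto_eq_intros)
  from filterlim_tendsto_pos_mult_at_top[OF tendsto_ident_at _ filterlim_compose[OF filterlim_inverse_at_top_right this]]
  have "filterlim (\<lambda>y::real. y / (1 - y)) at_top (at_left 1)"
    by (simp add: field_simps)
  hence lim1: "((ereal \<circ> (\<lambda>y. y / (1 - y)) \<circ> real_of_ereal) \<longlongrightarrow> \<infinity>) (at_left (ereal 1))"
    unfolding ereal_tendsto_simps .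
  have int': "set_integrable lborel (einterval (ereal 0) (ereal 1)) (\<lambda>y. f (y / (1 - y)) * (1 / (1 - y)\<^sup>2))"
    using int by simp
  have "ereal 0 < ereal 1" and nng: "\<And>y. ereal 0 \<le> ereal y \<Longrightarrow> ereal y \<le> ereal 1 \<Longrightarrow> 0 \<le> 1 / (1 - y)\<^sup>2"
    by auto
  note sub = interval_integral_substitution_nonneg[OF this(1) deriv fcont dcont fnn nng lim0 lim1 int']
  show "set_integrable lborel {0<..} f"
    using sub(1) unfolding einterval_eq .
  show "(LBINT x:{0<..}. f x) = (LBINT y:{0<..<1}. f (y / (1 - y)) / (1 - y)\<^sup>2)"
    using sub(2) einterval_eq_Ici[of 0] einterval_eq_Icc[of 0 1]
    by (simp add: interval_lebesgue_integral_def flip: zero_ereal_def one_ereal_def)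
qed

lemma beta_prime:
  assumes "0 < a" "0 < (c::real)"
  shows "set_integrable lborel {0<..} (\<lambda>x. x powr (a - 1) * (1 + x) powr (- a - c))"
    and "(LBINT x:{0<..}. x powr (a - 1) * (1 + x) powr (- a - c)) = Beta a c"
proof -
  let ?f = "\<lambda>x::real. x powr (a - 1) * (1 + x) powr (- a - c)"
  have eq: "?f (y / (1 - y)) / (1 - y)\<^sup>2 = y powr (a - 1) * (1 - y) powr (c - 1)" if "0 < y" "y < 1" for y
  proof -
    define d where "d = 1 - y"
    have d: "0 < d" using that by (simp add: d_def)
    have e: "1 + y / d = 1 / d" using d by (simp add: d_def field_simps)
    have e2: "d\<^sup>2 = exp (2 * ln d)" using d by (simp add: exp_double)
    show ?thesis unfolding d_def[symmetric] e e2 using d that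
      by (simp add: powr_def ln_div exp_add[symmetric] exp_diff[symmetric]) (simp add: algebra_simps)
  qed
  have int: "set_integrable lborel {0<..<1} (\<lambda>y. ?f (y / (1 - y)) / (1 - y)\<^sup>2)"
    by (rule set_integrable_cong[THEN iffD2, OF refl refl _ beta_integrable[OF assms]]) (use eq in auto)
  have cont: "continuous_on {0<..} ?f" by (intro continuous_intros) auto
  note sub = set_integral_half_line_substitution[OF cont _ int]
  show "set_integrable lborel {0<..} ?f" by (rule sub(1)) auto
  have "(LBINT x:{0<..}. ?f x) = (LBINT y:{0<..<1}. ?f (y / (1 - y)) / (1 - y)\<^sup>2)"
    by (rule sub(2)) auto
  also have "\<dots> = (LBINT y:{0<..<1}. y powr (a - 1) * (1 - y) powr (c - 1))"
    by (intro set_lebesgue_integral_cong) (use eq in auto)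
  also have "\<dots> = Beta a c" by (rule beta_integral[OF assms])
  finally show "(LBINT x:{0<..}. ?f x) = Beta a c" .
qed

section \<open>Power inequalities\<close>

lemma abs_one_plus_powr_minus_one_le:
  fixes e y :: real
  assumes "e \<le> 1" "0 \<le> y"
  shows "\<bar>(1 + y) powr e - 1\<bar> \<le> \<bar>e\<bar> * y"
proof (cases "y = 0")
  case False
  hence y: "0 < y" using assms by simp
  obtain z where z: "0 < z" "z < y"
    and eq: "(1 + y) powr e - (1 + 0) powr e = (y - 0) * (e * (1 + z) powr (e - 1))"
    using MVT2[OF y, of "\<lambda>v. (1 + v) powr e" "\<lambda>v. e * (1 + v) powr (e - 1)"]
    by (force intro!: derivative_eq_intros)
  have "(1 + z) powr (e - 1) \<le> 1"
    using powr_mono[of "e - 1" 0 "1 + z"] z assms by simp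
  hence "\<bar>e\<bar> * (1 + z) powr (e - 1) * y \<le> \<bar>e\<bar> * 1 * y"
    using y by (intro mult_right_mono mult_left_mono) auto
  moreover have "\<bar>(1 + y) powr e - 1\<bar> = \<bar>e\<bar> * (1 + z) powr (e - 1) * y"
    using eq y by (simp add: abs_mult)
  ultimately show ?thesis by simp
qed simp

text \<open>
  With \<open>r = (y - x) / x\<close> this is \<open>1 - (1 + r) powr (- a) \<le> (1 + a) * r powr g\<close>, which follows from
  the upper bounds \<open>1\<close> and \<open>a * r\<close> for the left-hand side.  It buys Hoelder continuity of order \<open>g\<close>
  at the price of \<open>g\<close> further powers of the singularity at \<open>x = 0\<close>.
\<close>

lemma powr_minus_diff_le:
  fixes a g x y :: real
  assumes "0 \<le> a" "0 < g" "g \<le> 1" "0 < x" "x \<le> y"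
  shows "\<bar>x powr (- a) - y powr (- a)\<bar> \<le> (1 + a) * (y - x) powr g * x powr (- a - g)"
proof -
  define r where "r = (y - x) / x"
  have r: "0 \<le> r" "y = x * (1 + r)" using assms by (auto simp: r_def field_simps)
  have "1 - (1 + r) powr (- a) \<le> (1 + a) * r powr g"
  proof (cases "r \<le> 1")
    case True
    have "1 - (1 + r) powr (- a) \<le> a * r"
      using abs_one_plus_powr_minus_one_le[of "- a" r] r assms by simp
    also have "\<dots> \<le> (1 + a) * r powr g"
    proof (cases "r = 0")
      case False
      hence "r powr 1 \<le> r powr g" using True r assms by (intro powr_mono') auto
      thus ?thesis using r assms False by (intro mult_mono) auto
    qed simp
    finally show ?thesis .
  next
    case False
    have "1 - (1 + r) powr (- a) \<le> 1 * 1" by simp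
    also have "\<dots> \<le> (1 + a) * r powr g"
      using False assms by (intro mult_mono) (auto simp: ge_one_powr_ge_zero)
    finally show ?thesis .
  qed
  moreover have "(1 + r) powr (- a) \<le> 1"
    using powr_mono[of "- a" 0 "1 + r"] r assms by simp
  ultimately have "\<bar>1 - (1 + r) powr (- a)\<bar> * x powr (- a) \<le> (1 + a) * r powr g * x powr (- a)"
    by (intro mult_right_mono) auto
  moreover have "x powr (- a) - y powr (- a) = (1 - (1 + r) powr (- a)) * x powr (- a)"
    by (simp only: r(2) powr_mult left_diff_distrib) (simp add: mult.commute)
  moreover have "r powr g * x powr (- a) = (y - x) powr g * x powr (- a - g)"
    using assms unfolding r_def by (simp add: powr_divide powr_diff)
  ultimately show ?thesis by (simp add: abs_mult mult.assoc)
qed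

lemma powr_le_one_plus:
  fixes r x e :: real
  assumes "0 < r" "r \<le> x" "x \<le> 1"
  shows "x powr e \<le> 1 + r powr e"
proof (cases "e \<ge> 0")
  case True
  have "x powr e \<le> 1 powr e" using assms True by (intro powr_mono2) auto
  thus ?thesis using powr_ge_zero[of r e] unfolding powr_one_eq_one by linarith
next
  case False
  have "x powr e \<le> r powr e" using assms False by (intro powr_mono2') auto
  thus ?thesis by simp
qed

lemma le_powr_unit:
  fixes x g :: real
  assumes "0 \<le> x" "x \<le> 1" "g \<le> 1"
  shows "x \<le> x powr g"
  using assms powr_mono'[of g 1 x] by (cases "x = 0") auto

text \<open>
  Quantifies how the factor \<open>y\<close> gained at \<open>y = 0\<close> compensates the weight \<open>y powr (- h - 1)\<close>
  without spoiling integrability at \<open>y = 1\<close>.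
\<close>

lemma one_minus_powr_bound:
  fixes a y :: real
  assumes "0 < a" "a \<le> 1" "0 < y" "y < 1"
  shows "\<bar>(1 - y) powr (a - 1) - 1\<bar> \<le> y * (1 - y) powr (a - 1)"
proof -
  have "1 - y \<le> (1 - y) powr (1 - a)"
    using assms by (intro le_powr_unit) auto
  hence "(1 - y) * (1 - y) powr (a - 1) \<le> (1 - y) powr (1 - a) * (1 - y) powr (a - 1)"
    by (intro mult_right_mono) auto
  also have "\<dots> = 1" using assms by (simp add: powr_add[symmetric])
  finally have "(1 - y) powr (a - 1) - 1 \<le> y * (1 - y) powr (a - 1)"
    by (simp add: algebra_simps)
  moreover have "1 \<le> (1 - y) powr (a - 1)"
    using assms powr_mono'[of "a - 1" 0 "1 - y"] by simp
  ultimately show ?thesis by simp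
qed

lemma powr_diff_le_powr:
  fixes x y e :: real
  assumes "0 \<le> x" "x \<le> y" "0 < e" "e \<le> 1"
  shows "y powr e - x powr e \<le> (y - x) powr e"
proof (cases "x < y")
  case True
  define r where "r = x / y"
  have r: "0 \<le> r" "r < 1" "x = r * y" using True assms by (auto simp: r_def field_simps)
  have y: "0 < y" using True assms by simp
  have "1 \<le> r powr e + (1 - r) powr e"
    using le_powr_unit[of r e] le_powr_unit[of "1 - r" e] r assms by simp
  hence "1 * y powr e \<le> (r powr e + (1 - r) powr e) * y powr e"
    by (intro mult_right_mono) auto
  moreover have "(r * y) powr e = r powr e * y powr e" using r y by (simp add: powr_mult)
  moreover have "(y - r * y) powr e = (1 - r) powr e * y powr e"
  proof -
    have "y - r * y = (1 - r) * y" by (simp add: left_diff_distrib)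
    thus ?thesis using r y by (simp add: powr_mult)
  qed
  ultimately show ?thesis unfolding r(3) by (simp add: distrib_right)
next
  case False
  hence "x = y" using assms by simp
  thus ?thesis by simp
qed

section \<open>The Gauss hypergeometric function\<close>

lemma hyp2F1_integrable:
  fixes b c e z :: real
  assumes "0 < b" "b < c" "0 \<le> z" "z < 1"
  shows "set_integrable lborel {0<..<1} (\<lambda>t. t powr (b - 1) * (1 - t) powr (c - b - 1) * (1 - z * t) powr e)"
proof -
  have zt: "1 - z \<le> 1 - z * t" "1 - z * t \<le> 1" if "0 < t" "t < 1" for t :: real
    using that assms mult_left_mono[of t 1 z] by auto
  have "set_integrable lborel {0<..<1} (\<lambda>t. t powr (b - 1) * (1 - t) powr (c - b - 1) * (1 + (1 - z) powr e))"
    using beta_integrable[of b "c - b"] assms by (intro set_integrable_mult_left) auto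
  thus ?thesis
  proof (rule set_integrable_dominated_continuous)
    show "continuous_on {0<..<1} (\<lambda>t. t powr (b - 1) * (1 - t) powr (c - b - 1) * (1 - z * t) powr e)"
      using zt assms by (force intro!: continuous_intros)
    show "\<bar>t powr (b - 1) * (1 - t) powr (c - b - 1) * (1 - z * t) powr e\<bar>
        \<le> t powr (b - 1) * (1 - t) powr (c - b - 1) * (1 + (1 - z) powr e)" if "t \<in> {0<..<1}" for t
      using that zt assms by (auto simp: abs_mult intro!: mult_left_mono powr_le_one_plus)
  qed auto
qed

lemma hyp2F1_integrable_endpoint:
  fixes a b c z :: real
  assumes "0 \<le> a" "0 < b" "a < c - b" "0 \<le> z" "z \<le> 1"
  shows "set_integrable lborel {0<..<1} (\<lambda>t. t powr (b - 1) * (1 - t) powr (c - b - 1) * (1 - z * t) powr (- a))"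
proof -
  have zt: "1 - t \<le> 1 - z * t" if "0 < t" "t < 1" for t :: real
    using that assms mult_right_mono[of z 1 t] by auto
  have "set_integrable lborel {0<..<1} (\<lambda>t. t powr (b - 1) * (1 - t) powr (c - b - a - 1))"
    using beta_integrable[of b "c - b - a"] assms by auto
  thus ?thesis
  proof (rule set_integrable_dominated_continuous)
    have "1 - z * t \<noteq> 0" if "t \<in> {0<..<1}" for t
    proof -
      have "0 < 1 - t" using that by simp
      also note zt[of t]
      finally show ?thesis using that by simp
    qed
    thus "continuous_on {0<..<1} (\<lambda>t. t powr (b - 1) * (1 - t) powr (c - b - 1) * (1 - z * t) powr (- a))"
      by (intro continuous_intros) auto
    show "\<bar>t powr (b - 1) * (1 - t) powr (c - b - 1) * (1 - z * t) powr (- a)\<bar>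
        \<le> t powr (b - 1) * (1 - t) powr (c - b - a - 1)" if "t \<in> {0<..<1}" for t
    proof -
      have "(1 - z * t) powr (- a) \<le> (1 - t) powr (- a)"
        using that zt assms by (intro powr_mono2') auto
      hence "\<bar>t powr (b - 1) * (1 - t) powr (c - b - 1) * (1 - z * t) powr (- a)\<bar>
         \<le> t powr (b - 1) * (1 - t) powr (c - b - 1) * (1 - t) powr (- a)"
        by (auto simp: abs_mult intro!: mult_left_mono)
      also have "\<dots> = t powr (b - 1) * (1 - t) powr (c - b - a - 1)"
        using that by (simp add: powr_add[symmetric] algebra_simps)
      finally show ?thesis .
    qed
  qed auto
qed

text \<open>
  Since \<open>1 - w * t \<ge> 1 - t\<close>, a Hoelder increment of order \<open>g\<close> in the argument costs at most a factor
  \<open>(1 - t) powr (- a - g)\<close> under the integral sign, and \<open>a + g < c - b\<close> is exactly the condition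
  that this remains integrable at \<open>t = 1\<close>.  The endpoint 1 of the interval is included.
\<close>

lemma hyp2F1_holder:
  assumes "0 \<le> a" "0 < b" "0 < g" "g \<le> 1" "a + g < c - b"
  shows "\<exists>C. \<forall>z\<in>{0..1}. \<forall>w\<in>{0..1}. \<bar>hyp2F1 a b c z - hyp2F1 a b c w\<bar> \<le> C * \<bar>z - w\<bar> powr g"
proof -
  define k where "k = (\<lambda>t::real. t powr (b - 1) * (1 - t) powr (c - b - 1))"
  define m where "m = (\<lambda>t::real. t powr (b - 1) * (1 - t) powr (c - b - a - g - 1))"
  define C where "C = \<bar>Gamma c / (Gamma b * Gamma (c - b))\<bar> * ((1 + a) * (LBINT t:{0<..<1}. m t))"
  have m: "set_integrable lborel {0<..<1} m"
    unfolding m_def using beta_integrable[of b "c - b - a - g"] assms by auto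
  have main: "\<bar>hyp2F1 a b c z - hyp2F1 a b c w\<bar> \<le> C * \<bar>z - w\<bar> powr g"
    if zw: "0 \<le> z" "z \<le> w" "w \<le> 1" for z w
  proof -
    have iz: "set_integrable lborel {0<..<1} (\<lambda>t. k t * (1 - z * t) powr (- a))"
      and iw: "set_integrable lborel {0<..<1} (\<lambda>t. k t * (1 - w * t) powr (- a))"
      unfolding k_def using zw assms by (auto intro!: hyp2F1_integrable_endpoint)
    have pt: "\<bar>k t * (1 - z * t) powr (- a) - k t * (1 - w * t) powr (- a)\<bar>
              \<le> (1 + a) * (w - z) powr g * m t" if t: "t \<in> {0<..<1}" for t
    proof -
      have wt: "1 - t \<le> 1 - w * t" "1 - w * t \<le> 1 - z * t"
        using t zw mult_right_mono[of w 1 t] mult_right_mono[of z w t] by auto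
      have "\<bar>(1 - w * t) powr (- a) - (1 - z * t) powr (- a)\<bar>
              \<le> (1 + a) * ((1 - z * t) - (1 - w * t)) powr g * (1 - w * t) powr (- a - g)"
      proof (rule powr_minus_diff_le)
        have "0 < 1 - t" using t by simp
        also note wt(1)
        finally show "0 < 1 - w * t" .
      qed (use wt t assms in auto)
      also have "\<dots> = (1 + a) * ((w - z) * t) powr g * (1 - w * t) powr (- a - g)"
        by (simp add: algebra_simps)
      also have "\<dots> \<le> (1 + a) * (w - z) powr g * (1 - t) powr (- a - g)"
      proof (intro mult_mono)
        show "((w - z) * t) powr g \<le> (w - z) powr g"
          using t zw assms mult_left_mono[of t 1 "w - z"] by (intro powr_mono2) auto
        show "(1 - w * t) powr (- a - g) \<le> (1 - t) powr (- a - g)"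
          using t wt assms by (intro powr_mono2') auto
      qed (use assms in auto)
      finally have "k t * \<bar>(1 - w * t) powr (- a) - (1 - z * t) powr (- a)\<bar>
         \<le> k t * ((1 + a) * (w - z) powr g * (1 - t) powr (- a - g))"
        by (intro mult_left_mono) (auto simp: k_def)
      also have "\<dots> = (1 + a) * (w - z) powr g * (t powr (b - 1) * ((1 - t) powr (c - b - 1) * (1 - t) powr (- a - g)))"
        by (simp add: k_def mult_ac)
      also have "(1 - t) powr (c - b - 1) * (1 - t) powr (- a - g) = (1 - t) powr (c - b - a - g - 1)"
        using t by (simp add: powr_add[symmetric] algebra_simps)
      also have "k t * \<bar>(1 - w * t) powr (- a) - (1 - z * t) powr (- a)\<bar>
         = \<bar>k t * ((1 - w * t) powr (- a) - (1 - z * t) powr (- a))\<bar>"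
        by (simp add: abs_mult k_def)
      also have "\<dots> = \<bar>k t * (1 - z * t) powr (- a) - k t * (1 - w * t) powr (- a)\<bar>"
        by (simp add: algebra_simps abs_minus_commute)
      finally show ?thesis by (simp add: m_def)
    qed
    have "\<bar>(LBINT t:{0<..<1}. k t * (1 - z * t) powr (- a)) - (LBINT t:{0<..<1}. k t * (1 - w * t) powr (- a))\<bar>
       = \<bar>LBINT t:{0<..<1}. k t * (1 - z * t) powr (- a) - k t * (1 - w * t) powr (- a)\<bar>"
      using iz iw by simp
    also have "\<dots> \<le> (LBINT t:{0<..<1}. \<bar>k t * (1 - z * t) powr (- a) - k t * (1 - w * t) powr (- a)\<bar>)"
      using set_integral_norm_bound[OF set_integral_diff(1)[OF iz iw]] by simp
    also have "\<dots> \<le> (LBINT t:{0<..<1}. (1 + a) * (w - z) powr g * m t)"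
      using pt by (intro set_integral_mono set_integrable_abs set_integral_diff(1) iz iw
          set_integrable_mult_right m) auto
    also have "\<dots> = (1 + a) * (w - z) powr g * (LBINT t:{0<..<1}. m t)" by simp
    finally have "\<bar>Gamma c / (Gamma b * Gamma (c - b))\<bar> *
        \<bar>(LBINT t:{0<..<1}. k t * (1 - z * t) powr (- a)) - (LBINT t:{0<..<1}. k t * (1 - w * t) powr (- a))\<bar>
        \<le> \<bar>Gamma c / (Gamma b * Gamma (c - b))\<bar> * ((1 + a) * (w - z) powr g * (LBINT t:{0<..<1}. m t))"
      by (intro mult_left_mono) auto
    thus ?thesis
      unfolding hyp2F1_def C_def k_def[symmetric] right_diff_distrib[symmetric] abs_mult[symmetric]
      using zw by (simp add: abs_mult k_def mult_ac)
  qed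
  show ?thesis
  proof (intro exI[of _ C] ballI)
    fix z w :: real assume "z \<in> {0..1}" "w \<in> {0..1}"
    thus "\<bar>hyp2F1 a b c z - hyp2F1 a b c w\<bar> \<le> C * \<bar>z - w\<bar> powr g"
      using main[of z w] main[of w z] by (cases "z \<le> w") (auto simp: abs_minus_commute)
  qed
qed

text \<open>
  At \<open>z = 1\<close> the left-hand limit is the Euler integral itself, by continuity up to the endpoint.
\<close>

lemma hyp2F1_ext_eq:
  assumes "0 \<le> a" "0 < b" "0 < g" "g \<le> 1" "a + g < c - b" "z \<le> 1"
  shows "hyp2F1_ext a b c z = hyp2F1 a b c z"
proof (cases "z < 1")
  case False
  hence z: "z = 1" using assms by simp
  obtain C where C: "\<And>z w. z \<in> {0..1} \<Longrightarrow> w \<in> {0..1} \<Longrightarrow> \<bar>hyp2F1 a b c z - hyp2F1 a b c w\<bar> \<le> C * \<bar>z - w\<bar> powr g"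
    using hyp2F1_holder[OF assms(1-5)] by blast
  have "((\<lambda>z. C * \<bar>z - 1\<bar> powr g) \<longlongrightarrow> C * \<bar>1 - 1\<bar> powr g) (at_left 1)"
    using assms by (intro tendsto_intros tendsto_powr') auto
  hence lim: "((\<lambda>z. C * \<bar>z - 1\<bar> powr g) \<longlongrightarrow> 0) (at_left 1)" by simp
  have "(hyp2F1 a b c \<longlongrightarrow> hyp2F1 a b c 1) (at_left 1)"
  proof (rule Lim_null_comparison[OF _ lim, THEN LIM_zero_cancel])
    have "\<forall>\<^sub>F z in at_left (1::real). 0 < z \<and> z < 1"
      using eventually_at_left_real[of 0 "1::real"] by simp
    thus "\<forall>\<^sub>F z in at_left 1. norm (hyp2F1 a b c z - hyp2F1 a b c 1) \<le> C * \<bar>z - 1\<bar> powr g"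
      
    proof eventually_elim
      case (elim z)
      show ?case using C[of z 1] elim by simp
    qed
  qed
  thus ?thesis using z by (simp add: hyp2F1_ext_def tendsto_Lim)
qed (simp add: hyp2F1_ext_def)

lemma Gamma_real_neq_0: "0 < x \<Longrightarrow> Gamma (x::real) \<noteq> 0"
  by (metis Gamma_real_pos less_irrefl)

lemma Beta_times_hyp2F1:
  assumes "0 < b" "b < c"
  shows "Beta b (c - b) * hyp2F1 a b c z
           = (LBINT t:{0<..<1}. t powr (b - 1) * (1 - t) powr (c - b - 1) * (1 - z * t) powr (- a))"
  using assms Gamma_real_neq_0[of b] Gamma_real_neq_0[of c] Gamma_real_neq_0[of "c - b"]
  by (simp add: hyp2F1_def Beta_def)

lemma hyp2F1_at_1:
  assumes "0 < b" "b < c" "a + b < c"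
  shows "hyp2F1 a b c 1 = Gamma c * Gamma (c - a - b) / (Gamma (c - a) * Gamma (c - b))"
proof -
  have "(LBINT t:{0<..<1}. t powr (b - 1) * (1 - t) powr (c - b - 1) * (1 - 1 * t) powr (- a))
      = (LBINT t:{0<..<1}. t powr (b - 1) * (1 - t) powr ((c - a - b) - 1))"
    by (intro set_lebesgue_integral_cong) (auto simp: powr_add[symmetric] algebra_simps)
  also have "\<dots> = Beta b (c - a - b)" using assms by (intro beta_integral) auto
  finally show ?thesis
    using assms Gamma_real_neq_0[of b] by (simp add: hyp2F1_def Beta_def)
qed

lemma hyp2F1_at_0:
  assumes "0 < b" "b < c"
  shows "hyp2F1 a b c 0 = 1"
proof -
  have "(LBINT t:{0<..<1}. t powr (b - 1) * (1 - t) powr (c - b - 1)) = Beta b (c - b)"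
    using assms by (intro beta_integral) auto
  thus ?thesis
    using assms Gamma_real_neq_0[of b] Gamma_real_neq_0[of c] Gamma_real_neq_0[of "c - b"]
    by (simp add: hyp2F1_def Beta_def)
qed

lemma DERIV_hyp2F1:
  assumes "0 < b" "b < c" "0 < z" "z < 1"
  shows "(hyp2F1 a b c has_real_derivative a * b / c * hyp2F1 (a + 1) (b + 1) (c + 1) z) (at z)"
proof -
  \<comment> \<open>For \<open>v\<close> within \<open>e\<close> of \<open>z\<close> the base \<open>1 - v * x\<close> stays between \<open>e\<close> and 1, so its powers are bounded.\<close>
  define e where "e = min z (1 - z) / 2"
  have e: "0 < e" "e < z" "z + e \<le> 1 - e" using assms by (auto simp: e_def min_def field_simps)
  define k where "k = (\<lambda>t::real. t powr (b - 1) * (1 - t) powr (c - b - 1))"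
  have vx: "e \<le> 1 - v * x \<and> 1 - v * x \<le> 1 \<and> 0 < 1 - v * x" if "\<bar>v - z\<bar> < e" "x \<in> {0<..<1}" for v x
  proof -
    have v: "0 < v" "v \<le> 1 - e" using that e by (auto simp: abs_if split: if_splits)
    have "v * x \<le> v" using v that mult_left_mono[of x 1 v] by simp
    moreover have "0 \<le> v * x" using v that by simp
    ultimately show ?thesis using v e by linarith
  qed
  have "((\<lambda>v. LBINT x:{0<..<1}. k x * (1 - v * x) powr (- a)) has_real_derivative
           (LBINT x:{0<..<1}. k x * (a * x * (1 - z * x) powr (- a - 1)))) (at z)"
  proof (rule has_real_derivative_set_integral)
    show "set_integrable lborel {0<..<1} k"
      using beta_integrable[of b "c - b"] assms by (simp add: k_def)
    show "continuous_on {0<..<1} k" unfolding k_def by (intro continuous_intros) auto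
    fix v x assume vx': "\<bar>v - z\<bar> < e" "x \<in> {0<..<1::real}"
    show "((\<lambda>v. (1 - v * x) powr (- a)) has_real_derivative a * x * (1 - v * x) powr (- a - 1)) (at v)"
      using vx[OF vx'] by (auto intro!: derivative_eq_intros)
    show "\<bar>(1 - v * x) powr (- a)\<bar> \<le> 1 + e powr (- a)"
      using vx[OF vx'] e by (auto intro!: powr_le_one_plus)
    have "\<bar>a\<bar> * x * (1 - v * x) powr (- a - 1) \<le> \<bar>a\<bar> * 1 * (1 + e powr (- a - 1))"
      using vx[OF vx'] vx' e by (intro mult_mono powr_le_one_plus) auto
    thus "\<bar>a * x * (1 - v * x) powr (- a - 1)\<bar> \<le> \<bar>a\<bar> * 1 * (1 + e powr (- a - 1))"
      using vx' by (simp add: abs_mult)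
  next
    fix v assume "\<bar>v - z\<bar> < e"
    with vx[of v] show "continuous_on {0<..<1} (\<lambda>x. (1 - v * x) powr (- a))"
      by (intro continuous_intros) force+
  next
    show "continuous_on {0<..<1} (\<lambda>x. a * x * (1 - z * x) powr (- a - 1))"
      using vx[of z] e by (intro continuous_intros) force+
  qed (use e in auto)
  hence "((\<lambda>v. Gamma c / (Gamma b * Gamma (c - b)) * (LBINT x:{0<..<1}. k x * (1 - v * x) powr (- a)))
      has_real_derivative Gamma c / (Gamma b * Gamma (c - b)) *
           (LBINT x:{0<..<1}. k x * (a * x * (1 - z * x) powr (- a - 1)))) (at z)"
    by (rule DERIV_cmult)
  moreover have "(LBINT x:{0<..<1}. k x * (a * x * (1 - z * x) powr (- a - 1))) =
     (LBINT x:{0<..<1}. a * (x powr (b + 1 - 1) * (1 - x) powr (c + 1 - (b + 1) - 1) * (1 - z * x) powr (- (a + 1))))"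
    by (intro set_lebesgue_integral_cong) (auto simp: k_def powr_diff)
  hence "Gamma c / (Gamma b * Gamma (c - b)) * (LBINT x:{0<..<1}. k x * (a * x * (1 - z * x) powr (- a - 1)))
     = Gamma c / (Gamma b * Gamma (c - b)) * (a * (LBINT x:{0<..<1}. x powr (b + 1 - 1) * (1 - x) powr (c + 1 - (b + 1) - 1) * (1 - z * x) powr (- (a + 1))))"
    by simp
  also have "\<dots> = a * b / c * hyp2F1 (a + 1) (b + 1) (c + 1) z"
  proof -
    have "Gamma (b + 1) = b * Gamma b" "Gamma (c + 1) = c * Gamma c"
      using assms by (auto intro!: Gamma_plus1 elim!: nonpos_Ints_cases)
    thus ?thesis using assms Gamma_real_neq_0[of b] Gamma_real_neq_0[of "c - b"]
      by (simp add: hyp2F1_def)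
  qed
  ultimately show ?thesis by (simp add: hyp2F1_def[abs_def] k_def)
qed

text \<open>
  The involution \<open>t \<mapsto> (1 - t) / (1 - z * t)\<close> of the unit interval sends \<open>t\<close>, \<open>1 - t\<close>, \<open>1 - z * t\<close>
  to \<open>1 - t\<close>, \<open>t\<close>, \<open>1\<close> up to powers of \<open>1 - z\<close> and \<open>1 - z * t\<close>, so it permutes the parameters of the
  Euler integrand.  It decreases, and is treated as the reflection \<open>t \<mapsto> 1 - t\<close> after the
  increasing map \<open>t \<mapsto> t * (1 - z) / (1 - z * t)\<close>.
\<close>

lemma hyp2F1_euler:
  assumes "0 < b" "b < c" "0 < z" "z < 1"
  shows "hyp2F1 a b c z = (1 - z) powr (c - a - b) * hyp2F1 (c - a) (c - b) c z"
proof -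
  define f where "f = (\<lambda>t::real. t powr (b - 1) * (1 - t) powr (c - b - 1) * (1 - z * t) powr (- a))"
  define f2 where "f2 = (\<lambda>t::real. t powr (c - b - 1) * (1 - t) powr (c - (c - b) - 1) * (1 - z * t) powr (- (c - a)))"
  define g where "g = (\<lambda>t::real. t * (1 - z) / (1 - z * t))"
  define g' where "g' = (\<lambda>t::real. (1 - z) / (1 - z * t)\<^sup>2)"
  have zt: "0 < 1 - z * t" if "0 \<le> t" "t \<le> 1" for t
  proof -
    have "z * t \<le> z" using that assms mult_left_mono[of t 1 z] by simp
    thus ?thesis using assms by linarith
  qed
  have int: "set_integrable lborel {0<..<1} f"
    unfolding f_def using assms by (intro hyp2F1_integrable) auto
  have int2: "set_integrable lborel {0<..<1} f2"
    unfolding f2_def using assms by (intro hyp2F1_integrable) auto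
  have sub: "f (1 - g t) * g' t = (1 - z) powr (c - a - b) * f2 t" if t: "0 < t" "t < 1" for t
  proof -
    have d: "0 < 1 - z * t" using zt t by simp
    define d q where "d = 1 - z * t" and "q = 1 - z"
    have dq: "0 < d" "0 < q" using d assms by (auto simp: d_def q_def)
    have e1: "1 - g t = (1 - t) / d"
      using d by (simp add: g_def d_def field_simps)
    have e2: "1 - (1 - t) / d = t * q / d"
      using d by (simp add: d_def q_def field_simps)
    have e3: "1 - z * ((1 - t) / d) = q / d"
      using d by (simp add: d_def q_def field_simps)
    have e4: "g' t = exp (ln q - 2 * ln d)"
      using dq by (simp add: g'_def exp_diff exp_double flip: d_def q_def)
    have "f (1 - g t) * g' t = q powr (c - a - b) *
        (t powr (c - b - 1) * (1 - t) powr (c - (c - b) - 1) * d powr (- (c - a)))"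
      unfolding f_def e1 e2 e3 e4 using dq t
      by (simp add: powr_def ln_div ln_mult exp_add[symmetric]) (simp add: algebra_simps)
    thus ?thesis by (simp add: f2_def d_def q_def)
  qed
  have gb: "0 < 1 - g t" "0 < g t" if "0 < t" "t < 1" for t :: real
    using that zt[of t] assms by (auto simp: g_def field_simps)
  have gc: "isCont g t" if "0 \<le> t" "t \<le> 1" for t
    unfolding g_def using zt[OF that] by (intro continuous_intros) auto
  have "(LBINT x=ereal 0..ereal 1. f (1 - x)) = (LBINT x=ereal 0..ereal 1. f (1 - g x) * g' x)"
  proof (rule interval_integral_substitution_nonneg(2))
    fix x :: real assume "ereal 0 < ereal x" "ereal x < ereal 1"
    hence x: "0 < x" "x < 1" by auto
    show "DERIV g x :> g' x"
      unfolding g_def g'_def using zt[of x] x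
      by (auto intro!: derivative_eq_intros simp: power2_eq_square divide_simps) (auto simp: algebra_simps)
    show "isCont (\<lambda>x. f (1 - x)) (g x)"
      unfolding f_def using gb[OF x] zt[of "1 - g x"] by (intro continuous_intros) auto
    show "isCont g' x" unfolding g'_def using zt[of x] x by (intro continuous_intros) auto
    show "0 \<le> f (1 - g x)" by (simp add: f_def)
  next
    show "((ereal \<circ> g \<circ> real_of_ereal) \<longlongrightarrow> ereal 0) (at_right (ereal 0))"
      unfolding ereal_tendsto_simps
      using gc[of 0] by (auto simp: isCont_def g_def intro: filterlim_mono at_le)
    show "((ereal \<circ> g \<circ> real_of_ereal) \<longlongrightarrow> ereal 1) (at_left (ereal 1))"
      unfolding ereal_tendsto_simps
      using gc[of 1] assms by (auto simp: isCont_def g_def intro: filterlim_mono at_le)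
    show "set_integrable lborel (einterval (ereal 0) (ereal 1)) (\<lambda>x. f (1 - g x) * g' x)"
      unfolding einterval_eq
      by (rule set_integrable_cong[THEN iffD2, OF refl refl _ set_integrable_mult_right[OF int2]])
         (use sub in auto)
  qed (use assms in \<open>auto simp: g'_def\<close>)
  also have "(LBINT x=ereal 0..ereal 1. f (1 - x)) = (LBINT x:{0<..<1}. f x)"
    by (simp only: interval_lebesgue_integral_def einterval_eq ereal_less_eq zero_le_one if_True
        set_integral_reflect)
  also have "(LBINT x=ereal 0..ereal 1. f (1 - g x) * g' x)
      = (LBINT x:{0<..<1}. (1 - z) powr (c - a - b) * f2 x)"
    by (simp only: interval_lebesgue_integral_def einterval_eq ereal_less_eq zero_le_one if_True)
       (intro set_lebesgue_integral_cong, use sub in auto)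
  finally have "(LBINT x:{0<..<1}. f x) = (1 - z) powr (c - a - b) * (LBINT x:{0<..<1}. f2 x)"
    by simp
  thus ?thesis
    unfolding hyp2F1_def f_def[symmetric] f2_def[symmetric] by (simp add: mult_ac)
qed

section \<open>The inner kernels\<close>

text \<open>
  The substitution \<open>h = H1 - 1/2\<close>, \<open>b = 2 * H2 - 1\<close> turns the hypothesis \<open>1/2 < H1 < H2 < 1\<close> into
  the inequalities below and shortens the exponents.
\<close>

locale kernel_exponents =
  fixes h b :: real
  assumes h_pos: "0 < h" and two_h_less_b: "2 * h < b" and b_less_1: "b < 1"
begin

lemma exponent_bounds: "0 < h" "h < 1/2" "h < b" "0 < b" "b < 1" "2 * h < b"
  using h_pos two_h_less_b b_less_1 by auto

text \<open>
  A Hoelder exponent common to \<open>F1\<close>, ..., \<open>F5\<close>.  It has to exceed \<open>h\<close>, so that increments of order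
  \<open>g\<close> make \<open>x powr (- h - 1)\<close> integrable at 0, and to stay below \<open>b - h\<close> and \<open>1 + h - b\<close>, the
  values of \<open>c - a - b\<close> for the hypergeometric functions involved.  The midpoint of the admissible
  interval is taken.
\<close>

definition g :: real where
  "g = (h + min (b - h) (1 + h - b)) / 2"

lemma g_bounds: "0 < g" "g < 1" "h < g" "g < b - h" "g < 1 + h - b"
  using exponent_bounds unfolding g_def by (auto simp: min_def field_simps)

abbreviation "f1 \<equiv> F1 (h + 1/2) ((b + 1) / 2)"
abbreviation "f2 \<equiv> F2 (h + 1/2) ((b + 1) / 2)"
abbreviation "f3 \<equiv> F3 (h + 1/2) ((b + 1) / 2)"
abbreviation "f4 \<equiv> F4 (h + 1/2) ((b + 1) / 2)"
abbreviation "f5 \<equiv> F5 (h + 1/2) ((b + 1) / 2)"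
abbreviation "d1 \<equiv> D1 (h + 1/2)"
abbreviation "d2 \<equiv> D2 (h + 1/2) ((b + 1) / 2)"
abbreviation "d3 \<equiv> D3 (h + 1/2) ((b + 1) / 2)"
abbreviation "d4 \<equiv> D4 (h + 1/2) ((b + 1) / 2)"
abbreviation "d5 \<equiv> D5 (h + 1/2) ((b + 1) / 2)"

lemma coefficient_eqs:
  "d1 = (1 - 2 * h) * Beta (1 - h) (1 - h)"
  "d2 = (1 - b) / 2 * Beta (1 - h) (1 - h)"
  "d3 = (b - 2 * h) * Beta (1 - h) b"
  "d4 = h * (1 - h) / (b - h + 1) * Beta (1 - h) b"
  "d5 = h * Beta (1 - h) b"
proof -
  have e: "3/2 - (h + 1/2) = 1 - h" "2 * ((b + 1) / 2) - 1 = b" "h + 1/2 - 1/2 = h"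
    "2 * ((b + 1) / 2) - (h + 1/2) + 1/2 = b - h + 1" by (simp_all add: field_simps)
  show "d1 = (1 - 2 * h) * Beta (1 - h) (1 - h)"
    "d2 = (1 - b) / 2 * Beta (1 - h) (1 - h)"
    "d3 = (b - 2 * h) * Beta (1 - h) b"
    "d4 = h * (1 - h) / (b - h + 1) * Beta (1 - h) b"
    "d5 = h * Beta (1 - h) b"
    unfolding D1_def D2_def D3_def D4_def D5_def e by (simp_all add: field_simps)
qed

lemma hypergeometric_eqs:
  assumes "z \<le> 1"
  shows "f1 z = hyp2F1 (1 - b) (1 - h) (2 - 2 * h) z"
    and "f2 z = hyp2F1 (1 + b - 2 * h) (1 - h) (3 - 2 * h) z"
    and "f5 z = hyp2F1 (b - 2 * h) b (1 + b - h) z"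
proof -
  have e: "2 - 2 * ((b + 1) / 2) = 1 - b" "3/2 - (h + 1/2) = 1 - h" "3 - 2 * (h + 1/2) = 2 - 2 * h"
     "1 + 2 * ((b + 1) / 2) - 2 * (h + 1/2) = 1 + b - 2 * h" "4 - 2 * (h + 1/2) = 3 - 2 * h"
     "2 * ((b + 1) / 2) - 2 * (h + 1/2) = b - 2 * h" "2 * ((b + 1) / 2) - 1 = b"
     "2 * ((b + 1) / 2) - (h + 1/2) + 1/2 = 1 + b - h"
    by (simp_all add: field_simps)
  show "f1 z = hyp2F1 (1 - b) (1 - h) (2 - 2 * h) z"
    "f2 z = hyp2F1 (1 + b - 2 * h) (1 - h) (3 - 2 * h) z"
    "f5 z = hyp2F1 (b - 2 * h) b (1 + b - h) z"
    unfolding F1_def F2_def F5_def e using assms exponent_bounds g_bounds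
    by (intro hyp2F1_ext_eq[where g = g]; simp)+
qed

lemma hypergeometric_eqs':
  assumes "0 \<le> z"
  shows "f3 z = hyp2F1 h (1 - h) (1 + b - h) (1 - z)"
    and "f4 z = hyp2F1 (b - 2 * h + 1) b (b - h + 2) (1 - z)"
proof -
  have e: "3/2 - (h + 1/2) = 1 - h" "h + 1/2 - 1/2 = h" "2 * ((b + 1) / 2) - 2 * (h + 1/2) + 1 = b - 2 * h + 1"
     "2 * ((b + 1) / 2) - 1 = b" "2 * ((b + 1) / 2) - (h + 1/2) + 3/2 = b - h + 2"
     "2 * ((b + 1) / 2) - (h + 1/2) + 1/2 = 1 + b - h"
    by (simp_all add: field_simps)
  show "f3 z = hyp2F1 h (1 - h) (1 + b - h) (1 - z)"
    "f4 z = hyp2F1 (b - 2 * h + 1) b (b - h + 2) (1 - z)"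
    unfolding F3_def F4_def e using assms exponent_bounds g_bounds
    by (intro hyp2F1_ext_eq[where g = g]; simp)+
qed

text \<open>
  The bracket that multiplies \<open>(T - u) powr (1/2 - H1)\<close> in \<open>L_minus\<close>; it is the profile of \<open>rho\<close> in
  the variable \<open>s / u\<close>.
\<close>

definition G :: "real \<Rightarrow> real" where
  "G z = (d3 + d5 * z) * f3 z + d4 * z powr (b - h) * (1 - z) * f4 z - d5 * z powr (b - h) * f5 z"

lemma psi_integral:
  assumes "0 < v" "v < s"
  shows "(LBINT t:{0<..<v}. (v - t) powr (- h) * t powr (- h) * (s - t) powr (b - 1))
      = Beta (1 - h) (1 - h) * v powr (1 - 2 * h) * s powr (b - 1) * hyp2F1 (1 - b) (1 - h) (2 - 2 * h) (v / s)"
proof -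
  have pt: "(v - v * x) powr (- h) * (v * x) powr (- h) * (s - v * x) powr (b - 1)
     = v powr (- 2 * h) * s powr (b - 1) *
       (x powr (1 - h - 1) * (1 - x) powr (2 - 2 * h - (1 - h) - 1) * (1 - v / s * x) powr (- (1 - b)))"
    if x: "0 < x" "x < 1" for x
  proof -
    have vx: "v * x < v" using x assms by simp
    hence vx: "v * x < s" using assms by linarith
    have e: "v - v * x = v * (1 - x)" "s - v * x = s * (1 - v / s * x)"
      using assms by (auto simp: field_simps)
    have "0 < 1 - v / s * x" using vx assms by (simp add: field_simps)
    thus ?thesis unfolding e using x assms
      by (simp add: powr_def ln_mult exp_add[symmetric]) (simp add: algebra_simps)
  qed
  have "(LBINT t:{0<..<v}. (v - t) powr (- h) * t powr (- h) * (s - t) powr (b - 1))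
     = v * (LBINT x:{0<..<1}. (v - v * x) powr (- h) * (v * x) powr (- h) * (s - v * x) powr (b - 1))"
    using assms by (subst set_integral_affine[of v]) auto
  also have "\<dots> = v * (LBINT x:{0<..<1}. v powr (- 2 * h) * s powr (b - 1) *
       (x powr (1 - h - 1) * (1 - x) powr (2 - 2 * h - (1 - h) - 1) * (1 - v / s * x) powr (- (1 - b))))"
    using pt by (intro arg_cong2[of _ _ _ _ "(*)"] set_lebesgue_integral_cong refl) auto
  also have "\<dots> = v * (v powr (- 2 * h) * s powr (b - 1) *
       (Beta (1 - h) (2 - 2 * h - (1 - h)) * hyp2F1 (1 - b) (1 - h) (2 - 2 * h) (v / s)))"
    using exponent_bounds by (subst Beta_times_hyp2F1) auto
  also have "2 - 2 * h - (1 - h) = 1 - h" by simp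
  also have "v * (v powr (- 2 * h) * s powr (b - 1) * (Beta (1 - h) (1 - h) * hyp2F1 (1 - b) (1 - h) (2 - 2 * h) (v / s)))
    = (v powr 1 * v powr (- 2 * h)) * s powr (b - 1) * (Beta (1 - h) (1 - h) * hyp2F1 (1 - b) (1 - h) (2 - 2 * h) (v / s))"
    using assms by simp
  also have "v powr 1 * v powr (- 2 * h) = v powr (1 - 2 * h)"
    by (simp only: powr_add[symmetric]) simp
  finally show ?thesis by (simp add: mult_ac)
qed

text \<open>
  The product rule gives \<open>F1\<close> and its derivative; the latter is a hypergeometric function that blows
  up at 1, and Euler's transformation rewrites it as \<open>(1 - z) powr (b - 1 - h)\<close> times the bounded
  function \<open>F2\<close>.
\<close>

lemma psi_eq:
  assumes "0 < u" "u < s"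
  shows "psi (h + 1/2) ((b + 1) / 2) u s
     = d1 * u powr (- 2 * h) * s powr (b - 1) * f1 (u / s)
       + d2 * u powr (1 - 2 * h) * s powr (b - 2) * (1 - u / s) powr (b - 1 - h) * f2 (u / s)"
proof -
  define z where "z = u / s"
  have z: "0 < z" "z < 1" using assms by (auto simp: z_def)
  let ?F = "\<lambda>a. hyp2F1 a (1 - h) (2 - 2 * h)"
  have euler: "hyp2F1 (1 - b + 1) (1 - h + 1) (2 - 2 * h + 1) z = (1 - z) powr (b - 1 - h) * f2 z"
  proof -
    have e: "2 - 2 * h + 1 - (1 - b + 1) - (1 - h + 1) = b - 1 - h"
      "2 - 2 * h + 1 - (1 - b + 1) = 1 + b - 2 * h" "2 - 2 * h + 1 - (1 - h + 1) = 1 - h"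
      by simp_all
    have e': "2 - 2 * h + 1 = 3 - 2 * h" "1 + b - 2 * h - (1 - h + 1) = b - 1 - h" by simp_all
    have "hyp2F1 (1 - b + 1) (1 - h + 1) (2 - 2 * h + 1) z
       = (1 - z) powr (2 - 2 * h + 1 - (1 - b + 1) - (1 - h + 1)) *
         hyp2F1 (2 - 2 * h + 1 - (1 - b + 1)) (2 - 2 * h + 1 - (1 - h + 1)) (2 - 2 * h + 1) z"
      using exponent_bounds z by (intro hyp2F1_euler) auto
    thus ?thesis using z by (simp only: e) (simp only: e' hypergeometric_eqs(2) less_imp_le)
  qed
  have "((\<lambda>v. Beta (1 - h) (1 - h) * v powr (1 - 2 * h) * s powr (b - 1) * ?F (1 - b) (v / s))
     has_real_derivative
       Beta (1 - h) (1 - h) * ((1 - 2 * h) * u powr (- 2 * h)) * s powr (b - 1) * ?F (1 - b) z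
       + Beta (1 - h) (1 - h) * u powr (1 - 2 * h) * s powr (b - 1) *
          ((1 - b) * (1 - h) / (2 - 2 * h) * hyp2F1 (1 - b + 1) (1 - h + 1) (2 - 2 * h + 1) z * (1 / s))) (at u)"
  proof -
    have D: "((\<lambda>v. ?F (1 - b) (v / s)) has_real_derivative
         (1 - b) * (1 - h) / (2 - 2 * h) * hyp2F1 (1 - b + 1) (1 - h + 1) (2 - 2 * h + 1) z * (1 / s)) (at u)"
    proof (rule DERIV_chain2[where g = "\<lambda>v. v / s" and f = "?F (1 - b)"])
      show "(?F (1 - b) has_real_derivative (1 - b) * (1 - h) / (2 - 2 * h) *
              hyp2F1 (1 - b + 1) (1 - h + 1) (2 - 2 * h + 1) z) (at (u / s))"
        unfolding z_def[symmetric] using z exponent_bounds by (intro DERIV_hyp2F1) auto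
    qed (use assms in \<open>auto intro!: derivative_eq_intros\<close>)
    have "((\<lambda>v. v powr (1 - 2 * h)) has_real_derivative (1 - 2 * h) * u powr (- 2 * h)) (at u)"
      using assms by (auto intro!: derivative_eq_intros)
    from DERIV_mult[OF DERIV_cmult_right[OF DERIV_cmult[OF this, of "Beta (1 - h) (1 - h)"], of "s powr (b - 1)"] D]
    show ?thesis by (rule DERIV_cong)
       (simp add: z_def mult_ac)
  qed
  hence "((\<lambda>v. LBINT t:{0<..<v}. (v - t) powr (- h) * t powr (- h) * (s - t) powr (b - 1))
     has_real_derivative
       Beta (1 - h) (1 - h) * ((1 - 2 * h) * u powr (- 2 * h)) * s powr (b - 1) * ?F (1 - b) z
       + Beta (1 - h) (1 - h) * u powr (1 - 2 * h) * s powr (b - 1) *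
          ((1 - b) * (1 - h) / (2 - 2 * h) * hyp2F1 (1 - b + 1) (1 - h + 1) (2 - 2 * h + 1) z * (1 / s))) (at u)"
    by (rule has_field_derivative_transform_within_open[where S = "{0<..<s}"])
       (use assms in \<open>auto simp: psi_integral\<close>)
  hence "psi (h + 1/2) ((b + 1) / 2) u s =
       Beta (1 - h) (1 - h) * ((1 - 2 * h) * u powr (- 2 * h)) * s powr (b - 1) * ?F (1 - b) z
       + Beta (1 - h) (1 - h) * u powr (1 - 2 * h) * s powr (b - 1) *
          ((1 - b) * (1 - h) / (2 - 2 * h) * hyp2F1 (1 - b + 1) (1 - h + 1) (2 - 2 * h + 1) z * (1 / s))"
    unfolding psi_def by (intro DERIV_imp_deriv) (simp add: add_divide_distrib)
  also have "?F (1 - b) z = f1 z" using z by (simp add: hypergeometric_eqs)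
  also have "hyp2F1 (1 - b + 1) (1 - h + 1) (2 - 2 * h + 1) z = (1 - z) powr (b - 1 - h) * f2 z" by (rule euler)
  also have "(1 - b) * (1 - h) / (2 - 2 * h) = (1 - b) / 2"
    using exponent_bounds by (simp add: field_simps)
  also have "Beta (1 - h) (1 - h) * u powr (1 - 2 * h) * s powr (b - 1) *
          ((1 - b) / 2 * ((1 - z) powr (b - 1 - h) * f2 z) * (1 / s))
     = d2 * u powr (1 - 2 * h) * (s powr (b - 1) / s) * (1 - z) powr (b - 1 - h) * f2 z"
    by (simp add: coefficient_eqs)
  also have "s powr (b - 1) / s = s powr (b - 2)"
    using assms powr_diff[of s "b - 1" 1] by simp
  also have "Beta (1 - h) (1 - h) * ((1 - 2 * h) * u powr (- 2 * h)) * s powr (b - 1) * f1 z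
     = d1 * u powr (- 2 * h) * s powr (b - 1) * f1 z"
    by (simp add: coefficient_eqs)
  finally show ?thesis by (simp add: z_def)
qed

text \<open>
  The reversed affine parametrisation, from \<open>v\<close> down to \<open>s\<close>, puts the hypergeometric argument
  \<open>1 - s / v\<close> into the unit interval.
\<close>

lemma phi_integral:
  assumes "0 < s" "s < v"
  shows "(LBINT t:{s<..<v}. (v - t) powr (- h) * t powr (- h) * (t - s) powr (b - 1))
      = Beta (1 - h) b * ((v - s) powr (b - h) * v powr (- h)) * hyp2F1 h (1 - h) (1 + b - h) (1 - s / v)"
proof -
  define c where "c = v - s"
  have c: "0 < c" "c < v" using assms by (auto simp: c_def)
  have pt: "(v - (s + c * (1 - x))) powr (- h) * (s + c * (1 - x)) powr (- h) * (s + c * (1 - x) - s) powr (b - 1)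
     = c powr (b - h - 1) * v powr (- h) *
       (x powr (1 - h - 1) * (1 - x) powr (1 + b - h - (1 - h) - 1) * (1 - (1 - s / v) * x) powr (- h))"
    if x: "0 < x" "x < 1" for x
  proof -
    have cx: "c * x < c" using x c by simp
    define d where "d = 1 - (1 - s / v) * x"
    have e: "v - (s + c * (1 - x)) = c * x" "s + c * (1 - x) = v * d" "s + c * (1 - x) - s = c * (1 - x)"
      using assms by (auto simp: field_simps c_def d_def)
    have "0 < v * d" using cx assms unfolding e(2)[symmetric] by (auto simp: algebra_simps c_def)
    hence d: "0 < d" using assms by (simp add: zero_less_mult_iff)
    show ?thesis unfolding e(1,3) unfolding e(2) d_def[symmetric] using x c d assms
      by (simp add: powr_def ln_mult exp_add[symmetric]) (simp add: algebra_simps)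
  qed
  have "(LBINT t:{s<..<v}. (v - t) powr (- h) * t powr (- h) * (t - s) powr (b - 1))
     = c * (LBINT x:{0<..<1}. (v - (s + c * x)) powr (- h) * (s + c * x) powr (- h) * (s + c * x - s) powr (b - 1))"
    using assms c by (subst set_integral_affine[of c]) (auto simp: c_def)
  also have "\<dots> = c * (LBINT x:{0<..<1}. (v - (s + c * (1 - x))) powr (- h) * (s + c * (1 - x)) powr (- h)
        * (s + c * (1 - x) - s) powr (b - 1))"
    by (subst (2) set_integral_reflect[symmetric]) simp
  also have "\<dots> = c * (LBINT x:{0<..<1}. c powr (b - h - 1) * v powr (- h) *
       (x powr (1 - h - 1) * (1 - x) powr (1 + b - h - (1 - h) - 1) * (1 - (1 - s / v) * x) powr (- h)))"
    using pt by (intro arg_cong2[of _ _ _ _ "(*)"] set_lebesgue_integral_cong refl) auto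
  also have "\<dots> = c * (c powr (b - h - 1) * v powr (- h) *
       (Beta (1 - h) (1 + b - h - (1 - h)) * hyp2F1 h (1 - h) (1 + b - h) (1 - s / v)))"
    using exponent_bounds by (subst Beta_times_hyp2F1) auto
  also have "1 + b - h - (1 - h) = b" by simp
  also have "c * (c powr (b - h - 1) * v powr (- h) * (Beta (1 - h) b * hyp2F1 h (1 - h) (1 + b - h) (1 - s / v)))
    = (c powr 1 * c powr (b - h - 1)) * v powr (- h) * (Beta (1 - h) b * hyp2F1 h (1 - h) (1 + b - h) (1 - s / v))"
    using c by simp
  also have "c powr 1 * c powr (b - h - 1) = c powr (b - h)"
    by (simp only: powr_add[symmetric]) simp
  finally show ?thesis by (simp add: mult_ac c_def)
qed

lemma phi_eq:
  assumes "0 < s" "s < u"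
  shows "phi (h + 1/2) ((b + 1) / 2) u s
     = (u - s) powr (b - h - 1) * u powr (- h) *
       ((d3 + d5 * (s / u)) * f3 (s / u) + d4 * (s / u) powr (b - h) * (1 - s / u) * f4 (s / u))"
proof -
  define z where "z = s / u"
  have z: "0 < z" "z < 1" "s = z * u" "0 < u" using assms by (auto simp: z_def)
  let ?F = "hyp2F1 h (1 - h) (1 + b - h)"
  let ?B = "Beta (1 - h) b"
  let ?F' = "hyp2F1 (h + 1) (1 - h + 1) (1 + b - h + 1) (1 - z)"
  have euler: "?F' = z powr (b - h - 1) * f4 z"
  proof -
    have e: "1 + b - h + 1 - (h + 1) - (1 - h + 1) = b - h - 1"
      "1 + b - h + 1 - (h + 1) = b - 2 * h + 1" "1 + b - h + 1 - (1 - h + 1) = b"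
      by simp_all
    have e': "1 + b - h + 1 = b - h + 2" "b - 2 * h + 1 - (1 - h + 1) = b - h - 1" by simp_all
    have "?F' = (1 - (1 - z)) powr (1 + b - h + 1 - (h + 1) - (1 - h + 1)) *
         hyp2F1 (1 + b - h + 1 - (h + 1)) (1 + b - h + 1 - (1 - h + 1)) (1 + b - h + 1) (1 - z)"
      using exponent_bounds z by (intro hyp2F1_euler) auto
    moreover have "1 - (1 - z) = z" by simp
    ultimately show ?thesis using z by (simp only: e) (simp only: e' hypergeometric_eqs'(2) less_imp_le)
  qed
  have D: "((\<lambda>v. ?F (1 - s / v)) has_real_derivative h * (1 - h) / (1 + b - h) * ?F' * (s / u\<^sup>2)) (at u)"
  proof (rule DERIV_chain2[where g = "\<lambda>v. 1 - s / v" and f = ?F])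
    show "(?F has_real_derivative h * (1 - h) / (1 + b - h) * ?F') (at (1 - s / u))"
      unfolding z_def[symmetric] using z exponent_bounds by (intro DERIV_hyp2F1) auto
  qed (use assms in \<open>auto intro!: derivative_eq_intros simp: power2_eq_square\<close>)
  have D2: "((\<lambda>v. (v - s) powr (b - h) * v powr (- h)) has_real_derivative
       ((b - h) * (u - s) powr (b - h - 1) * u powr (- h) - h * (u - s) powr (b - h) * u powr (- h - 1))) (at u)"
    using assms by (auto intro!: derivative_eq_intros)
  have "((\<lambda>v. ?B * ((v - s) powr (b - h) * v powr (- h)) * ?F (1 - s / v)) has_real_derivative
      ?B * ((b - h) * (u - s) powr (b - h - 1) * u powr (- h) - h * (u - s) powr (b - h) * u powr (- h - 1)) * ?F (1 - z)
      + ?B * ((u - s) powr (b - h) * u powr (- h)) * (h * (1 - h) / (1 + b - h) * ?F' * (s / u\<^sup>2))) (at u)"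
    using DERIV_mult[OF DERIV_cmult[OF D2, of ?B] D]
    by (rule DERIV_cong) (simp add: z_def mult_ac)
  hence "((\<lambda>v. LBINT t:{s<..<v}. (v - t) powr (- h) * t powr (- h) * (t - s) powr (b - 1))
     has_real_derivative
      ?B * ((b - h) * (u - s) powr (b - h - 1) * u powr (- h) - h * (u - s) powr (b - h) * u powr (- h - 1)) * ?F (1 - z)
      + ?B * ((u - s) powr (b - h) * u powr (- h)) * (h * (1 - h) / (1 + b - h) * ?F' * (s / u\<^sup>2))) (at u)"
    by (rule has_field_derivative_transform_within_open[where S = "{s<..}"])
       (use assms in \<open>auto simp: phi_integral\<close>)
  hence "phi (h + 1/2) ((b + 1) / 2) u s =
      ?B * ((b - h) * (u - s) powr (b - h - 1) * u powr (- h) - h * (u - s) powr (b - h) * u powr (- h - 1)) * ?F (1 - z)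
      + ?B * ((u - s) powr (b - h) * u powr (- h)) * (h * (1 - h) / (1 + b - h) * ?F' * (s / u\<^sup>2))"
    unfolding phi_def by (intro DERIV_imp_deriv) (simp add: add_divide_distrib)
  also have "?F (1 - z) = f3 z" using z by (simp add: hypergeometric_eqs')
  also have "?F' = z powr (b - h - 1) * f4 z" by (rule euler)
  also have "(u - s) powr (b - h) = (u - s) powr (b - h - 1) * (u * (1 - z))"
    using assms z powr_add[of "u - s" "b - h - 1" 1] by (simp add: algebra_simps)
  also have "u powr (- h - 1) = u powr (- h) / u"
    using z powr_diff[of u "- h" 1] by simp
  also have "z powr (b - h - 1) = z powr (b - h) / z"
    using z powr_diff[of z "b - h" 1] by simp
  also have "s / u\<^sup>2 = z / u" by (simp add: z_def power2_eq_square)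
  finally have "phi (h + 1/2) ((b + 1) / 2) u s =
     ?B * ((b - h) * (u - s) powr (b - h - 1) * u powr (- h)
       - h * ((u - s) powr (b - h - 1) * (u * (1 - z))) * (u powr (- h) / u)) * f3 z
     + ?B * ((u - s) powr (b - h - 1) * (u * (1 - z)) * u powr (- h))
       * (h * (1 - h) / (1 + b - h) * (z powr (b - h) / z * f4 z) * (z / u))" .
  moreover have "B * ((b - h) * A * U - h * (A * (u * (1 - z))) * (U / u)) * P
       + B * (A * (u * (1 - z)) * U) * (K * (Z / z * Q) * (z / u))
     = A * U * (((b - 2 * h) * B + h * B * z) * P + K * B * Z * (1 - z) * Q)" for A B K P Q U Z :: real
    using z by (simp add: field_simps)
  moreover have "b - h + 1 = 1 + b - h" by simp
  ultimately show ?thesis unfolding z_def[symmetric] coefficient_eqs by (simp only:)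
qed

text \<open>
  Here the domain of integration is fixed and the kernel is smooth in \<open>u\<close>, so one differentiates
  under the integral sign before applying Euler's transformation.
\<close>

lemma tau_eq:
  assumes "0 < s" "s < u"
  shows "tau (h + 1/2) ((b + 1) / 2) u s
     = - ((u - s) powr (b - h - 1) * u powr (- h) * (d5 * (s / u) powr (b - h) * f5 (s / u)))"
proof -
  define z where "z = s / u"
  have z: "0 < z" "z < 1" "s = z * u" "0 < u" using assms by (auto simp: z_def)
  define k where "k = (\<lambda>x::real. x powr (- h) * (1 - x) powr (b - 1))"
  define e where "e = (u - s) / 2"
  have e: "0 < e" "s < u - e" using assms by (auto simp: e_def field_simps)
  have integral: "(LBINT t:{0<..<s}. (v - t) powr (- h) * t powr (- h) * (s - t) powr (b - 1))
     = s powr (b - h) * (LBINT x:{0<..<1}. k x * (v - s * x) powr (- h))" for v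
  proof -
    have pt: "(s * x) powr (- h) * (s - s * x) powr (b - 1) = s powr (b - h - 1) * k x"
      if x: "0 < x" "x < 1" for x
    proof -
      have e: "s - s * x = s * (1 - x)" by (simp add: algebra_simps)
      show ?thesis unfolding e k_def using x assms
        by (simp add: powr_def ln_mult exp_add[symmetric]) (simp add: algebra_simps)
    qed
    have "(LBINT t:{0<..<s}. (v - t) powr (- h) * t powr (- h) * (s - t) powr (b - 1))
        = s * (LBINT x:{0<..<1}. (v - s * x) powr (- h) * (s * x) powr (- h) * (s - s * x) powr (b - 1))"
      using assms by (subst set_integral_affine[of s]) auto
    also have "\<dots> = s * (LBINT x:{0<..<1}. s powr (b - h - 1) * (k x * (v - s * x) powr (- h)))"
      using pt by (intro arg_cong2[of _ _ _ _ "(*)"] set_lebesgue_integral_cong refl)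
        (auto simp: mult_ac)
    also have "\<dots> = (s powr 1 * s powr (b - h - 1)) * (LBINT x:{0<..<1}. k x * (v - s * x) powr (- h))"
      using assms by simp
    also have "s powr 1 * s powr (b - h - 1) = s powr (b - h)"
      by (simp only: powr_add[symmetric]) simp
    finally show ?thesis .
  qed
  have vx: "e \<le> v - s * x \<and> 0 < v - s * x" if "\<bar>v - u\<bar> < e" "x \<in> {0<..<1}" for v x
  proof -
    have "u - e \<le> v" using that by linarith
    moreover have "s * x \<le> s" using that assms by simp
    moreover have "u - e - s = e" unfolding e_def by (simp add: field_simps)
    ultimately show ?thesis using e by linarith
  qed
  have "((\<lambda>v. LBINT x:{0<..<1}. k x * (v - s * x) powr (- h)) has_real_derivative
           (LBINT x:{0<..<1}. k x * (- h * (u - s * x) powr (- h - 1)))) (at u)"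
  proof (rule has_real_derivative_set_integral)
    show "set_integrable lborel {0<..<1} k"
      using beta_integrable[of "1 - h" b] exponent_bounds by (simp add: k_def)
    show "continuous_on {0<..<1} k" unfolding k_def by (intro continuous_intros) auto
    fix v x assume vx': "\<bar>v - u\<bar> < e" "x \<in> {0<..<1::real}"
    show "((\<lambda>v. (v - s * x) powr (- h)) has_real_derivative - h * (v - s * x) powr (- h - 1)) (at v)"
      using vx[OF vx'] by (auto intro!: derivative_eq_intros)
    show "\<bar>(v - s * x) powr (- h)\<bar> \<le> e powr (- h)"
      using vx[OF vx'] e exponent_bounds by (auto intro!: powr_mono2')
    have "h * (v - s * x) powr (- h - 1) \<le> h * e powr (- h - 1)"
      using vx[OF vx'] e exponent_bounds by (intro mult_left_mono powr_mono2') auto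
    thus "\<bar>- h * (v - s * x) powr (- h - 1)\<bar> \<le> h * e powr (- h - 1)"
      using exponent_bounds by (simp add: abs_mult)
  next
    fix v assume "\<bar>v - u\<bar> < e"
    with vx[of v] show "continuous_on {0<..<1} (\<lambda>x. (v - s * x) powr (- h))"
      by (intro continuous_intros) force+
  next
    show "continuous_on {0<..<1} (\<lambda>x. - h * (u - s * x) powr (- h - 1))"
      using vx[of u] e by (intro continuous_intros) force+
  qed (use e in auto)
  from DERIV_cmult[OF this, of "s powr (b - h)"]
  have "tau (h + 1/2) ((b + 1) / 2) u s
      = s powr (b - h) * (LBINT x:{0<..<1}. k x * (- h * (u - s * x) powr (- h - 1)))"
    unfolding tau_def by (intro DERIV_imp_deriv) (simp add: add_divide_distrib integral)
  also have "(LBINT x:{0<..<1}. k x * (- h * (u - s * x) powr (- h - 1)))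
     = (LBINT x:{0<..<1}. - h * u powr (- h - 1) * (x powr (1 - h - 1) * (1 - x) powr (1 + b - h - (1 - h) - 1)
           * (1 - z * x) powr (- (h + 1))))"
  proof (intro set_lebesgue_integral_cong allI impI)
    fix x :: real assume x: "x \<in> {0<..<1}"
    have "u - s * x = u * (1 - z * x)" using z by (simp add: algebra_simps)
    moreover have "0 < 1 - z * x"
      using vx[of u x] x e z calculation by (simp add: zero_less_mult_iff)
    ultimately show "k x * (- h * (u - s * x) powr (- h - 1)) =
       - h * u powr (- h - 1) * (x powr (1 - h - 1) * (1 - x) powr (1 + b - h - (1 - h) - 1)
           * (1 - z * x) powr (- (h + 1)))"
      using z by (simp add: k_def powr_mult)
  qed simp
  also have "\<dots> = - h * u powr (- h - 1) * (Beta (1 - h) (1 + b - h - (1 - h)) * hyp2F1 (h + 1) (1 - h) (1 + b - h) z)"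
    using exponent_bounds by (simp only: set_integral_mult_right) (subst Beta_times_hyp2F1, auto)
  also have "hyp2F1 (h + 1) (1 - h) (1 + b - h) z
      = (1 - z) powr (1 + b - h - (h + 1) - (1 - h)) * hyp2F1 (1 + b - h - (h + 1)) (1 + b - h - (1 - h)) (1 + b - h) z"
    using exponent_bounds z by (intro hyp2F1_euler) auto
  also have "1 + b - h - (h + 1) - (1 - h) = b - h - 1" by simp
  also have "1 + b - h - (h + 1) = b - 2 * h" by simp
  also have "1 + b - h - (1 - h) = b" by simp
  also have "hyp2F1 (b - 2 * h) b (1 + b - h) z = f5 z"
    using z by (simp add: hypergeometric_eqs)
  also have "s powr (b - h) * (- h * u powr (- h - 1) * (Beta (1 - h) b * ((1 - z) powr (b - h - 1) * f5 z)))
     = - (s powr (b - h) * u powr (- h - 1) * (1 - z) powr (b - h - 1)) * d5 * f5 z"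
    by (simp add: coefficient_eqs)
  also have "s powr (b - h) * u powr (- h - 1) * (1 - z) powr (b - h - 1) = (u - s) powr (b - h - 1) * u powr (- h) * z powr (b - h)"
  proof -
    have "u - s = u * (1 - z)" using z by (simp add: algebra_simps)
    thus ?thesis unfolding z(3) using z
      by (simp add: powr_def ln_mult exp_add[symmetric]) (simp add: algebra_simps)
  qed
  finally show ?thesis by (simp add: z_def mult_ac)
qed

lemma rho_eq:
  assumes "0 < s" "s < u"
  shows "rho (h + 1/2) ((b + 1) / 2) u s = (u - s) powr (b - h - 1) * u powr (- h) * G (s / u)"
  unfolding rho_def phi_eq[OF assms] tau_eq[OF assms] G_def by (simp add: algebra_simps)

end

section \<open>Hoelder continuous functions on the unit interval\<close>

definition holder_unit :: "real \<Rightarrow> (real \<Rightarrow> real) \<Rightarrow> bool" where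
  "holder_unit g f \<longleftrightarrow> (\<exists>C. \<forall>z\<in>{0..1}. \<forall>w\<in>{0..1}. \<bar>f z - f w\<bar> \<le> C * \<bar>z - w\<bar> powr g)"

lemma holder_unitD:
  assumes "holder_unit g f"
  obtains C where "C \<ge> 0" "\<And>z w. z \<in> {0..1} \<Longrightarrow> w \<in> {0..1} \<Longrightarrow> \<bar>f z - f w\<bar> \<le> C * \<bar>z - w\<bar> powr g"
proof -
  obtain C where C: "\<And>z w. z \<in> {0..1} \<Longrightarrow> w \<in> {0..1} \<Longrightarrow> \<bar>f z - f w\<bar> \<le> C * \<bar>z - w\<bar> powr g"
    using assms unfolding holder_unit_def by blast
  have le: "C * \<bar>z - w\<bar> powr g \<le> max C 0 * \<bar>z - w\<bar> powr g" for z w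
    by (intro mult_right_mono) auto
  show ?thesis by (rule that[of "max C 0", OF _ order_trans[OF C le]]) auto
qed

lemma holder_unit_continuous:
  assumes "holder_unit g f" "0 < g"
  shows "continuous_on {0..1} f"
  unfolding continuous_on_def
proof
  fix z :: real assume z: "z \<in> {0..1}"
  obtain C where C0: "C \<ge> 0" and C: "\<And>z w. z \<in> {0..1} \<Longrightarrow> w \<in> {0..1} \<Longrightarrow> \<bar>f z - f w\<bar> \<le> C * \<bar>z - w\<bar> powr g"
    by (rule holder_unitD[OF assms(1)]) (rule that; blast)
  have "((\<lambda>w. \<bar>w - z\<bar>) \<longlongrightarrow> 0) (at z within {0..1})"
    by (intro tendsto_rabs_zero LIM_zero tendsto_ident_at)
  hence "((\<lambda>w. \<bar>w - z\<bar> powr g) \<longlongrightarrow> 0 powr g) (at z within {0..1})"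
    using assms by (intro tendsto_powr' tendsto_const) auto
  hence lim: "((\<lambda>w. C * \<bar>w - z\<bar> powr g) \<longlongrightarrow> 0) (at z within {0..1})"
    by (intro tendsto_mult_right_zero) simp
  show "(f \<longlongrightarrow> f z) (at z within {0..1})"
  proof (rule Lim_null_comparison[OF _ lim, THEN LIM_zero_cancel])
    show "\<forall>\<^sub>F w in at z within {0..1}. norm (f w - f z) \<le> C * \<bar>w - z\<bar> powr g"
      unfolding eventually_at_filter using C[OF _ z] by (intro always_eventually) auto
  qed
qed

lemma holder_unit_bounded:
  assumes "holder_unit g f" "0 < g"
  obtains M where "M \<ge> 0" "\<And>z. z \<in> {0..1} \<Longrightarrow> \<bar>f z\<bar> \<le> M"
proof -
  have "bounded (f ` {0..1})"
    using holder_unit_continuous[OF assms] by (intro compact_imp_bounded compact_continuous_image) auto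
  then obtain M where "\<forall>y\<in>f ` {0..1}. norm y \<le> M"
    unfolding bounded_iff by blast
  hence M: "\<And>z. z \<in> {0..1} \<Longrightarrow> \<bar>f z\<bar> \<le> M" by simp
  from M[of 0] have "0 \<le> M" by simp
  with M show ?thesis by (rule that[rotated])
qed

lemma holder_unit_add:
  assumes "holder_unit g f" "holder_unit g f'"
  shows "holder_unit g (\<lambda>z. f z + f' z)"
proof -
  obtain C where C0: "C \<ge> 0" and C: "\<And>z w. z \<in> {0..1} \<Longrightarrow> w \<in> {0..1} \<Longrightarrow> \<bar>f z - f w\<bar> \<le> C * \<bar>z - w\<bar> powr g"
    by (rule holder_unitD[OF assms(1)]) (rule that; blast)
  obtain C' where C0': "C' \<ge> 0" and C': "\<And>z w. z \<in> {0..1} \<Longrightarrow> w \<in> {0..1} \<Longrightarrow> \<bar>f' z - f' w\<bar> \<le> C' * \<bar>z - w\<bar> powr g"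
    by (rule holder_unitD[OF assms(2)]) (rule that; blast)
  show ?thesis unfolding holder_unit_def
  proof (intro exI[of _ "C + C'"] ballI)
    fix z w :: real assume zw: "z \<in> {0..1}" "w \<in> {0..1}"
    show "\<bar>f z + f' z - (f w + f' w)\<bar> \<le> (C + C') * \<bar>z - w\<bar> powr g"
      using C[OF zw] C'[OF zw] by (simp add: distrib_right)
  qed
qed

lemma holder_unit_mult:
  assumes "holder_unit g f" "holder_unit g f'" "0 < g"
  shows "holder_unit g (\<lambda>z. f z * f' z)"
proof -
  obtain C where C: "C \<ge> 0" "\<And>z w. z \<in> {0..1} \<Longrightarrow> w \<in> {0..1} \<Longrightarrow> \<bar>f z - f w\<bar> \<le> C * \<bar>z - w\<bar> powr g"
    by (rule holder_unitD[OF assms(1)]) (rule that; blast)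
  obtain C' where C': "C' \<ge> 0" "\<And>z w. z \<in> {0..1} \<Longrightarrow> w \<in> {0..1} \<Longrightarrow> \<bar>f' z - f' w\<bar> \<le> C' * \<bar>z - w\<bar> powr g"
    by (rule holder_unitD[OF assms(2)]) (rule that; blast)
  obtain M where M: "M \<ge> 0" "\<And>z. z \<in> {0..1} \<Longrightarrow> \<bar>f z\<bar> \<le> M"
    by (rule holder_unit_bounded[OF assms(1,3)]) (rule that; blast)
  obtain M' where M': "M' \<ge> 0" "\<And>z. z \<in> {0..1} \<Longrightarrow> \<bar>f' z\<bar> \<le> M'"
    by (rule holder_unit_bounded[OF assms(2,3)]) (rule that; blast)
  show ?thesis unfolding holder_unit_def
  proof (intro exI[of _ "C * M' + M * C'"] ballI)
    fix z w :: real assume zw: "z \<in> {0..1}" "w \<in> {0..1}"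
    have "f z * f' z - f w * f' w = (f z - f w) * f' z + f w * (f' z - f' w)"
      by (simp add: algebra_simps)
    hence "\<bar>f z * f' z - f w * f' w\<bar> \<le> \<bar>(f z - f w) * f' z\<bar> + \<bar>f w * (f' z - f' w)\<bar>"
      by (simp only: abs_triangle_ineq)
    hence "\<bar>f z * f' z - f w * f' w\<bar> \<le> \<bar>f z - f w\<bar> * \<bar>f' z\<bar> + \<bar>f w\<bar> * \<bar>f' z - f' w\<bar>"
      by (simp only: abs_mult)
    also have "\<dots> \<le> (C * \<bar>z - w\<bar> powr g) * M' + M * (C' * \<bar>z - w\<bar> powr g)"
      using C C' M M' zw by (intro add_mono mult_mono) auto
    finally show "\<bar>f z * f' z - f w * f' w\<bar> \<le> (C * M' + M * C') * \<bar>z - w\<bar> powr g"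
      by (simp add: algebra_simps)
  qed
qed

lemma holder_unit_const: "holder_unit g (\<lambda>z. c)"
  unfolding holder_unit_def by (intro exI[of _ 0]) auto

lemma holder_unit_id:
  assumes "g \<le> 1"
  shows "holder_unit g (\<lambda>z. z)"
  unfolding holder_unit_def
proof (intro exI[of _ 1] ballI)
  fix z w :: real assume "z \<in> {0..1}" "w \<in> {0..1}"
  thus "\<bar>z - w\<bar> \<le> 1 * \<bar>z - w\<bar> powr g"
    using le_powr_unit[of "\<bar>z - w\<bar>" g] assms by auto
qed

lemma holder_unit_powr:
  assumes "0 < g" "g \<le> e" "e \<le> 1"
  shows "holder_unit g (\<lambda>z. z powr e)"
  unfolding holder_unit_def
proof (intro exI[of _ 1] ballI)
  have main: "\<bar>z powr e - w powr e\<bar> \<le> \<bar>z - w\<bar> powr g" if zw: "0 \<le> w" "w \<le> z" "z \<le> 1" for z w :: real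
  proof -
    have "w powr e \<le> z powr e" using zw assms by (intro powr_mono2) auto
    hence "\<bar>z powr e - w powr e\<bar> = z powr e - w powr e" by simp
    also have "\<dots> \<le> (z - w) powr e" using zw assms by (intro powr_diff_le_powr) auto
    also have "\<dots> \<le> (z - w) powr g"
      using zw assms powr_mono'[of g e "z - w"] by (cases "z = w") auto
    finally show ?thesis using zw by simp
  qed
  fix z w :: real assume "z \<in> {0..1}" "w \<in> {0..1}"
  thus "\<bar>z powr e - w powr e\<bar> \<le> 1 * \<bar>z - w\<bar> powr g"
    using main[of w z] main[of z w] by (cases "w \<le> z") (auto simp: abs_minus_commute)
qed

lemma holder_unit_reflect:
  assumes "holder_unit g f"
  shows "holder_unit g (\<lambda>z. f (1 - z))"
proof -
  obtain C where C0: "C \<ge> 0" and C: "\<And>z w. z \<in> {0..1} \<Longrightarrow> w \<in> {0..1} \<Longrightarrow> \<bar>f z - f w\<bar> \<le> C * \<bar>z - w\<bar> powr g"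
    by (rule holder_unitD[OF assms]) (rule that; blast)
  show ?thesis unfolding holder_unit_def
  proof (intro exI[of _ C] ballI)
    fix z w :: real assume "z \<in> {0..1}" "w \<in> {0..1}"
    thus "\<bar>f (1 - z) - f (1 - w)\<bar> \<le> C * \<bar>z - w\<bar> powr g"
      using C[of "1 - z" "1 - w"] by (auto simp: abs_minus_commute)
  qed
qed

lemma holder_unit_cong:
  assumes "\<And>z. z \<in> {0..1} \<Longrightarrow> f z = f' z"
  shows "holder_unit g f \<longleftrightarrow> holder_unit g f'"
  unfolding holder_unit_def using assms by simp

lemma zx_bounds:
  assumes "0 \<le> z" "z \<le> 1" "0 \<le> x"
  shows "1 \<le> 1 + (1 - z) * x" "zx z x \<in> {0..1}" "yx z x \<in> {0..1}" "\<bar>z - zx z x\<bar> \<le> x"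
proof -
  show d: "1 \<le> 1 + (1 - z) * x" using assms by simp
  show "zx z x \<in> {0..1}" "yx z x \<in> {0..1}"
    using d assms order_trans[OF assms(2) d] by (auto simp: zx_def yx_def divide_le_eq)
  have "z - zx z x = z * (1 - z) * x / (1 + (1 - z) * x)"
    using d by (simp add: zx_def field_simps)
  also have "\<bar>\<dots>\<bar> \<le> z * (1 - z) * x"
  proof -
    have "0 \<le> z * (1 - z) * x" using assms by simp
    moreover from this have "z * (1 - z) * x * 1 \<le> z * (1 - z) * x * (1 + (1 - z) * x)"
      using d by (intro mult_left_mono) auto
    ultimately show ?thesis using d by (simp add: divide_le_eq)
  qed
  also have "\<dots> \<le> 1 * 1 * x" using assms by (intro mult_mono) auto
  finally show "\<bar>z - zx z x\<bar> \<le> x" by simp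
qed

lemma one_plus_nonzero:
  assumes "0 < x"
  shows "\<forall>z\<in>{0..1}. 1 + (1 - z) * x \<noteq> (0::real)"
proof
  fix z :: real assume "z \<in> {0..1}"
  hence "1 \<le> 1 + (1 - z) * x" using assms by (intro zx_bounds(1)) auto
  thus "1 + (1 - z) * x \<noteq> 0" by linarith
qed

section \<open>Majorants for the outer integrals\<close>

context kernel_exponents
begin

text \<open>
  The choice of \<open>g\<close> gives \<open>a + g < c - b\<close> for each of the five parameter triples.
\<close>

lemma holder_f:
  "holder_unit g f1" "holder_unit g f2" "holder_unit g f3" "holder_unit g f4" "holder_unit g f5"
proof -
  have F: "holder_unit g (hyp2F1 a' b' c')" if "0 \<le> a'" "0 < b'" "a' + g < c' - b'" for a' b' c'
    unfolding holder_unit_def using that g_bounds by (intro hyp2F1_holder) auto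
  show "holder_unit g f1" "holder_unit g f2" "holder_unit g f5"
    using exponent_bounds g_bounds
    by (subst holder_unit_cong[OF hypergeometric_eqs(1)] holder_unit_cong[OF hypergeometric_eqs(2)]
          holder_unit_cong[OF hypergeometric_eqs(3)]; auto intro!: F)+
  show "holder_unit g f3" "holder_unit g f4"
    using exponent_bounds g_bounds
    by (subst holder_unit_cong[OF hypergeometric_eqs'(1)] holder_unit_cong[OF hypergeometric_eqs'(2)];
        auto intro!: F holder_unit_reflect)+
qed

text \<open>
  The three summands of \<open>G\<close> correspond to the three integrals \<open>Psi1\<close>, \<open>Psi2\<close>, \<open>Psi3\<close>, and
  to \<open>Lambda1\<close>, \<open>Lambda2\<close>, \<open>Lambda3\<close>.
\<close>

definition G1 :: "real \<Rightarrow> real" where "G1 z = (d3 + d5 * z) * f3 z"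
definition G2 :: "real \<Rightarrow> real" where "G2 z = d4 * z powr (b - h) * (1 - z) * f4 z"
definition G3 :: "real \<Rightarrow> real" where "G3 z = - (d5 * z powr (b - h) * f5 z)"

lemma G_split: "G z = G1 z + G2 z + G3 z"
  by (simp add: G_def G1_def G2_def G3_def)

lemma holder_G: "holder_unit g G1" "holder_unit g G2" "holder_unit g G3" "holder_unit g G"
proof -
  have p: "holder_unit g (\<lambda>z. z powr (b - h))"
    using exponent_bounds g_bounds by (intro holder_unit_powr) auto
  have i: "holder_unit g (\<lambda>z. z)" using g_bounds by (intro holder_unit_id) auto
  note hs = holder_unit_add holder_unit_mult holder_unit_const holder_unit_reflect[OF i] p i holder_f g_bounds(1)
  show 1: "holder_unit g G1" unfolding G1_def[abs_def] by (intro hs)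
  show 2: "holder_unit g G2" unfolding G2_def[abs_def] by (intro hs)
  have "holder_unit g (\<lambda>z. - d5 * z powr (b - h) * f5 z)" by (intro hs)
  thus 3: "holder_unit g G3" by (simp add: G3_def[abs_def])
  show "holder_unit g G"
    using holder_unit_add[OF holder_unit_add[OF 1 2] 3] by (simp add: G_split[abs_def])
qed

text \<open>
  With \<open>t = u + (u - s) * x\<close> and \<open>z = s / u\<close> one has \<open>t - s = (u - s) * (1 + x)\<close> and
  \<open>t = u * (1 + (1 - z) * x)\<close>; so \<open>kappa z x\<close> is the factor by which the powers in
  \<open>t powr (2 * h) * rho t s\<close> change between \<open>u\<close> and \<open>t\<close>.
\<close>

definition kappa :: "real \<Rightarrow> real \<Rightarrow> real" where
  "kappa z x = (1 + x) powr (b - h - 1) * (1 + (1 - z) * x) powr h"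

lemma kappa_bounds:
  assumes "0 \<le> z" "z \<le> 1" "0 \<le> x"
  shows "\<bar>kappa z x\<bar> \<le> (1 + (1 - z) * x) powr h" "\<bar>1 - kappa z x\<bar> \<le> 2 * x * (1 + (1 - z) * x) powr h"
proof -
  note d = zx_bounds(1)[OF assms]
  have le1: "(1 + x) powr (b - h - 1) \<le> 1"
    using powr_mono[of "b - h - 1" 0 "1 + x"] assms exponent_bounds by simp
  have ge1: "1 \<le> (1 + (1 - z) * x) powr h" using d exponent_bounds by (intro ge_one_powr_ge_zero) auto
  have "(1 + x) powr (b - h - 1) * (1 + (1 - z) * x) powr h \<le> 1 * (1 + (1 - z) * x) powr h"
    using le1 by (intro mult_right_mono) auto
  thus "\<bar>kappa z x\<bar> \<le> (1 + (1 - z) * x) powr h" by (simp add: kappa_def)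
  have "\<bar>(1 + x) powr (b - h - 1) - 1\<bar> \<le> \<bar>b - h - 1\<bar> * x"
    using assms exponent_bounds by (intro abs_one_plus_powr_minus_one_le) auto
  also have "\<dots> \<le> 1 * x" using assms exponent_bounds by (intro mult_right_mono) auto
  finally have 1: "\<bar>(1 + x) powr (b - h - 1) - 1\<bar> \<le> x" by simp
  have "\<bar>(1 + (1 - z) * x) powr h - 1\<bar> \<le> \<bar>h\<bar> * ((1 - z) * x)"
    using assms exponent_bounds by (intro abs_one_plus_powr_minus_one_le) auto
  also have "\<dots> \<le> 1 * (1 * x)" using assms exponent_bounds by (intro mult_mono) auto
  finally have 2: "\<bar>(1 + (1 - z) * x) powr h - 1\<bar> \<le> x" by simp
  have "1 - kappa z x = (1 - (1 + (1 - z) * x) powr h) + (1 - (1 + x) powr (b - h - 1)) * (1 + (1 - z) * x) powr h"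
    by (simp add: kappa_def algebra_simps)
  also have "\<bar>\<dots>\<bar> \<le> \<bar>1 - (1 + (1 - z) * x) powr h\<bar> + \<bar>1 - (1 + x) powr (b - h - 1)\<bar> * (1 + (1 - z) * x) powr h"
    by (rule order_trans[OF abs_triangle_ineq]) (simp add: abs_mult)
  also have "\<dots> \<le> x * (1 + (1 - z) * x) powr h + x * (1 + (1 - z) * x) powr h"
  proof (intro add_mono mult_right_mono)
    show "\<bar>1 - (1 + (1 - z) * x) powr h\<bar> \<le> x * (1 + (1 - z) * x) powr h"
      using 2 assms mult_left_mono[OF ge1, of x] by (simp add: abs_minus_commute)
  qed (use 1 in \<open>auto simp: abs_minus_commute\<close>)
  finally show "\<bar>1 - kappa z x\<bar> \<le> 2 * x * (1 + (1 - z) * x) powr h" by simp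
qed

definition psi_integrand :: "(real \<Rightarrow> real) \<Rightarrow> real \<Rightarrow> real \<Rightarrow> real" where
  "psi_integrand f z x = x powr (- h - 1) * (f z - kappa z x * f (zx z x))"

text \<open>
  Of order \<open>x powr (g - h - 1)\<close> at 0 and \<open>x powr (- h - 1)\<close> at infinity, and at the same time a
  density whose integral is a Beta value.
\<close>

definition psi_bound :: "real \<Rightarrow> real" where
  "psi_bound x = x powr (g - h - 1) * (1 + x) powr (- g)"

lemma psi_bound_integrable: "set_integrable lborel {0<..} psi_bound"
  using beta_prime(1)[of "g - h" h] exponent_bounds g_bounds by (simp add: psi_bound_def[abs_def])

text \<open>
  For small \<open>x\<close> the Hoelder continuity of \<open>f\<close> and the Lipschitz bound for \<open>kappa\<close> give order
  \<open>x powr g\<close> for the increment; for large \<open>x\<close> boundedness is enough.  The factor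
  \<open>(1 + (1 - z) * x) powr h\<close> is the only source of growth; it is kept as a parameter \<open>N\<close> because it
  equals \<open>(t / u) powr h\<close>, which is bounded on the range of integration, where \<open>t < T\<close>.
\<close>

lemma psi_integrand_le:
  assumes "holder_unit g f"
  obtains C where "C \<ge> 0" "\<And>z x N. 0 \<le> z \<Longrightarrow> z \<le> 1 \<Longrightarrow> 0 < x \<Longrightarrow> (1 + (1 - z) * x) powr h \<le> N \<Longrightarrow>
      \<bar>psi_integrand f z x\<bar> \<le> C * N * psi_bound x"
proof -
  obtain C where C: "C \<ge> 0" "\<And>z w. z \<in> {0..1} \<Longrightarrow> w \<in> {0..1} \<Longrightarrow> \<bar>f z - f w\<bar> \<le> C * \<bar>z - w\<bar> powr g"
    by (rule holder_unitD[OF assms]) (rule that; blast)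
  obtain M where M: "M \<ge> 0" "\<And>z. z \<in> {0..1} \<Longrightarrow> \<bar>f z\<bar> \<le> M"
    by (rule holder_unit_bounded[OF assms g_bounds(1)]) (rule that; blast)
  show ?thesis
  proof (rule that[of "(C + 2 * M) * 2 powr g"])
    show "0 \<le> (C + 2 * M) * 2 powr g" using C M by simp
    fix z x N :: real assume zx: "0 \<le> z" "z \<le> 1" "0 < x" and N: "(1 + (1 - z) * x) powr h \<le> N"
    note d = zx_bounds[OF zx(1,2) less_imp_le[OF zx(3)]]
    note k = kappa_bounds[OF zx(1,2) less_imp_le[OF zx(3)]]
    have "1 \<le> (1 + (1 - z) * x) powr h" using d exponent_bounds by (intro ge_one_powr_ge_zero) auto
    hence N1: "1 \<le> N" using N by simp
    have z01: "z \<in> {0..1}" using zx by simp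
    have "\<bar>f z - kappa z x * f (zx z x)\<bar> \<le> (C + 2 * M) * N * (2 powr g * x powr g * (1 + x) powr (- g))"
    proof (cases "x \<le> 1")
      case True
      have "f z - kappa z x * f (zx z x) = (f z - f (zx z x)) + (1 - kappa z x) * f (zx z x)"
        by (simp add: algebra_simps)
      also have "\<bar>\<dots>\<bar> \<le> \<bar>f z - f (zx z x)\<bar> + \<bar>1 - kappa z x\<bar> * \<bar>f (zx z x)\<bar>"
        by (rule order_trans[OF abs_triangle_ineq]) (simp add: abs_mult)
      also have "\<dots> \<le> C * x powr g + 2 * x * N * M"
      proof (intro add_mono mult_mono)
        have "\<bar>z - zx z x\<bar> powr g \<le> x powr g" using d g_bounds by (intro powr_mono2) auto
        hence "C * \<bar>z - zx z x\<bar> powr g \<le> C * x powr g" using C by (intro mult_left_mono) auto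
        thus "\<bar>f z - f (zx z x)\<bar> \<le> C * x powr g" using C(2)[OF z01 d(2)] by simp
        have "2 * x * (1 + (1 - z) * x) powr h \<le> 2 * x * N" using N zx by (intro mult_left_mono) auto
        thus "\<bar>1 - kappa z x\<bar> \<le> 2 * x * N" using k(2) by simp
      qed (use M(2)[OF d(2)] N1 zx in auto)
      also have "\<dots> \<le> C * x powr g * N + 2 * x powr g * N * M"
      proof (intro add_mono)
        show "C * x powr g \<le> C * x powr g * N" using C N1 mult_left_mono[of 1 N "C * x powr g"] by simp
        have "x \<le> x powr g" using True zx g_bounds by (intro le_powr_unit) auto
        thus "2 * x * N * M \<le> 2 * x powr g * N * M"
          using N1 M by (intro mult_right_mono mult_left_mono) auto
      qed
      also have "\<dots> = (C + 2 * M) * N * (x powr g * 1)" by (simp add: algebra_simps)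
      also have "\<dots> \<le> (C + 2 * M) * N * (x powr g * (2 powr g * (1 + x) powr (- g)))"
      proof (intro mult_left_mono)
        have "(1 + x) powr g \<le> 2 powr g" using True zx g_bounds by (intro powr_mono2) auto
        thus "1 \<le> 2 powr g * (1 + x) powr (- g)" using zx by (simp add: powr_minus field_simps)
      qed (use C M N1 in auto)
      finally show ?thesis by (simp add: mult_ac)
    next
      case False
      have "\<bar>f z - kappa z x * f (zx z x)\<bar> \<le> \<bar>f z\<bar> + \<bar>kappa z x\<bar> * \<bar>f (zx z x)\<bar>"
        by (rule order_trans[OF abs_triangle_ineq4]) (simp add: abs_mult)
      also have "\<dots> \<le> M + N * M"
        using M(2)[OF z01] M(2)[OF d(2)] k(1) N M(1) N1 by (intro add_mono mult_mono) auto
      also have "\<dots> \<le> N * M + N * M" using N1 M mult_right_mono[of 1 N M] by (simp add: mult.commute)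
      also have "\<dots> \<le> (C + 2 * M) * N * 1" using C N1 by (simp add: algebra_simps)
      also have "\<dots> \<le> (C + 2 * M) * N * (2 powr g * x powr g * (1 + x) powr (- g))"
      proof (intro mult_left_mono)
        have "(1 + x) powr g \<le> (2 * x) powr g" using False zx g_bounds by (intro powr_mono2) auto
        thus "1 \<le> 2 powr g * x powr g * (1 + x) powr (- g)"
          using zx by (simp add: powr_mult powr_minus field_simps)
      qed (use C M N1 in auto)
      finally show ?thesis .
    qed
    hence "x powr (- h - 1) * \<bar>f z - kappa z x * f (zx z x)\<bar>
       \<le> x powr (- h - 1) * ((C + 2 * M) * N * (2 powr g * x powr g * (1 + x) powr (- g)))"
      by (intro mult_left_mono) auto
    also have "\<dots> = (C + 2 * M) * 2 powr g * N * (x powr (- h - 1) * x powr g * (1 + x) powr (- g))"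
      by (simp add: mult_ac)
    also have "x powr (- h - 1) * x powr g = x powr (g - h - 1)"
      by (simp add: powr_add[symmetric] algebra_simps)
    finally show "\<bar>psi_integrand f z x\<bar> \<le> (C + 2 * M) * 2 powr g * N * psi_bound x"
      by (simp add: psi_integrand_def psi_bound_def abs_mult)
  qed
qed

lemma psi_integrand_continuous:
  assumes "holder_unit g f" "0 \<le> z" "z \<le> 1"
  shows "continuous_on {0<..} (psi_integrand f z)"
proof -
  have nz: "\<forall>x\<in>{0<..}. 1 + (1 - z) * x \<noteq> 0" "\<forall>x\<in>{0<..}. 1 + x \<noteq> (0::real)" "\<forall>x\<in>{0<..}. x \<noteq> (0::real)"
  proof
    fix x :: real assume "x \<in> {0<..}"
    hence "1 \<le> 1 + (1 - z) * x" using assms by (intro zx_bounds(1)) auto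
    thus "1 + (1 - z) * x \<noteq> 0" by linarith
  qed auto
  have c: "continuous_on {0<..} (\<lambda>x. f (zx z x))"
  proof (rule continuous_on_compose2[OF holder_unit_continuous[OF assms(1) g_bounds(1)]])
    show "continuous_on {0<..} (zx z)" unfolding zx_def[abs_def]
      using nz by (intro continuous_intros nz)
    show "zx z ` {0<..} \<subseteq> {0..1}"
      by (intro image_subsetI zx_bounds(2)[OF assms(2,3)]) simp
  qed
  show ?thesis unfolding psi_integrand_def[abs_def] kappa_def
    by (intro continuous_intros c nz)
qed

lemma psi_integrand_integrable:
  assumes "holder_unit g f" "0 \<le> z" "z \<le> 1"
  shows "set_integrable lborel {0<..<R} (psi_integrand f z)"
proof -
  obtain C where "C \<ge> 0" and C: "\<And>z x N. 0 \<le> z \<Longrightarrow> z \<le> 1 \<Longrightarrow> 0 < x \<Longrightarrow> (1 + (1 - z) * x) powr h \<le> N \<Longrightarrow>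
      \<bar>psi_integrand f z x\<bar> \<le> C * N * psi_bound x"
    by (rule psi_integrand_le[OF assms(1)]) (rule that; blast)
  have "set_integrable lborel {0<..} (\<lambda>x. C * (1 + R) powr h * psi_bound x)"
    by (intro set_integrable_mult_right psi_bound_integrable)
  thus ?thesis
  proof (rule set_integrable_dominated_continuous)
    show "continuous_on {0<..<R} (psi_integrand f z)"
      by (rule continuous_on_subset[OF psi_integrand_continuous[OF assms]]) auto
    fix x assume x: "x \<in> {0<..<R}"
    have "(1 - z) * x \<le> 1 * R" using x assms by (intro mult_mono) auto
    thus "\<bar>psi_integrand f z x\<bar> \<le> C * (1 + R) powr h * psi_bound x"
      using x assms zx_bounds(1)[OF assms(2,3), of x] exponent_bounds by (intro C powr_mono2) auto
  qed auto
qed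

definition lambda_integrand :: "(real \<Rightarrow> real) \<Rightarrow> real \<Rightarrow> real \<Rightarrow> real" where
  "lambda_integrand f z x =
     x powr (b - h - 1) * (1 + x) powr (- h - 1) * (1 + (1 - z) * x) powr h * f (yx z x)"

definition lambda_bound :: "real \<Rightarrow> real" where
  "lambda_bound x = x powr (b - h - 1) * (1 + x) powr (- h - 1)"

lemma lambda_bound_integrable: "set_integrable lborel {0<..} lambda_bound"
  using beta_prime(1)[of "b - h" "1 + 2 * h - b"] exponent_bounds by (simp add: lambda_bound_def[abs_def])

lemma lambda_integrand_le:
  assumes "\<And>z. z \<in> {0..1} \<Longrightarrow> \<bar>f z\<bar> \<le> M" "0 \<le> z" "z \<le> 1" "0 < x" "(1 + (1 - z) * x) powr h \<le> N"
  shows "\<bar>lambda_integrand f z x\<bar> \<le> N * M * lambda_bound x"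
proof -
  have "0 \<le> M" using assms(1)[of 0] by simp
  moreover have "0 \<le> N" using powr_ge_zero[of "1 + (1 - z) * x" h] assms(5) by linarith
  ultimately have "\<bar>lambda_integrand f z x\<bar>
     \<le> x powr (b - h - 1) * (1 + x) powr (- h - 1) * N * M"
    using assms(1)[OF zx_bounds(3)[OF assms(2,3)], of x] assms(4,5)
    unfolding lambda_integrand_def abs_mult by (intro mult_mono) auto
  thus ?thesis by (simp add: lambda_bound_def mult_ac)
qed

lemma lambda_integrand_continuous:
  assumes "holder_unit g f" "0 \<le> z" "z \<le> 1"
  shows "continuous_on {0<..} (lambda_integrand f z)"
proof -
  have nz: "\<forall>x\<in>{0<..}. 1 + (1 - z) * x \<noteq> 0" "\<forall>x\<in>{0<..}. 1 + x \<noteq> (0::real)" "\<forall>x\<in>{0<..}. x \<noteq> (0::real)"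
  proof
    fix x :: real assume "x \<in> {0<..}"
    hence "1 \<le> 1 + (1 - z) * x" using assms by (intro zx_bounds(1)) auto
    thus "1 + (1 - z) * x \<noteq> 0" by linarith
  qed auto
  have c: "continuous_on {0<..} (\<lambda>x. f (yx z x))"
  proof (rule continuous_on_compose2[OF holder_unit_continuous[OF assms(1) g_bounds(1)]])
    show "continuous_on {0<..} (yx z)" unfolding yx_def[abs_def]
      using nz by (intro continuous_intros nz)
    show "yx z ` {0<..} \<subseteq> {0..1}"
      by (intro image_subsetI zx_bounds(3)[OF assms(2,3)]) simp
  qed
  show ?thesis unfolding lambda_integrand_def[abs_def]
    by (intro continuous_intros c nz)
qed

lemma lambda_integrand_integrable:
  assumes "holder_unit g f" "0 \<le> z" "z \<le> 1"
  shows "set_integrable lborel {0<..<R} (lambda_integrand f z)"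
proof -
  obtain M where "M \<ge> 0" and M: "\<And>z. z \<in> {0..1} \<Longrightarrow> \<bar>f z\<bar> \<le> M"
    by (rule holder_unit_bounded[OF assms(1) g_bounds(1)]) (rule that; blast)
  have "set_integrable lborel {0<..} (\<lambda>x. (1 + R) powr h * M * lambda_bound x)"
    by (intro set_integrable_mult_right lambda_bound_integrable)
  thus ?thesis
  proof (rule set_integrable_dominated_continuous)
    show "continuous_on {0<..<R} (lambda_integrand f z)"
      by (rule continuous_on_subset[OF lambda_integrand_continuous[OF assms]]) auto
    fix x assume x: "x \<in> {0<..<R}"
    have "(1 - z) * x \<le> 1 * R" using x assms by (intro mult_mono) auto
    thus "\<bar>lambda_integrand f z x\<bar> \<le> (1 + R) powr h * M * lambda_bound x"
      using x assms zx_bounds(1)[OF assms(2,3), of x] exponent_bounds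
      by (intro lambda_integrand_le M powr_mono2) auto
  qed auto
qed

end

section \<open>Factorisation of the kernel\<close>

context kernel_exponents
begin

text \<open>
  The identities between the factors of the integrands that put the three \<open>Psi\<close>-integrals, and the
  three \<open>Lambda\<close>-integrals, into one common form.
\<close>

lemma zx_factors:
  assumes "0 < z" "z \<le> 1" "0 < x"
  defines "e \<equiv> 1 + (1 - z) * x"
  shows "0 < e" "zx z x powr (b - h) = z powr (b - h) * e powr (h - b)" "1 - zx z x = (1 - z) * (1 + x) / e"
    "e powr (2 * h - b - 1) = e powr h * e powr (h - b) / e" "e powr (2 * h - b) = e powr h * e powr (h - b)"
    "(1 + x) powr (b - h) = (1 + x) powr (b - h - 1) * (1 + x)"
    "yx z x powr (b - h) = e powr (h - b)" "1 - yx z x = (1 - z) * x / e"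
    "x powr (b - h) = x powr (b - h - 1) * x" "e powr (h - 1) = e powr h / e" "1 / x powr (h + 1) = x powr (- h - 1)"
proof -
  have e: "1 \<le> e" unfolding e_def by (rule zx_bounds(1)) (use assms in auto)
  show e0: "0 < e" using e by linarith
  have zx: "zx z x = z / e" and yx: "yx z x = 1 / e" by (simp_all add: zx_def yx_def e_def)
  show "zx z x powr (b - h) = z powr (b - h) * e powr (h - b)"
    unfolding zx using e0 assms powr_minus_divide[of e "b - h"] by (simp add: powr_divide)
  show "yx z x powr (b - h) = e powr (h - b)"
    unfolding yx using e0 powr_minus_divide[of e "b - h"] by (simp add: powr_divide)
  have "e - z = (1 - z) * (1 + x)" "e - 1 = (1 - z) * x" by (simp_all add: e_def algebra_simps)
  moreover have "1 - z / e = (e - z) / e" "1 - 1 / e = (e - 1) / e"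
    using e0 by (simp_all add: diff_divide_distrib)
  ultimately show "1 - zx z x = (1 - z) * (1 + x) / e" "1 - yx z x = (1 - z) * x / e"
    unfolding zx yx by (simp_all only:)
  show "e powr (2 * h - b) = e powr h * e powr (h - b)"
    by (simp add: powr_add[symmetric])
  show "e powr (2 * h - b - 1) = e powr h * e powr (h - b) / e"
    using e0 powr_diff[of e "2 * h - b" 1] by (simp add: powr_add[symmetric])
  show "e powr (h - 1) = e powr h / e" using e0 powr_diff[of e h 1] by simp
  show "(1 + x) powr (b - h) = (1 + x) powr (b - h - 1) * (1 + x)"
    using assms powr_diff[of "1 + x" "b - h" 1] by simp
  show "x powr (b - h) = x powr (b - h - 1) * x"
    using assms powr_diff[of x "b - h" 1] by simp
  show "1 / x powr (h + 1) = x powr (- h - 1)"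
    using powr_minus_divide[of x "h + 1"] by simp
qed

lemma exponent_eqs:
  "- (h + 1/2) - 1/2 = - h - 1" "2 * ((b + 1) / 2) - (h + 1/2) - 3/2 = b - h - 1"
  "(h + 1/2) - 1/2 = h" "2 * ((b + 1) / 2) - (h + 1/2) - 1/2 = b - h" "(h + 1/2) + 1/2 = h + 1"
  "2 * (h + 1/2) - 2 * ((b + 1) / 2) - 1 = 2 * h - b - 1" "2 * (h + 1/2) - 2 * ((b + 1) / 2) = 2 * h - b"
  "(h + 1/2) - 3/2 = h - 1" "- 1/2 - (h + 1/2) = - h - 1" "2 * (h + 1/2) - 1 = 2 * h" "1/2 - (h + 1/2) = - h"
  "2 * ((b + 1) / 2) - 2 = b - 1" "3/2 + (h + 1/2) - 2 * ((b + 1) / 2) = 1 + h - b" "3/2 - (h + 1/2) = 1 - h"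
  "2 * ((b + 1) / 2) - 2 * (h + 1/2) - 1 = b - 2 * h - 1"
  by (simp_all add: field_simps)

lemma Psi_eqs:
  assumes "0 < z" "z \<le> 1"
  shows "Psi1 (h + 1/2) ((b + 1) / 2) z R = (LBINT x:{0<..<R}. psi_integrand G1 z x)"
    and "Psi2 (h + 1/2) ((b + 1) / 2) z R = (LBINT x:{0<..<R}. psi_integrand G2 z x)"
    and "Psi3 (h + 1/2) ((b + 1) / 2) z R = (LBINT x:{0<..<R}. psi_integrand G3 z x)"
proof -
  show "Psi1 (h + 1/2) ((b + 1) / 2) z R = (LBINT x:{0<..<R}. psi_integrand G1 z x)"
    unfolding Psi1_def exponent_eqs
    by (intro set_lebesgue_integral_cong) (auto simp: psi_integrand_def kappa_def G1_def mult_ac)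
  have "d4 * z powr (b - h) * (1 - z) *
     ((f4 z - (1 + x) powr (b - h) * (1 + (1 - z) * x) powr (2 * h - b - 1) * f4 (zx z x)) / x powr (h + 1))
     = psi_integrand G2 z x" if x: "x \<in> {0<..<R}" for x
  proof -
    note f = zx_factors[OF assms, of x]
    have "d4 * z powr (b - h) * (1 - z) *
     ((f4 z - (1 + x) powr (b - h) * (1 + (1 - z) * x) powr (2 * h - b - 1) * f4 (zx z x)) / x powr (h + 1))
     = (1 / x powr (h + 1)) * (d4 * z powr (b - h) * (1 - z) *
     (f4 z - (1 + x) powr (b - h) * (1 + (1 - z) * x) powr (2 * h - b - 1) * f4 (zx z x)))" by simp
    also have "\<dots> = psi_integrand G2 z x"
      unfolding psi_integrand_def G2_def kappa_def using x
      by (simp only: f greaterThanLessThan_iff) (simp add: algebra_simps)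
    finally show ?thesis .
  qed
  thus "Psi2 (h + 1/2) ((b + 1) / 2) z R = (LBINT x:{0<..<R}. psi_integrand G2 z x)"
    unfolding Psi2_def exponent_eqs set_integral_mult_right[symmetric]
    by (intro set_lebesgue_integral_cong) auto
  have "- d5 * z powr (b - h) *
     ((f5 z - (1 + x) powr (b - h - 1) * (1 + (1 - z) * x) powr (2 * h - b) * f5 (zx z x)) / x powr (h + 1))
     = psi_integrand G3 z x" if x: "x \<in> {0<..<R}" for x
  proof -
    note f = zx_factors[OF assms, of x]
    have "- d5 * z powr (b - h) *
     ((f5 z - (1 + x) powr (b - h - 1) * (1 + (1 - z) * x) powr (2 * h - b) * f5 (zx z x)) / x powr (h + 1))
     = (1 / x powr (h + 1)) * (- d5 * z powr (b - h) *
     (f5 z - (1 + x) powr (b - h - 1) * (1 + (1 - z) * x) powr (2 * h - b) * f5 (zx z x)))" by simp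
    also have "\<dots> = psi_integrand G3 z x"
      unfolding psi_integrand_def G3_def kappa_def using x
      by (simp only: f greaterThanLessThan_iff) (simp add: algebra_simps)
    finally show ?thesis .
  qed
  thus "Psi3 (h + 1/2) ((b + 1) / 2) z R = (LBINT x:{0<..<R}. psi_integrand G3 z x)"
    unfolding Psi3_def exponent_eqs set_integral_mult_right[symmetric]
    by (intro set_lebesgue_integral_cong) auto
qed

text \<open>
  Each summand is integrable on its own, so the three integrals may be added.
\<close>

lemma Psi_sum:
  assumes "0 < z" "z \<le> 1"
  shows "Psi1 (h + 1/2) ((b + 1) / 2) z R + Psi2 (h + 1/2) ((b + 1) / 2) z R + Psi3 (h + 1/2) ((b + 1) / 2) z R
     = (LBINT x:{0<..<R}. psi_integrand G z x)"
proof -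
  have int: "set_integrable lborel {0<..<R} (psi_integrand f z)" if "holder_unit g f" for f
    using that assms by (intro psi_integrand_integrable) auto
  note I = int[OF holder_G(1)] int[OF holder_G(2)] int[OF holder_G(3)]
  have "(LBINT x:{0<..<R}. psi_integrand G z x)
      = (LBINT x:{0<..<R}. psi_integrand G1 z x + psi_integrand G2 z x + psi_integrand G3 z x)"
    by (intro set_lebesgue_integral_cong) (auto simp: psi_integrand_def G_split algebra_simps)
  thus ?thesis unfolding Psi_eqs[OF assms] using I
    by (simp add: set_integral_add)
qed

lemma Lambda_eqs:
  assumes "0 < z" "z \<le> 1"
  shows "Lambda1 (h + 1/2) ((b + 1) / 2) z R = (LBINT x:{0<..<R}. lambda_integrand G1 z x)"
    and "Lambda2 (h + 1/2) ((b + 1) / 2) z R = (LBINT x:{0<..<R}. lambda_integrand G2 z x)"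
    and "Lambda3 (h + 1/2) ((b + 1) / 2) z R = (LBINT x:{0<..<R}. lambda_integrand G3 z x)"
proof -
  have "x powr (b - h - 1) * (1 + x) powr (- h - 1) * (1 + (1 - z) * x) powr (h - 1) *
        (d3 + d5 + d3 * (1 - z) * x) * f3 (yx z x) = lambda_integrand G1 z x" if x: "x \<in> {0<..<R}" for x
  proof -
    note f = zx_factors[OF assms, of x]
    have x0: "0 < x" using x by simp
    have num: "d3 + d5 + d3 * (1 - z) * x = (1 + (1 - z) * x) * (d3 + d5 * yx z x)"
      unfolding yx_def using f(1)[OF x0] by (simp add: field_simps)
    have cancel: "A * B * (E / e) * (e * D) * F = A * B * E * (D * F)" if "0 < e" for A B E e D F :: real
      using that by simp
    show ?thesis unfolding lambda_integrand_def G1_def num f(10)[OF x0] by (rule cancel[OF f(1)[OF x0]])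
  qed
  thus "Lambda1 (h + 1/2) ((b + 1) / 2) z R = (LBINT x:{0<..<R}. lambda_integrand G1 z x)"
    unfolding Lambda1_def exponent_eqs by (intro set_lebesgue_integral_cong) auto
  have "d4 * (1 - z) * (x powr (b - h) * (1 + x) powr (- h - 1) * (1 + (1 - z) * x) powr (2 * h - b - 1) * f4 (yx z x))
     = lambda_integrand G2 z x" if x: "x \<in> {0<..<R}" for x
  proof -
    note f = zx_factors[OF assms, of x]
    show ?thesis unfolding lambda_integrand_def G2_def using x
      by (simp only: f greaterThanLessThan_iff) (simp add: mult_ac)
  qed
  thus "Lambda2 (h + 1/2) ((b + 1) / 2) z R = (LBINT x:{0<..<R}. lambda_integrand G2 z x)"
    unfolding Lambda2_def exponent_eqs set_integral_mult_right[symmetric]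
    by (intro set_lebesgue_integral_cong) auto
  have "- d5 * (x powr (b - h - 1) * (1 + x) powr (- h - 1) * (1 + (1 - z) * x) powr (2 * h - b) * f5 (yx z x))
     = lambda_integrand G3 z x" if x: "x \<in> {0<..<R}" for x
  proof -
    note f = zx_factors[OF assms, of x]
    show ?thesis unfolding lambda_integrand_def G3_def using x
      by (simp only: f greaterThanLessThan_iff) (simp add: mult_ac)
  qed
  thus "Lambda3 (h + 1/2) ((b + 1) / 2) z R = (LBINT x:{0<..<R}. lambda_integrand G3 z x)"
    unfolding Lambda3_def exponent_eqs set_integral_mult_right[symmetric]
    by (intro set_lebesgue_integral_cong) auto
qed

lemma Lambda_sum:
  assumes "0 < z" "z \<le> 1"
  shows "Lambda1 (h + 1/2) ((b + 1) / 2) z R + Lambda2 (h + 1/2) ((b + 1) / 2) z R + Lambda3 (h + 1/2) ((b + 1) / 2) z R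
     = (LBINT x:{0<..<R}. lambda_integrand G z x)"
proof -
  have int: "set_integrable lborel {0<..<R} (lambda_integrand f z)" if "holder_unit g f" for f
    using that assms by (intro lambda_integrand_integrable) auto
  note I = int[OF holder_G(1)] int[OF holder_G(2)] int[OF holder_G(3)]
  have "(LBINT x:{0<..<R}. lambda_integrand G z x)
      = (LBINT x:{0<..<R}. lambda_integrand G1 z x + lambda_integrand G2 z x + lambda_integrand G3 z x)"
    by (intro set_lebesgue_integral_cong) (auto simp: lambda_integrand_def G_split algebra_simps)
  thus ?thesis unfolding Lambda_eqs[OF assms] using I
    by (simp add: set_integral_add)
qed

lemma L_minus_eq:
  assumes "0 < s" "s < u"
  shows "L_minus (h + 1/2) ((b + 1) / 2) T u s = (T - u) powr (- h) * (u - s) powr h * G (s / u)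
      + h * (LBINT x:{0<..<(T - u) / (u - s)}. psi_integrand G (s / u) x)"
proof -
  have z: "0 < s / u" "s / u \<le> 1" using assms by auto
  show ?thesis
    unfolding L_minus_def Psi_sum[OF z] exponent_eqs G_def ..
qed

text \<open>
  The substitution \<open>t = u + (u - s) * x\<close> turns the integrand into
  \<open>u powr h * (u - s) powr (b - 2 * h - 2)\<close> times \<open>psi_integrand G (s / u) x\<close>, and \<open>dt\<close> contributes
  one more power of \<open>u - s\<close>.
\<close>

lemma K_minus_eq:
  assumes "0 < s" "s < u" "u < T"
  shows "K_minus (h + 1/2) ((b + 1) / 2) T u s = (u - s) powr (b - 2 * h - 1) * L_minus (h + 1/2) ((b + 1) / 2) T u s"
proof -
  define c where "c = u - s"
  define z where "z = s / u"
  define R where "R = (T - u) / c"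
  have c: "0 < c" "0 < R" using assms by (auto simp: c_def R_def)
  have z: "0 < z" "z < 1" "0 < u" "s = u * z" using assms by (auto simp: z_def)
  let ?rho = "rho (h + 1/2) ((b + 1) / 2)"
  have rho_u: "?rho u s = c powr (b - h - 1) * u powr (- h) * G z"
    using rho_eq[OF assms(1,2)] by (simp add: c_def z_def)
  have pt: "(u powr (2 * h) * ?rho u s - (u + c * x) powr (2 * h) * ?rho (u + c * x) s) / (u + c * x - u) powr (h + 1)
     = u powr h * c powr (b - 2 * h - 2) * psi_integrand G z x" if x: "0 < x" "x < R" for x
  proof -
    define e where "e = 1 + (1 - z) * x"
    have e: "0 < e" using zx_factors(1)[of z x] z x by (simp add: e_def)
    have t: "u + c * x = u * e" using z by (simp add: e_def c_def algebra_simps)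
    have ts: "u + c * x - s = c * (1 + x)" by (simp add: c_def algebra_simps)
    have "?rho (u + c * x) s = (u + c * x - s) powr (b - h - 1) * (u + c * x) powr (- h) * G (s / (u + c * x))"
    proof (rule rho_eq)
      have "0 < c * x" using c x by simp
      thus "s < u + c * x" using assms by linarith
    qed (rule assms)
    also have "s / (u + c * x) = zx z x" unfolding t zx_def e_def[symmetric] using z by simp
    finally have rho_t: "?rho (u + c * x) s = (c * (1 + x)) powr (b - h - 1) * (u * e) powr (- h) * G (zx z x)"
      by (simp add: t ts[unfolded t])
    have 1: "u powr (2 * h) * (c powr (b - h - 1) * u powr (- h) * G z) = u powr h * c powr (b - h - 1) * G z"
      using z powr_add[of u "2 * h" "- h"] by simp
    have 2: "(u * e) powr (2 * h) * ((c * (1 + x)) powr (b - h - 1) * (u * e) powr (- h) * G (zx z x))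
        = u powr h * c powr (b - h - 1) * (kappa z x * G (zx z x))"
    proof -
      have "(u * e) powr (2 * h) * (u * e) powr (- h) = (u * e) powr h"
        by (simp add: powr_add[symmetric])
      hence "(u * e) powr (2 * h) * ((c * (1 + x)) powr (b - h - 1) * (u * e) powr (- h) * G (zx z x))
        = (u * e) powr h * (c * (1 + x)) powr (b - h - 1) * G (zx z x)" by (simp add: mult_ac)
      also have "\<dots> = u powr h * c powr (b - h - 1) * (kappa z x * G (zx z x))"
        using z e c x by (simp add: powr_mult kappa_def e_def mult_ac)
      finally show ?thesis .
    qed
    have 3: "1 / (c * x) powr (h + 1) = c powr (- h - 1) * x powr (- h - 1)"
      using c x powr_minus_divide[of "c * x" "h + 1"] by (simp add: powr_mult)
    have 4: "c powr (b - h - 1) * c powr (- h - 1) = c powr (b - 2 * h - 2)"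
      by (simp add: powr_add[symmetric] algebra_simps)
    have "(u powr (2 * h) * ?rho u s - (u + c * x) powr (2 * h) * ?rho (u + c * x) s) / (u + c * x - u) powr (h + 1)
       = (u powr h * c powr (b - h - 1) * G z - u powr h * c powr (b - h - 1) * (kappa z x * G (zx z x)))
           * (1 / (c * x) powr (h + 1))"
      unfolding rho_u rho_t add_diff_cancel_left' unfolding t 1 2 by simp
    also have "\<dots> = u powr h * (c powr (b - h - 1) * c powr (- h - 1)) * (x powr (- h - 1) * (G z - kappa z x * G (zx z x)))"
      unfolding 3 by (simp add: algebra_simps)
    finally show ?thesis unfolding 4 by (simp add: psi_integrand_def)
  qed
  have "(LBINT t:{u<..<T}. (u powr (2 * h) * ?rho u s - t powr (2 * h) * ?rho t s) / (t - u) powr (h + 1))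
     = c * (LBINT x:{0<..<R}. (u powr (2 * h) * ?rho u s - (u + c * x) powr (2 * h) * ?rho (u + c * x) s) / (u + c * x - u) powr (h + 1))"
    using c by (subst set_integral_affine[of c]) (auto simp: R_def)
  also have "\<dots> = c * (LBINT x:{0<..<R}. u powr h * c powr (b - 2 * h - 2) * psi_integrand G z x)"
    using pt by (intro arg_cong2[of _ _ _ _ "(*)"] set_lebesgue_integral_cong refl) auto
  also have "\<dots> = u powr h * (c powr 1 * c powr (b - 2 * h - 2)) * (LBINT x:{0<..<R}. psi_integrand G z x)"
    using c by simp
  also have "c powr 1 * c powr (b - 2 * h - 2) = c powr (b - 2 * h - 1)"
    by (simp only: powr_add[symmetric]) simp
  finally have int: "(LBINT t:{u<..<T}. (u powr (2 * h) * ?rho u s - t powr (2 * h) * ?rho t s) / (t - u) powr (h + 1))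
     = u powr h * c powr (b - 2 * h - 1) * (LBINT x:{0<..<R}. psi_integrand G z x)" .
  have 5: "u powr h * u powr (- h) = 1" "u powr (- h) * u powr h = 1"
    using z by (simp_all add: powr_add[symmetric])
  have 6: "c powr (b - h - 1) = c powr (b - 2 * h - 1) * c powr h"
    by (simp add: powr_add[symmetric] algebra_simps)
  have "K_minus (h + 1/2) ((b + 1) / 2) T u s
     = (u powr h * u powr (- h)) * (T - u) powr (- h) * c powr (b - h - 1) * G z
       + h * (u powr (- h) * u powr h) * c powr (b - 2 * h - 1) * (LBINT x:{0<..<R}. psi_integrand G z x)"
    unfolding K_minus_def exponent_eqs int by (simp add: rho_u mult_ac)
  also have "\<dots> = c powr (b - 2 * h - 1) * ((T - u) powr (- h) * c powr h * G z + h * (LBINT x:{0<..<R}. psi_integrand G z x))"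
    unfolding 5 6 by (simp add: algebra_simps)
  finally show ?thesis
    unfolding L_minus_eq[OF assms(1,2)] by (simp add: c_def z_def R_def)
qed

definition phi1_integrand :: "real \<Rightarrow> real \<Rightarrow> real" where
  "phi1_integrand z y = (f1 z - f1 (z + (1 - z) * y)) / y powr (h + 1)"

definition phi2_integrand :: "real \<Rightarrow> real \<Rightarrow> real" where
  "phi2_integrand z y = (z * f2 z - (z + (1 - z) * y) * (1 - y) powr (b - h - 1) * f2 (z + (1 - z) * y)) / y powr (h + 1)"

lemma convex_unit:
  assumes "0 \<le> z" "z \<le> 1" "0 < y" "y < (1::real)"
  shows "z + (1 - z) * y \<in> {0..1}" "\<bar>z - (z + (1 - z) * y)\<bar> \<le> y"
proof -
  have "0 \<le> (1 - z) * y" "(1 - z) * y \<le> (1 - z) * 1"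
    using assms by (auto intro!: mult_left_le)
  thus "z + (1 - z) * y \<in> {0..1}" using assms by auto
  have "(1 - z) * y \<le> 1 * y" using assms by (intro mult_right_mono) auto
  thus "\<bar>z - (z + (1 - z) * y)\<bar> \<le> y" using \<open>0 \<le> (1 - z) * y\<close> by simp
qed

lemma phi1_integrand_le:
  obtains C where "C \<ge> 0" "\<And>z y. 0 \<le> z \<Longrightarrow> z \<le> 1 \<Longrightarrow> 0 < y \<Longrightarrow> y < 1 \<Longrightarrow>
      \<bar>phi1_integrand z y\<bar> \<le> C * y powr (g - h - 1)"
proof -
  obtain C where C: "C \<ge> 0" "\<And>z w. z \<in> {0..1} \<Longrightarrow> w \<in> {0..1} \<Longrightarrow> \<bar>f1 z - f1 w\<bar> \<le> C * \<bar>z - w\<bar> powr g"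
    by (rule holder_unitD[OF holder_f(1)]) (rule that; blast)
  show ?thesis
  proof (rule that[OF C(1)])
    fix z y :: real assume zy: "0 \<le> z" "z \<le> 1" "0 < y" "y < 1"
    note w = convex_unit[OF zy]
    have "\<bar>f1 z - f1 (z + (1 - z) * y)\<bar> \<le> C * \<bar>z - (z + (1 - z) * y)\<bar> powr g"
      using w zy by (intro C) auto
    also have "\<dots> \<le> C * y powr g"
      using w zy g_bounds C by (intro mult_left_mono powr_mono2) auto
    finally have "\<bar>f1 z - f1 (z + (1 - z) * y)\<bar> / y powr (h + 1) \<le> C * y powr g / y powr (h + 1)"
      by (intro divide_right_mono) auto
    also have "C * y powr g / y powr (h + 1) = C * y powr (g - h - 1)"
      by (simp add: powr_diff powr_add)
    finally show "\<bar>phi1_integrand z y\<bar> \<le> C * y powr (g - h - 1)"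
      by (simp add: phi1_integrand_def)
  qed
qed

text \<open>
  The increment splits into the Hoelder increment of \<open>z * F2 z\<close>, of order \<open>y powr g\<close>, and the
  increment of \<open>(1 - y) powr (b - h - 1)\<close>, which is controlled by \<open>one_minus_powr_bound\<close>.
\<close>

lemma phi2_integrand_le:
  obtains C where "C \<ge> 0" "\<And>z y. 0 \<le> z \<Longrightarrow> z \<le> 1 \<Longrightarrow> 0 < y \<Longrightarrow> y < 1 \<Longrightarrow>
      \<bar>phi2_integrand z y\<bar> \<le> C * (y powr (g - h - 1) + y powr (- h) * (1 - y) powr (b - h - 1))"
proof -
  have hol: "holder_unit g (\<lambda>z. z * f2 z)"
    using g_bounds by (intro holder_unit_mult holder_unit_id holder_f) auto
  obtain C where C: "C \<ge> 0" "\<And>z w. z \<in> {0..1} \<Longrightarrow> w \<in> {0..1} \<Longrightarrow> \<bar>z * f2 z - w * f2 w\<bar> \<le> C * \<bar>z - w\<bar> powr g"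
    by (rule holder_unitD[OF hol]) (rule that; blast)
  obtain M where M: "M \<ge> 0" "\<And>z. z \<in> {0..1} \<Longrightarrow> \<bar>z * f2 z\<bar> \<le> M"
    by (rule holder_unit_bounded[OF hol g_bounds(1)]) (rule that; blast)
  show ?thesis
  proof (rule that[of "C + M"])
    show "0 \<le> C + M" using C M by simp
    fix z y :: real assume zy: "0 \<le> z" "z \<le> 1" "0 < y" "y < 1"
    define w where "w = z + (1 - z) * y"
    note w = convex_unit[OF zy, folded w_def]
    have k: "\<bar>1 - (1 - y) powr (b - h - 1)\<bar> \<le> y * (1 - y) powr (b - h - 1)"
      using one_minus_powr_bound[of "b - h" y] zy exponent_bounds by (simp add: abs_minus_commute)
    have "\<bar>z * f2 z - w * (1 - y) powr (b - h - 1) * f2 w\<bar>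
        = \<bar>(z * f2 z - w * f2 w) + (1 - (1 - y) powr (b - h - 1)) * (w * f2 w)\<bar>"
      by (simp add: algebra_simps)
    also have "\<dots> \<le> \<bar>z * f2 z - w * f2 w\<bar> + \<bar>1 - (1 - y) powr (b - h - 1)\<bar> * \<bar>w * f2 w\<bar>"
      by (rule order_trans[OF abs_triangle_ineq]) (simp only: abs_mult order_refl)
    also have "\<dots> \<le> C * y powr g + y * (1 - y) powr (b - h - 1) * M"
    proof (intro add_mono mult_mono k M w)
      have "\<bar>z * f2 z - w * f2 w\<bar> \<le> C * \<bar>z - w\<bar> powr g"
        using w zy by (intro C) auto
      also have "\<dots> \<le> C * y powr g"
        using w zy g_bounds C by (intro mult_left_mono powr_mono2) auto
      finally show "\<bar>z * f2 z - w * f2 w\<bar> \<le> C * y powr g" .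
    qed (use zy in auto)
    also have "\<dots> \<le> (C + M) * y powr g + y * (1 - y) powr (b - h - 1) * (C + M)"
      using C M zy by (intro add_mono mult_right_mono mult_left_mono) auto
    finally have "\<bar>z * f2 z - w * (1 - y) powr (b - h - 1) * f2 w\<bar> / y powr (h + 1)
        \<le> ((C + M) * y powr g + y * (1 - y) powr (b - h - 1) * (C + M)) / y powr (h + 1)"
      by (intro divide_right_mono) auto
    also have "\<dots> = (C + M) * (y powr g / y powr (h + 1) + (y powr 1 / y powr (h + 1)) * (1 - y) powr (b - h - 1))"
      using zy by (simp add: field_simps)
    also have "y powr g / y powr (h + 1) = y powr (g - h - 1)" by (simp add: powr_diff powr_add)
    also have "y powr 1 / y powr (h + 1) = y powr (- h)" by (simp only: powr_diff[symmetric]) simp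
    finally show "\<bar>phi2_integrand z y\<bar> \<le> (C + M) * (y powr (g - h - 1) + y powr (- h) * (1 - y) powr (b - h - 1))"
      by (simp add: phi2_integrand_def w_def)
  qed
qed

lemma phi_bounds_integrable:
  "set_integrable lborel {0<..<1} (\<lambda>y. y powr (g - h - 1))"
  "set_integrable lborel {0<..<1} (\<lambda>y. y powr (g - h - 1) + y powr (- h) * (1 - y) powr (b - h - 1))"
proof -
  have "set_integrable lborel {0<..<1} (\<lambda>y. y powr ((g - h) - 1) * (1 - y) powr (1 - 1))"
    using exponent_bounds g_bounds by (intro beta_integrable) auto
  thus 1: "set_integrable lborel {0<..<1} (\<lambda>y. y powr (g - h - 1))"
    by (rule set_integrable_cong[THEN iffD1, OF refl refl, rotated]) auto
  have "set_integrable lborel {0<..<1} (\<lambda>y. y powr ((1 - h) - 1) * (1 - y) powr ((b - h) - 1))"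
    using exponent_bounds g_bounds by (intro beta_integrable) auto
  with 1 show "set_integrable lborel {0<..<1} (\<lambda>y. y powr (g - h - 1) + y powr (- h) * (1 - y) powr (b - h - 1))"
    by (intro set_integral_add) simp_all
qed

lemma phi_integrand_continuous:
  assumes "0 \<le> z" "z \<le> 1"
  shows "continuous_on {0<..<1} (phi1_integrand z)" "continuous_on {0<..<1} (phi2_integrand z)"
proof -
  have c: "continuous_on {0<..<1} (\<lambda>y. f (z + (1 - z) * y))" if "holder_unit g f" for f
  proof (rule continuous_on_compose2[OF holder_unit_continuous[OF that g_bounds(1)]])
    show "(\<lambda>y. z + (1 - z) * y) ` {0<..<1} \<subseteq> {0..1}"
      by (intro image_subsetI convex_unit(1)[OF assms]) auto
  qed (intro continuous_intros)
  show "continuous_on {0<..<1} (phi1_integrand z)" "continuous_on {0<..<1} (phi2_integrand z)"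
    unfolding phi1_integrand_def[abs_def] phi2_integrand_def[abs_def]
    by (intro continuous_intros c holder_f; auto)+
qed

lemma phi_integrand_integrable:
  assumes "0 \<le> z" "z \<le> 1"
  shows "set_integrable lborel {0<..<1} (phi1_integrand z)" "set_integrable lborel {0<..<1} (phi2_integrand z)"
proof -
  obtain C where C: "C \<ge> 0" "\<And>z y. 0 \<le> z \<Longrightarrow> z \<le> 1 \<Longrightarrow> 0 < y \<Longrightarrow> y < 1 \<Longrightarrow>
      \<bar>phi1_integrand z y\<bar> \<le> C * y powr (g - h - 1)"
    by (rule phi1_integrand_le) (rule that; blast)
  show "set_integrable lborel {0<..<1} (phi1_integrand z)"
    by (rule set_integrable_dominated_continuous[OF set_integrable_mult_right[of C, OF phi_bounds_integrable(1)]])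
       (use assms in \<open>auto intro!: C phi_integrand_continuous\<close>)
  obtain C' where C': "C' \<ge> 0" "\<And>z y. 0 \<le> z \<Longrightarrow> z \<le> 1 \<Longrightarrow> 0 < y \<Longrightarrow> y < 1 \<Longrightarrow>
      \<bar>phi2_integrand z y\<bar> \<le> C' * (y powr (g - h - 1) + y powr (- h) * (1 - y) powr (b - h - 1))"
    by (rule phi2_integrand_le) (rule that; blast)
  show "set_integrable lborel {0<..<1} (phi2_integrand z)"
    by (rule set_integrable_dominated_continuous[OF set_integrable_mult_right[of C', OF phi_bounds_integrable(2)]])
       (use assms in \<open>auto intro!: C' phi_integrand_continuous\<close>)
qed

lemma Phi_eqs:
  "Phi1 (h + 1/2) ((b + 1) / 2) z = (LBINT y:{0<..<1}. phi1_integrand z y)"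
  "Phi2 (h + 1/2) ((b + 1) / 2) z = (LBINT y:{0<..<1}. phi2_integrand z y)"
  unfolding Phi1_def Phi2_def phi1_integrand_def phi2_integrand_def exponent_eqs by simp_all

text \<open>
  In the outer integral \<open>psi\<close> occurs only with the weight \<open>u powr (2 * h)\<close>, and with that weight it
  depends on \<open>u\<close> through the ratio \<open>u / s\<close> alone.
\<close>

lemma psi_scaled:
  assumes "0 < u" "u < s"
  shows "u powr (2 * h) * psi (h + 1/2) ((b + 1) / 2) u s
    = s powr (b - 1) * (d1 * f1 (u / s) + d2 * (1 - u / s) powr (b - h - 1) * (u / s * f2 (u / s)))"
proof -
  have 1: "u powr (2 * h) * u powr (- 2 * h) = 1" using assms by (simp add: powr_add[symmetric])
  have 2: "u powr (2 * h) * u powr (1 - 2 * h) = u" using assms by (simp add: powr_add[symmetric])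
  have 3: "s powr (b - 2) = s powr (b - 1) / s" using assms powr_diff[of s "b - 1" 1] by simp
  have "u powr (2 * h) * psi (h + 1/2) ((b + 1) / 2) u s
     = (u powr (2 * h) * u powr (- 2 * h)) * (d1 * s powr (b - 1) * f1 (u / s))
       + (u powr (2 * h) * u powr (1 - 2 * h)) * (d2 * s powr (b - 2) * (1 - u / s) powr (b - 1 - h) * f2 (u / s))"
    unfolding psi_eq[OF assms] by (simp only: distrib_left mult_ac)
  also have "\<dots> = s powr (b - 1) * (d1 * f1 (u / s) + d2 * (1 - u / s) powr (b - h - 1) * (u / s * f2 (u / s)))"
    unfolding 1 2 3 by (simp add: algebra_simps)
  finally show ?thesis .
qed

lemma L_plus_eq:
  assumes "0 < u" "u < s"
  shows "L_plus (h + 1/2) ((b + 1) / 2) T u s =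
     d1 * u powr (- h) * s powr (b - 1) * (s - u) powr (1 + h - b) *
       (f1 (u / s) + h * (LBINT y:{0<..<1}. phi1_integrand (u / s) y))
     + d2 * (u / s) powr (1 - h) * f2 (u / s)
     + h * d2 * (u / s) powr (- h) * (LBINT y:{0<..<1}. phi2_integrand (u / s) y)
     - h * (u / s) powr (- h) * (LBINT x:{0<..<(T - s) / (s - u)}. lambda_integrand G (u / s) x)"
proof -
  have z: "0 < u / s" "u / s \<le> 1" using assms by auto
  show ?thesis unfolding L_plus_def Lambda_sum[OF z] exponent_eqs Phi_eqs ..
qed

text \<open>
  The two outer integrals are parametrised by \<open>t = u + (s - u) * y\<close> with \<open>y\<close> in the unit interval
  and by \<open>t = s + (s - u) * x\<close> with \<open>0 < x < (T - s) / (s - u)\<close>.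
\<close>

lemma K_plus_eq:
  assumes "0 < u" "u < s" "s < T"
  shows "K_plus (h + 1/2) ((b + 1) / 2) T u s = (s - u) powr (b - 2 * h - 1) * L_plus (h + 1/2) ((b + 1) / 2) T u s"
proof -
  define c where "c = s - u"
  define z where "z = u / s"
  define R where "R = (T - s) / c"
  have c: "0 < c" "0 < R" using assms by (auto simp: c_def R_def)
  have z: "0 < z" "z < 1" "0 < s" "u = s * z" using assms by (auto simp: z_def)
  have cz: "c = s * (1 - z)" using z by (simp add: c_def algebra_simps)
  let ?rho = "rho (h + 1/2) ((b + 1) / 2)"
  let ?psi = "psi (h + 1/2) ((b + 1) / 2)"
  let ?I1 = "LBINT y:{0<..<1}. phi1_integrand z y"
  let ?I2 = "LBINT y:{0<..<1}. phi2_integrand z y"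
  let ?I3 = "LBINT x:{0<..<R}. lambda_integrand G z x"
  define q where "q = (1 - z) powr (b - h - 1)"
  have pt1: "(u powr (2 * h) * ?psi u s - (u + c * y) powr (2 * h) * ?psi (u + c * y) s) / (u + c * y - u) powr (h + 1)
     = c powr (- h - 1) * s powr (b - 1) * (d1 * phi1_integrand z y + d2 * q * phi2_integrand z y)"
    if y: "0 < y" "y < 1" for y
  proof -
    define w where "w = z + (1 - z) * y"
    have ty: "c * y < c" "0 < c * y" using c y by auto
    have "u + c = s" by (simp add: c_def)
    hence t: "0 < u + c * y" "u + c * y < s" using assms ty by linarith+
    have ts: "(u + c * y) / s = w" unfolding w_def cz using z by (simp add: field_simps)
    have w1: "1 - w = (1 - z) * (1 - y)" by (simp add: w_def algebra_simps)
    have 3: "1 / (c * y) powr (h + 1) = c powr (- h - 1) * (1 / y powr (h + 1))"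
      using c y powr_minus_divide[of c "h + 1"] by (simp add: powr_mult)
    have "(u powr (2 * h) * ?psi u s - (u + c * y) powr (2 * h) * ?psi (u + c * y) s) / (u + c * y - u) powr (h + 1)
       = (s powr (b - 1) * (d1 * f1 z + d2 * q * (z * f2 z))
          - s powr (b - 1) * (d1 * f1 w + d2 * (q * (1 - y) powr (b - h - 1)) * (w * f2 w))) * (1 / (c * y) powr (h + 1))"
      unfolding psi_scaled[OF assms(1,2)] psi_scaled[OF t] ts w1 z_def[symmetric]
      using y z by (simp add: q_def powr_mult)
    also have "\<dots> = c powr (- h - 1) * s powr (b - 1) * (d1 * ((f1 z - f1 w) * (1 / y powr (h + 1)))
        + d2 * q * ((z * f2 z - w * (1 - y) powr (b - h - 1) * f2 w) * (1 / y powr (h + 1))))"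
      unfolding 3 by (simp only: algebra_simps)
    finally show ?thesis by (simp add: phi1_integrand_def phi2_integrand_def w_def)
  qed
  have "(LBINT t:{u<..<s}. (u powr (2 * h) * ?psi u s - t powr (2 * h) * ?psi t s) / (t - u) powr (h + 1))
     = c * (LBINT y:{0<..<1}. (u powr (2 * h) * ?psi u s - (u + c * y) powr (2 * h) * ?psi (u + c * y) s) / (u + c * y - u) powr (h + 1))"
    using c assms by (subst set_integral_affine[of c]) (auto simp: c_def)
  also have "\<dots> = c * (LBINT y:{0<..<1}. c powr (- h - 1) * s powr (b - 1) * (d1 * phi1_integrand z y + d2 * q * phi2_integrand z y))"
    using pt1 by (intro arg_cong2[of _ _ _ _ "(*)"] set_lebesgue_integral_cong refl) auto
  also have "\<dots> = (c powr 1 * c powr (- h - 1)) * s powr (b - 1) * (LBINT y:{0<..<1}. d1 * phi1_integrand z y + d2 * q * phi2_integrand z y)"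
    using c by simp
  also have "(LBINT y:{0<..<1}. d1 * phi1_integrand z y + d2 * q * phi2_integrand z y) = d1 * ?I1 + d2 * q * ?I2"
    using phi_integrand_integrable[of z] z by (subst set_integral_add) auto
  also have "c powr 1 * c powr (- h - 1) = c powr (- h)"
    by (simp only: powr_add[symmetric]) simp
  finally have int1: "(LBINT t:{u<..<s}. (u powr (2 * h) * ?psi u s - t powr (2 * h) * ?psi t s) / (t - u) powr (h + 1))
     = c powr (- h) * s powr (b - 1) * (d1 * ?I1 + d2 * q * ?I2)" .
  have pt2: "(s + c * x - u) powr (- h - 1) * (s + c * x) powr (2 * h) * ?rho (s + c * x) s
     = c powr (b - 2 * h - 2) * s powr h * lambda_integrand G z x" if x: "0 < x" "x < R" for x
  proof -
    define e where "e = 1 + (1 - z) * x"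
    have e: "0 < e" using zx_factors(1)[of z x] z x by (simp add: e_def)
    have t: "s + c * x = s * e" using z by (simp add: e_def cz algebra_simps)
    have tu: "s + c * x - u = c * (1 + x)" by (simp add: c_def algebra_simps)
    have "?rho (s + c * x) s = (s + c * x - s) powr (b - h - 1) * (s + c * x) powr (- h) * G (s / (s + c * x))"
      using x c z by (intro rho_eq) auto
    also have "s / (s + c * x) = yx z x" unfolding t yx_def e_def[symmetric] using z by simp
    also have "s + c * x - s = c * x" by simp
    finally have rho_t: "?rho (s + c * x) s = (c * x) powr (b - h - 1) * (s * e) powr (- h) * G (yx z x)"
      by (simp add: t)
    have 1: "(s * e) powr (2 * h) * (s * e) powr (- h) = (s * e) powr h"
      by (simp add: powr_add[symmetric])
    have 2: "c powr (- h - 1) * c powr (b - h - 1) = c powr (b - 2 * h - 2)"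
      by (simp add: powr_add[symmetric] algebra_simps)
    have "(s + c * x - u) powr (- h - 1) * (s + c * x) powr (2 * h) * ?rho (s + c * x) s
       = (c * (1 + x)) powr (- h - 1) * (c * x) powr (b - h - 1) * ((s * e) powr (2 * h) * (s * e) powr (- h)) * G (yx z x)"
      unfolding rho_t tu unfolding t by (simp only: mult_ac)
    also have "\<dots> = (c powr (- h - 1) * c powr (b - h - 1)) * s powr h *
        (x powr (b - h - 1) * (1 + x) powr (- h - 1) * e powr h * G (yx z x))"
      unfolding 1 using c x z e by (simp add: powr_mult mult_ac)
    finally show ?thesis unfolding 2 by (simp add: lambda_integrand_def e_def)
  qed
  have "(LBINT t:{s<..<T}. (t - u) powr (- h - 1) * t powr (2 * h) * ?rho t s)
     = c * (LBINT x:{0<..<R}. (s + c * x - u) powr (- h - 1) * (s + c * x) powr (2 * h) * ?rho (s + c * x) s)"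
    using c by (subst set_integral_affine[of c]) (auto simp: R_def)
  also have "\<dots> = c * (LBINT x:{0<..<R}. c powr (b - 2 * h - 2) * s powr h * lambda_integrand G z x)"
    using pt2 by (intro arg_cong2[of _ _ _ _ "(*)"] set_lebesgue_integral_cong refl) auto
  also have "\<dots> = (c powr 1 * c powr (b - 2 * h - 2)) * s powr h * ?I3"
    using c by simp
  also have "c powr 1 * c powr (b - 2 * h - 2) = c powr (b - 2 * h - 1)"
    by (simp only: powr_add[symmetric]) simp
  finally have int2: "(LBINT t:{s<..<T}. (t - u) powr (- h - 1) * t powr (2 * h) * ?rho t s)
     = c powr (b - 2 * h - 1) * s powr h * ?I3" .
  have lead: "u powr h * c powr (- h) * ?psi u s
     = u powr (- h) * c powr (- h) * s powr (b - 1) * (d1 * f1 z + d2 * q * (z * f2 z))"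
  proof -
    have "u powr h = u powr (- h) * u powr (2 * h)" by (simp add: powr_add[symmetric])
    hence "u powr h * c powr (- h) * ?psi u s = u powr (- h) * c powr (- h) * (u powr (2 * h) * ?psi u s)" by simp
    thus ?thesis unfolding psi_scaled[OF assms(1,2)] by (simp add: z_def q_def)
  qed
  have cexp: "c powr (- h) = c powr (b - 2 * h - 1) * c powr (1 + h - b)"
    by (simp add: powr_add[symmetric])
  have uz: "u powr (- h) = s powr (- h) * z powr (- h)" using z by (simp add: powr_mult)
  \<comment> \<open>The powers of \<open>s\<close>, \<open>s - u\<close> and \<open>1 - u / s\<close> in the \<open>F2\<close>-part cancel, as \<open>s - u = s * (1 - u / s)\<close>.\<close>
  have sq: "s powr (- h) * s powr (b - 1) * c powr (1 + h - b) * q = 1"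
  proof -
    have "c powr (1 + h - b) = s powr (1 + h - b) * (1 - z) powr (1 + h - b)"
      using z by (simp add: cz powr_mult)
    thus ?thesis using z by (simp add: q_def powr_def exp_add[symmetric]) (simp add: algebra_simps)
  qed
  have us: "u powr (- h) * s powr h = z powr (- h)"
    unfolding uz using z by (simp add: powr_minus)
  have zz: "z powr (- h) * z = z powr (1 - h)"
    using z powr_add[of z "- h" 1] by simp
  have "K_plus (h + 1/2) ((b + 1) / 2) T u s
     = u powr (- h) * c powr (- h) * s powr (b - 1) * (d1 * f1 z + d2 * q * (z * f2 z))
       + h * u powr (- h) * (c powr (- h) * s powr (b - 1) * (d1 * ?I1 + d2 * q * ?I2))
       - h * u powr (- h) * (c powr (b - 2 * h - 1) * s powr h * ?I3)"
    unfolding K_plus_def exponent_eqs int1 int2 c_def[symmetric] lead ..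
  also have "\<dots> = c powr (b - 2 * h - 1) * (d1 * u powr (- h) * s powr (b - 1) * c powr (1 + h - b) * (f1 z + h * ?I1)
       + d2 * z powr (- h) * (s powr (- h) * s powr (b - 1) * c powr (1 + h - b) * q) * (z * f2 z + h * ?I2)
       - h * (u powr (- h) * s powr h) * ?I3)"
    unfolding cexp uz by (simp only: algebra_simps)
  also have "\<dots> = c powr (b - 2 * h - 1) * (d1 * u powr (- h) * s powr (b - 1) * c powr (1 + h - b) * (f1 z + h * ?I1)
       + d2 * (z powr (- h) * z) * f2 z + h * d2 * z powr (- h) * ?I2
       - h * z powr (- h) * ?I3)"
    unfolding sq us by (simp only: algebra_simps mult_1_right mult_1_left)
  finally show ?thesis
    unfolding zz L_plus_eq[OF assms(1,2)] z_def[symmetric] c_def[symmetric] R_def[symmetric] .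
qed

lemma kernel_K_eq:
  assumes "0 < u" "u < T" "0 < s" "s < T" "u \<noteq> s"
  shows "kernel_K (h + 1/2) ((b + 1) / 2) T u s = \<bar>u - s\<bar> powr (b - 2 * h - 1) * kernel_L (h + 1/2) ((b + 1) / 2) T u s"
  using assms K_minus_eq[of s u T] K_plus_eq[of u s T] by (auto simp: kernel_K_def kernel_L_def)

end

section \<open>Continuity up to the diagonal\<close>

text \<open>
  The common continuity argument for the \<open>Psi\<close>- and the \<open>Lambda\<close>-part; the latter is used with the two
  coordinates exchanged.  The cut-off \<open>x < (T - u) / (u - s)\<close> is written as
  \<open>x * (u - s) < T - u\<close>, which remains meaningful at \<open>u = s\<close>, where it holds for every \<open>x\<close>.
\<close>

lemma continuous_on_half_line_integral:
  fixes F :: "real \<Rightarrow> real \<Rightarrow> real"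
  assumes w: "set_integrable lborel {0<..} w" and h: "0 \<le> h"
    and le: "\<And>z x N. 0 \<le> z \<Longrightarrow> z \<le> 1 \<Longrightarrow> 0 < x \<Longrightarrow> (1 + (1 - z) * x) powr h \<le> N \<Longrightarrow> \<bar>F z x\<bar> \<le> C * N * w x"
    and contx: "\<And>z. 0 \<le> z \<Longrightarrow> z \<le> 1 \<Longrightarrow> continuous_on {0<..} (F z)"
    and contz: "\<And>x. 0 < x \<Longrightarrow> continuous_on {0..1} (\<lambda>z. F z x)"
  shows "continuous_on {p. 0 < snd p \<and> snd p \<le> fst p \<and> fst p < T}
           (\<lambda>p. LBINT x:{x. 0 < x \<and> x * (fst p - snd p) < T - fst p}. F (snd p / fst p) x)"
    (is "continuous_on ?S (\<lambda>p. LBINT x:?A p. _)")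
  unfolding continuous_on_def
proof
  fix p0 assume p0: "p0 \<in> ?S"
  hence u0: "0 < fst p0" by auto
  have T: "0 < T" using p0 by auto
  have A_open: "open (?A p)" for p :: "real \<times> real"
    unfolding Collect_conj_eq by (intro open_Int open_Collect_less continuous_intros)
  have z: "0 \<le> snd p / fst p" "snd p / fst p \<le> 1" if "p \<in> ?S" for p
    using that by auto
  define N where "N = (2 * T / fst p0) powr h"
  have inS: "\<forall>\<^sub>F p in at p0 within ?S. p \<in> ?S" by (simp add: eventually_at_filter)
  have fst_lim: "(fst \<longlongrightarrow> fst p0) (at p0 within ?S)" and snd_lim: "(snd \<longlongrightarrow> snd p0) (at p0 within ?S)"
    by (intro tendsto_intros)+
  \<comment> \<open>Keeping \<open>fst p\<close> away from 0 makes the bound \<open>T / fst p\<close> for the growth factor uniform.\<close>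
  have big: "\<forall>\<^sub>F p in at p0 within ?S. fst p0 / 2 < fst p"
    using u0 by (intro order_tendstoD(1)[OF fst_lim]) simp
  show "((\<lambda>p. LBINT x:?A p. F (snd p / fst p) x) \<longlongrightarrow> (LBINT x:?A p0. F (snd p0 / fst p0) x)) (at p0 within ?S)"
  proof (rule tendsto_set_integral_dominated[OF set_integrable_mult_right[of "C * N", OF w]])
    show "\<forall>\<^sub>F p in at p0 within ?S. open (?A p) \<and> continuous_on (?A p) (F (snd p / fst p)) \<and> ?A p \<subseteq> {0<..} \<and>
        (\<forall>x\<in>?A p. \<bar>F (snd p / fst p) x\<bar> \<le> C * N * w x)"
      using inS big
    proof eventually_elim
      case (elim p)
      have "\<bar>F (snd p / fst p) x\<bar> \<le> C * N * w x" if x: "x \<in> ?A p" for x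
      proof (rule le)
        have p: "0 < fst p" "snd p \<le> fst p" using elim by auto
        have "fst p * (1 + (1 - snd p / fst p) * x) = fst p + x * (fst p - snd p)"
          using p by (simp add: field_simps)
        also have "\<dots> \<le> T" using x by simp
        finally have "1 + (1 - snd p / fst p) * x \<le> T / fst p"
          using p by (simp add: le_divide_eq mult.commute)
        also have "\<dots> \<le> T / (fst p0 / 2)"
          using elim u0 T by (intro divide_left_mono) auto
        finally have "1 + (1 - snd p / fst p) * x \<le> 2 * T / fst p0" by (simp add: mult.commute)
        moreover have "0 \<le> (1 - snd p / fst p) * x"
          using z[OF elim(1)] x by (intro mult_nonneg_nonneg) auto
        ultimately show "(1 + (1 - snd p / fst p) * x) powr h \<le> N"
          unfolding N_def using h by (intro powr_mono2) auto
      qed (use z[OF elim(1)] x in auto)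
      thus ?case using A_open[of p] z[OF elim(1)]
        by (auto intro!: continuous_on_subset[OF contx])
    qed
    show "continuous_on (?A p0) (F (snd p0 / fst p0))"
      using z[OF p0] by (auto intro!: continuous_on_subset[OF contx])
    \<comment> \<open>Only the end point of the limiting domain can fail to be eventually inside or eventually outside
      the moving domains; on the diagonal the quotient is 0 and the domain has no end point.\<close>
    have "AE x in lborel. x \<noteq> (T - fst p0) / (fst p0 - snd p0)" by (rule AE_lborel_singleton)
    thus "AE x in lborel. ((\<lambda>p. indicator (?A p) x * F (snd p / fst p) x) \<longlongrightarrow>
             indicator (?A p0) x * F (snd p0 / fst p0) x) (at p0 within ?S)"
    proof eventually_elim
      case (elim x)
      consider "x \<le> 0" | "0 < x" "x * (fst p0 - snd p0) < T - fst p0"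
        | "0 < x" "T - fst p0 < x * (fst p0 - snd p0)"
      proof (cases "fst p0 = snd p0")
        case True
        hence "x * (fst p0 - snd p0) < T - fst p0" using p0 by simp
        thus ?thesis using that by linarith
      next
        case False
        hence "x * (fst p0 - snd p0) \<noteq> T - fst p0" using elim by (auto simp: field_simps)
        thus ?thesis using that by linarith
      qed
      thus ?case
      proof cases
        case 1
        thus ?thesis by simp
      next
        case 2
        have "((\<lambda>p. x * (fst p - snd p) - (T - fst p)) \<longlongrightarrow> x * (fst p0 - snd p0) - (T - fst p0)) (at p0 within ?S)"
          by (intro tendsto_intros)
        hence "\<forall>\<^sub>F p in at p0 within ?S. x * (fst p - snd p) - (T - fst p) < 0"
          by (rule order_tendstoD(2)) (use 2 in simp)
        hence ev: "\<forall>\<^sub>F p in at p0 within ?S. F (snd p / fst p) x = indicator (?A p) x * F (snd p / fst p) x"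
          by eventually_elim (use 2 in simp)
        have "((\<lambda>p. F (snd p / fst p) x) \<longlongrightarrow> F (snd p0 / fst p0) x) (at p0 within ?S)"
        proof (rule continuous_on_tendsto_compose[OF contz[OF 2(1)]])
          show "((\<lambda>p. snd p / fst p) \<longlongrightarrow> snd p0 / fst p0) (at p0 within ?S)"
            using u0 by (intro tendsto_intros) auto
          show "\<forall>\<^sub>F p in at p0 within ?S. snd p / fst p \<in> {0..1}"
            using inS by eventually_elim (use z in auto)
        qed (use z[OF p0] in auto)
        from Lim_transform_eventually[OF this ev] show ?thesis using 2 by simp
      next
        case 3
        have "((\<lambda>p. x * (fst p - snd p) - (T - fst p)) \<longlongrightarrow> x * (fst p0 - snd p0) - (T - fst p0)) (at p0 within ?S)"
          by (intro tendsto_intros)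
        hence "\<forall>\<^sub>F p in at p0 within ?S. 0 < x * (fst p - snd p) - (T - fst p)"
          by (rule order_tendstoD(1)) (use 3 in simp)
        hence "\<forall>\<^sub>F p in at p0 within ?S. 0 = indicator (?A p) x * F (snd p / fst p) x"
          by eventually_elim simp
        from Lim_transform_eventually[OF tendsto_const this] show ?thesis using 3 by simp
      qed
    qed
  qed (rule A_open)
qed

context kernel_exponents
begin

lemma continuous_zx_yx:
  assumes "holder_unit g f" "0 < x"
  shows "continuous_on {0..1} (\<lambda>z. f (zx z x))" "continuous_on {0..1} (\<lambda>z. f (yx z x))"
proof -
  note nz = one_plus_nonzero[OF assms(2)]
  note f = continuous_on_compose2[OF holder_unit_continuous[OF assms(1) g_bounds(1)]]
  have c: "continuous_on {0..1} (\<lambda>z. zx z x)" "continuous_on {0..1} (\<lambda>z. yx z x)"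
    unfolding zx_def yx_def using nz by (intro continuous_intros; simp)+
  have s: "(\<lambda>z. zx z x) ` {0..1} \<subseteq> {0..1}" "(\<lambda>z. yx z x) ` {0..1} \<subseteq> {0..1}"
    using assms(2) by (intro image_subsetI zx_bounds; simp)+
  show "continuous_on {0..1} (\<lambda>z. f (zx z x))" "continuous_on {0..1} (\<lambda>z. f (yx z x))"
    by (rule f[OF c(1) s(1)], rule f[OF c(2) s(2)])
qed

lemma psi_integral_continuous:
  "continuous_on {p. 0 < snd p \<and> snd p \<le> fst p \<and> fst p < T}
     (\<lambda>p. LBINT x:{x. 0 < x \<and> x * (fst p - snd p) < T - fst p}. psi_integrand G (snd p / fst p) x)"
proof -
  obtain C where C: "C \<ge> 0" "\<And>z x N. 0 \<le> z \<Longrightarrow> z \<le> 1 \<Longrightarrow> 0 < x \<Longrightarrow> (1 + (1 - z) * x) powr h \<le> N \<Longrightarrow>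
      \<bar>psi_integrand G z x\<bar> \<le> C * N * psi_bound x"
    by (rule psi_integrand_le[OF holder_G(4)]) (rule that; blast)
  show ?thesis
  proof (rule continuous_on_half_line_integral[OF psi_bound_integrable _ C(2)])
    show "continuous_on {0..1} (\<lambda>z. psi_integrand G z x)" if "0 < x" for x
      unfolding psi_integrand_def kappa_def
      by (intro continuous_intros holder_unit_continuous[OF holder_G(4) g_bounds(1)]
            continuous_zx_yx[OF holder_G(4) that] one_plus_nonzero that)
  qed (use exponent_bounds in \<open>auto intro: psi_integrand_continuous holder_G\<close>)
qed

lemma lambda_integral_continuous:
  "continuous_on {p. 0 < snd p \<and> snd p \<le> fst p \<and> fst p < T}
     (\<lambda>p. LBINT x:{x. 0 < x \<and> x * (fst p - snd p) < T - fst p}. lambda_integrand G (snd p / fst p) x)"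
proof -
  obtain M where M: "M \<ge> 0" "\<And>z. z \<in> {0..1} \<Longrightarrow> \<bar>G z\<bar> \<le> M"
    by (rule holder_unit_bounded[OF holder_G(4) g_bounds(1)]) (rule that; blast)
  have le: "\<bar>lambda_integrand G z x\<bar> \<le> M * N * lambda_bound x"
    if "0 \<le> z" "z \<le> 1" "0 < x" "(1 + (1 - z) * x) powr h \<le> N" for z x N
    using lambda_integrand_le[OF M(2) that] by (simp add: mult_ac)
  show ?thesis
  proof (rule continuous_on_half_line_integral[OF lambda_bound_integrable _ le])
    show "continuous_on {0..1} (\<lambda>z. lambda_integrand G z x)" if "0 < x" for x
      unfolding lambda_integrand_def
      by (intro continuous_intros continuous_zx_yx[OF holder_G(4) that] one_plus_nonzero that)
  qed (use exponent_bounds in \<open>auto intro: lambda_integrand_continuous holder_G\<close>)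
qed

lemma phi_integrals_continuous:
  "continuous_on {0..1} (\<lambda>z. LBINT y:{0<..<1}. phi1_integrand z y)"
  "continuous_on {0..1} (\<lambda>z. LBINT y:{0<..<1}. phi2_integrand z y)"
proof -
  have gen: "continuous_on {0..1} (\<lambda>z. LBINT y:{0<..<1}. F z y)"
    if w: "set_integrable lborel {0<..<1} w" and le: "\<And>z y. 0 \<le> z \<Longrightarrow> z \<le> 1 \<Longrightarrow> 0 < y \<Longrightarrow> y < 1 \<Longrightarrow> \<bar>F z y\<bar> \<le> C * w y"
      and cy: "\<And>z. 0 \<le> z \<Longrightarrow> z \<le> 1 \<Longrightarrow> continuous_on {0<..<1} (F z)"
      and cz: "\<And>y. 0 < y \<Longrightarrow> y < 1 \<Longrightarrow> continuous_on {0..1} (\<lambda>z. F z y)" for F :: "real \<Rightarrow> real \<Rightarrow> real" and w C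
    unfolding continuous_on_def
  proof
    fix z0 :: real assume z0: "z0 \<in> {0..1}"
    have ev: "\<forall>\<^sub>F z in at z0 within {0..1}. z \<in> {0..1}" by (simp add: eventually_at_filter)
    show "((\<lambda>z. LBINT y:{0<..<1}. F z y) \<longlongrightarrow> (LBINT y:{0<..<1}. F z0 y)) (at z0 within {0..1})"
    proof (rule tendsto_set_integral_dominated[OF set_integrable_mult_right[of C, OF w]])
      show "\<forall>\<^sub>F z in at z0 within {0..1}. open {0<..<1::real} \<and> continuous_on {0<..<1} (F z)
           \<and> {0<..<1} \<subseteq> {0<..<1::real} \<and> (\<forall>y\<in>{0<..<1}. \<bar>F z y\<bar> \<le> C * w y)"
        using ev by eventually_elim (use le cy in auto)
      show "AE y in lborel. ((\<lambda>z. indicator {0<..<1} y * F z y) \<longlongrightarrow> indicator {0<..<1} y * F z0 y) (at z0 within {0..1})"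
      proof (rule AE_I2)
        fix y :: real
        show "((\<lambda>z. indicator {0<..<1} y * F z y) \<longlongrightarrow> indicator {0<..<1} y * F z0 y) (at z0 within {0..1})"
          using cz[of y] z0 by (cases "0 < y \<and> y < 1") (auto simp: continuous_on_def indicator_def)
      qed
    qed (use cy z0 in auto)
  qed
  have c: "continuous_on {0..1} (\<lambda>z. f (z + (1 - z) * y))" if "holder_unit g f" "0 < y" "y < 1" for f y
  proof (rule continuous_on_compose2[OF holder_unit_continuous[OF that(1) g_bounds(1)]])
    show "(\<lambda>z. z + (1 - z) * y) ` {0..1} \<subseteq> {0..1}"
      using that by (intro image_subsetI convex_unit(1)) auto
  qed (intro continuous_intros)
  note c0 = holder_unit_continuous[OF _ g_bounds(1)]
  obtain C where C: "C \<ge> 0" "\<And>z y. 0 \<le> z \<Longrightarrow> z \<le> 1 \<Longrightarrow> 0 < y \<Longrightarrow> y < 1 \<Longrightarrow>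
      \<bar>phi1_integrand z y\<bar> \<le> C * y powr (g - h - 1)"
    by (rule phi1_integrand_le) (rule that; blast)
  obtain C' where C': "C' \<ge> 0" "\<And>z y. 0 \<le> z \<Longrightarrow> z \<le> 1 \<Longrightarrow> 0 < y \<Longrightarrow> y < 1 \<Longrightarrow>
      \<bar>phi2_integrand z y\<bar> \<le> C' * (y powr (g - h - 1) + y powr (- h) * (1 - y) powr (b - h - 1))"
    by (rule phi2_integrand_le) (rule that; blast)
  show "continuous_on {0..1} (\<lambda>z. LBINT y:{0<..<1}. phi1_integrand z y)"
  proof (rule gen[OF phi_bounds_integrable(1) C(2)])
    show "continuous_on {0..1} (\<lambda>z. phi1_integrand z y)" if "0 < y" "y < 1" for y
      unfolding phi1_integrand_def using that by (intro continuous_intros c c0 holder_f) auto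
  qed (auto intro: phi_integrand_continuous)
  show "continuous_on {0..1} (\<lambda>z. LBINT y:{0<..<1}. phi2_integrand z y)"
  proof (rule gen[OF phi_bounds_integrable(2) C'(2)])
    show "continuous_on {0..1} (\<lambda>z. phi2_integrand z y)" if "0 < y" "y < 1" for y
      unfolding phi2_integrand_def using that by (intro continuous_intros c c0 holder_f) auto
  qed (auto intro: phi_integrand_continuous)
qed

text \<open>
  \<open>Lbar_minus\<close> and \<open>Lbar_plus\<close> extend \<open>L_minus\<close> and \<open>L_plus\<close> to the closed half-regions, diagonal
  included.  There the terms with a positive power of \<open>\<bar>u - s\<bar>\<close> vanish, since
  \<open>0 powr a = 0\<close>, and the integrals in \<open>x\<close> range over the whole half-line.
\<close>

definition Lbar_minus :: "real \<Rightarrow> real \<times> real \<Rightarrow> real" where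
  "Lbar_minus T p = (T - fst p) powr (- h) * (fst p - snd p) powr h * G (snd p / fst p)
     + h * (LBINT x:{x. 0 < x \<and> x * (fst p - snd p) < T - fst p}. psi_integrand G (snd p / fst p) x)"

definition Lbar_plus :: "real \<Rightarrow> real \<times> real \<Rightarrow> real" where
  "Lbar_plus T p =
     d1 * fst p powr (- h) * snd p powr (b - 1) * (snd p - fst p) powr (1 + h - b) *
       (f1 (fst p / snd p) + h * (LBINT y:{0<..<1}. phi1_integrand (fst p / snd p) y))
     + d2 * (fst p / snd p) powr (1 - h) * f2 (fst p / snd p)
     + h * d2 * (fst p / snd p) powr (- h) * (LBINT y:{0<..<1}. phi2_integrand (fst p / snd p) y)
     - h * (fst p / snd p) powr (- h) *
       (LBINT x:{x. 0 < x \<and> x * (snd p - fst p) < T - snd p}. lambda_integrand G (fst p / snd p) x)"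

lemma Lbar_minus_eq:
  assumes "0 < s" "s < u"
  shows "Lbar_minus T (u, s) = L_minus (h + 1/2) ((b + 1) / 2) T u s"
proof -
  have "{x. 0 < x \<and> x * (u - s) < T - u} = {0<..<(T - u) / (u - s)}"
    using assms by (auto simp: field_simps)
  thus ?thesis unfolding L_minus_eq[OF assms] Lbar_minus_def by simp
qed

lemma Lbar_plus_eq:
  assumes "0 < u" "u < s"
  shows "Lbar_plus T (u, s) = L_plus (h + 1/2) ((b + 1) / 2) T u s"
proof -
  have "{x. 0 < x \<and> x * (s - u) < T - s} = {0<..<(T - s) / (s - u)}"
    using assms by (auto simp: field_simps)
  thus ?thesis unfolding L_plus_eq[OF assms] Lbar_plus_def by simp
qed

lemma continuous_on_quotient:
  assumes "continuous_on {0..1} f" "\<And>p. p \<in> S \<Longrightarrow> 0 < q p \<and> 0 \<le> r p \<and> r p \<le> q p"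
    and "continuous_on S q" "continuous_on S (r :: _ \<Rightarrow> real)"
  shows "continuous_on S (\<lambda>p. f (r p / q p))"
proof (rule continuous_on_compose2[OF assms(1)])
  show "continuous_on S (\<lambda>p. r p / q p)"
    using assms by (intro continuous_intros) force+
  show "(\<lambda>p. r p / q p) ` S \<subseteq> {0..1}"
    using assms(2) by (force simp: divide_le_eq)
qed

lemma continuous_Lbar_minus:
  "continuous_on {p. 0 < snd p \<and> snd p \<le> fst p \<and> fst p < T} (Lbar_minus T)" (is "continuous_on ?S _")
proof -
  have 1: "continuous_on ?S (\<lambda>p. G (snd p / fst p))"
    by (intro continuous_on_quotient holder_unit_continuous[OF holder_G(4) g_bounds(1)] continuous_intros) auto
  have 2: "continuous_on ?S (\<lambda>p. (fst p - snd p) powr h)"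
    using exponent_bounds by (intro continuous_on_powr' continuous_intros) auto
  have 3: "continuous_on ?S (\<lambda>p. (T - fst p) powr (- h))"
    by (intro continuous_on_powr continuous_intros) auto
  show ?thesis unfolding Lbar_minus_def[abs_def]
    by (intro continuous_on_add continuous_on_mult continuous_on_const 1 2 3 psi_integral_continuous)
qed

lemma continuous_Lbar_plus:
  "continuous_on {p. 0 < fst p \<and> fst p \<le> snd p \<and> snd p < T} (Lbar_plus T)" (is "continuous_on ?S _")
proof -
  have q: "continuous_on ?S (\<lambda>p. f (fst p / snd p))" if "continuous_on {0..1} f" for f :: "real \<Rightarrow> real"
    by (intro continuous_on_quotient that continuous_intros) auto
  have 1: "continuous_on ?S (\<lambda>p. (snd p - fst p) powr (1 + h - b))"
    using exponent_bounds by (intro continuous_on_powr' continuous_intros) auto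
  have 2: "continuous_on ?S (\<lambda>p. fst p powr (- h))" "continuous_on ?S (\<lambda>p. snd p powr (b - 1))"
    "continuous_on ?S (\<lambda>p. (fst p / snd p) powr (1 - h))" "continuous_on ?S (\<lambda>p. (fst p / snd p) powr (- h))"
    by (intro continuous_intros; auto)+
  have "prod.swap ` ?S \<subseteq> {p. 0 < snd p \<and> snd p \<le> fst p \<and> fst p < T}" by auto
  from continuous_on_compose2[OF lambda_integral_continuous continuous_on_swap this]
  have 3: "continuous_on ?S (\<lambda>p. LBINT x:{x. 0 < x \<and> x * (snd p - fst p) < T - snd p}. lambda_integrand G (fst p / snd p) x)"
    by simp
  show ?thesis unfolding Lbar_plus_def[abs_def]
    by (intro continuous_on_add continuous_on_diff continuous_on_mult continuous_on_const 1 2 3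
        q[OF holder_unit_continuous[OF holder_f(1) g_bounds(1)]] q[OF holder_unit_continuous[OF holder_f(2) g_bounds(1)]]
        q[OF phi_integrals_continuous(1)] q[OF phi_integrals_continuous(2)])
qed

end

section \<open>Values on the diagonal\<close>

text \<open>
  Integrating by parts against \<open>y powr (- h)\<close> regularises the Beta integral with first argument
  \<open>- h\<close>.  Concretely, with \<open>F y = y powr (- h) * ((1 - y) powr a - 1)\<close> one finds
  \<open>F' = - h * k + (h - a) * m\<close>, where \<open>m\<close> is the convergent integrand of \<open>Beta (1 - h) a\<close>, and
  \<open>F\<close> runs from 0 to \<open>- 1\<close>.
\<close>

lemma subtracted_beta_integral:
  fixes a h :: real
  assumes "0 < a" "a \<le> 1" "0 < h" "h < 1"
  defines "k \<equiv> \<lambda>y. y powr (- h - 1) * ((1 - y) powr (a - 1) - 1)"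
  shows "set_integrable lborel {0<..<1} k"
    and "h * (LBINT y:{0<..<1}. k y) = 1 + (h - a) * Beta (1 - h) a"
proof -
  define m where "m = (\<lambda>y::real. y powr (- h) * (1 - y) powr (a - 1))"
  have m: "set_integrable lborel {0<..<1} m"
    using beta_integrable[of "1 - h" a] assms by (simp add: m_def)
  have m_int: "(LBINT y:{0<..<1}. m y) = Beta (1 - h) a"
    using beta_integral[of "1 - h" a] assms by (simp add: m_def)
  have y1: "y powr (- h - 1) * y = y powr (- h)" if "0 < y" for y :: real
    using that powr_add[of y "- h - 1" 1] by simp
  show k: "set_integrable lborel {0<..<1} k"
  proof (rule set_integrable_dominated_continuous[OF m])
    show "continuous_on {0<..<1} k" unfolding k_def by (intro continuous_intros) auto
    fix y :: real assume y: "y \<in> {0<..<1}"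
    have "\<bar>k y\<bar> \<le> y powr (- h - 1) * (y * (1 - y) powr (a - 1))"
      unfolding k_def abs_mult using y assms by (intro mult_mono one_minus_powr_bound) auto
    also have "\<dots> = (y powr (- h - 1) * y) * (1 - y) powr (a - 1)" by simp
    also have "\<dots> = m y" using y1[of y] y unfolding m_def by simp
    finally show "\<bar>k y\<bar> \<le> m y" .
  qed auto
  define F where "F = (\<lambda>y::real. y powr (- h) * ((1 - y) powr a - 1))"
  define F' where "F' = (\<lambda>y. - h * k y + (h - a) * m y)"
  have F'_int: "set_integrable lborel {0<..<1} F'"
    unfolding F'_def using k m by (intro set_integral_add(1) set_integrable_mult_right)
  have "(LBINT y=ereal 0..ereal 1. F' y) = - 1 - 0"
  proof (rule interval_integral_FTC_integrable)
    fix y :: real assume "ereal 0 < ereal y" "ereal y < ereal 1"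
    hence y: "0 < y" "y < 1" by auto
    have q: "(1 - y) powr a = (1 - y) * (1 - y) powr (a - 1)"
      using y powr_add[of "1 - y" 1 "a - 1"] by simp
    have F'_eq: "- h * y powr (- h - 1) * ((1 - y) powr a - 1) + y powr (- h) * (a * (1 - y) powr (a - 1) * - 1) = F' y"
      unfolding F'_def k_def m_def q y1[OF y(1), symmetric] by (simp add: algebra_simps)
    have "(F has_real_derivative - h * y powr (- h - 1) * ((1 - y) powr a - 1) + y powr (- h) * (a * (1 - y) powr (a - 1) * - 1)) (at y)"
      unfolding F_def using y by (auto intro!: derivative_eq_intros)
    thus "(F has_vector_derivative F' y) (at y)"
      unfolding F'_eq by (simp add: has_real_derivative_iff_has_vector_derivative)
    show "isCont F' y" unfolding F'_def k_def m_def using y by (intro continuous_intros) auto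
  next
    show "set_integrable lborel (einterval (ereal 0) (ereal 1)) F'" using F'_int by simp
    have ev: "\<forall>\<^sub>F y in at_right (0::real). 0 < y \<and> y < 1"
      using eventually_at_right_real[of 0 "1::real"] by simp
    hence "\<forall>\<^sub>F y in at_right (0::real). 0 \<le> y" by eventually_elim simp
    hence lim: "((\<lambda>y::real. y powr (1 - h)) \<longlongrightarrow> 0 powr (1 - h)) (at_right 0)"
      using assms by (intro tendsto_powr' tendsto_const tendsto_ident_at) auto
    from ev have "\<forall>\<^sub>F y in at_right (0::real). norm (F y) \<le> y powr (1 - h)"
    proof eventually_elim
      case (elim y)
      have "1 - y \<le> (1 - y) powr a" using elim assms by (intro le_powr_unit) auto
      moreover have "(1 - y) powr a \<le> 1" using elim assms powr_mono'[of 0 a "1 - y"] by simp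
      ultimately have "y powr (- h) * \<bar>(1 - y) powr a - 1\<bar> \<le> y powr (- h) * y"
        by (intro mult_left_mono) auto
      also have "\<dots> = y powr (1 - h)" using elim powr_add[of y "- h" 1] by simp
      finally show ?case by (simp add: F_def abs_mult)
    qed
    from Lim_null_comparison[OF this] lim
    show "((F \<circ> real_of_ereal) \<longlongrightarrow> 0) (at_right (ereal 0))"
      unfolding ereal_tendsto_simps by simp
    have "((\<lambda>y::real. (1 - y) powr a) \<longlongrightarrow> 0 powr a) (at_left 1)"
    proof (rule tendsto_powr')
      have "eventually (\<lambda>y::real. y < 1) (at_left 1)" by (simp add: eventually_at_filter)
      thus "(0::real) \<noteq> 0 \<or> 0 < a \<and> (\<forall>\<^sub>F y in at_left 1. 0 \<le> 1 - (y::real))"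
        using assms by (auto elim: eventually_mono)
    qed (auto intro!: tendsto_eq_intros)
    moreover have "((\<lambda>y::real. y powr (- h)) \<longlongrightarrow> 1 powr (- h)) (at_left 1)"
      by (rule tendsto_powr[OF tendsto_ident_at tendsto_const]) simp
    ultimately have "(F \<longlongrightarrow> 1 powr (- h) * (0 powr a - 1)) (at_left 1)"
      unfolding F_def by (intro tendsto_mult tendsto_diff tendsto_const)
    thus "((F \<circ> real_of_ereal) \<longlongrightarrow> - 1) (at_left (ereal 1))"
      unfolding ereal_tendsto_simps by simp
  qed simp
  also have "(LBINT y=ereal 0..ereal 1. F' y) = (LBINT y:{0<..<1}. F' y)"
    by (simp only: interval_lebesgue_integral_def einterval_eq ereal_less_eq zero_le_one if_True)
  also have "\<dots> = - h * (LBINT y:{0<..<1}. k y) + (h - a) * (LBINT y:{0<..<1}. m y)"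
  proof -
    have "set_integrable lborel {0<..<1} (\<lambda>y. - h * k y)" "set_integrable lborel {0<..<1} (\<lambda>y. (h - a) * m y)"
      using k m by (intro set_integrable_mult_right; simp)+
    from set_integral_add(2)[OF this] show ?thesis
      unfolding F'_def set_integral_mult_right .
  qed
  finally show "h * (LBINT y:{0<..<1}. k y) = 1 + (h - a) * Beta (1 - h) a"
    unfolding m_int by simp
qed

lemma Gamma_reflection_real':
  "Gamma x * Gamma (1 - x) = pi / sin (pi * x)" for x :: real
proof -
  have 1: "Gamma (complex_of_real x) = of_real (Gamma x)" by (rule Gamma_complex_of_real)
  have 2: "Gamma (1 - complex_of_real x) = of_real (Gamma (1 - x))"
    using Gamma_complex_of_real[of "1 - x"] by simp
  have 3: "sin (of_real pi * complex_of_real x) = of_real (sin (pi * x))"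
    using sin_of_real[of "pi * x", where 'a = complex] by simp
  have "complex_of_real (Gamma x * Gamma (1 - x)) = complex_of_real (pi / sin (pi * x))"
    using Gamma_reflection_complex[of "of_real x"] unfolding 1 2 3 by simp
  thus ?thesis by (simp only: of_real_eq_iff)
qed

lemma Gamma_real_plus1: "0 < x \<Longrightarrow> Gamma (x + 1) = x * Gamma (x::real)"
  by (intro Gamma_plus1) (auto elim!: nonpos_Ints_cases)

lemma sin_squares_diff: "sin x ^ 2 - sin y ^ 2 = sin (x + y) * sin (x - y)" for x y :: real
proof -
  have "sin (x + y) * sin (x - y) = sin x ^ 2 * cos y ^ 2 - cos x ^ 2 * sin y ^ 2"
    by (simp add: sin_add sin_diff power2_eq_square algebra_simps)
  also have "\<dots> = sin x ^ 2 * (1 - sin y ^ 2) - (1 - sin x ^ 2) * sin y ^ 2"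
    by (simp only: cos_squared_eq)
  finally show ?thesis by (simp add: algebra_simps)
qed

context kernel_exponents
begin

text \<open>
  At \<open>z = 1\<close> the profile is frozen at \<open>G 1\<close>.  The substitution \<open>x = y / (1 - y)\<close> turns the remaining
  integral into the difference of the subtracted Beta integrals with \<open>a = h\<close> and
  \<open>a = 1 + 2 * h - b\<close>, the first of which contributes only the constant 1.
\<close>

lemma psi_integral_diagonal:
  "h * (LBINT x:{0<..}. psi_integrand G 1 x) = G 1 * ((1 + h - b) * Beta (1 - h) (1 + 2 * h - b))"
proof -
  define f where "f = (\<lambda>x::real. x powr (- h - 1) * (1 - (1 + x) powr (b - h - 1)))"
  define k where "k = (\<lambda>a y::real. y powr (- h - 1) * ((1 - y) powr (a - 1) - 1))"
  have psi: "psi_integrand G 1 x = G 1 * f x" for x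
    by (simp add: psi_integrand_def kappa_def zx_def f_def algebra_simps)
  have eq: "f (y / (1 - y)) / (1 - y)\<^sup>2 = k h y - k (1 + 2 * h - b) y" if "0 < y" "y < 1" for y
  proof -
    define d where "d = 1 - y"
    have d: "0 < d" using that by (simp add: d_def)
    have e: "1 + y / d = 1 / d" using d by (simp add: d_def field_simps)
    have e1: "(y / d) powr (- h - 1) / d\<^sup>2 = y powr (- h - 1) * d powr (h - 1)"
    proof -
      have "d\<^sup>2 = exp (2 * ln d)" using d by (simp add: exp_double)
      thus ?thesis using d that
        by (simp add: powr_def ln_div exp_add[symmetric] exp_diff[symmetric]) (simp add: algebra_simps)
    qed
    have e2: "(1 / d) powr (b - h - 1) = d powr (1 + h - b)"
      using d by (simp add: powr_def ln_div) (simp add: algebra_simps)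
    have e3: "d powr (h - 1) * d powr (1 + h - b) = d powr (1 + 2 * h - b - 1)"
      by (simp add: powr_add[symmetric] algebra_simps)
    have "f (y / d) / d\<^sup>2 = ((y / d) powr (- h - 1) / d\<^sup>2) * (1 - (1 / d) powr (b - h - 1))"
      by (simp add: f_def e)
    also have "\<dots> = y powr (- h - 1) * (d powr (h - 1) - d powr (h - 1) * d powr (1 + h - b))"
      unfolding e1 e2 by (simp add: algebra_simps)
    finally have "f (y / d) / d\<^sup>2 = y powr (- h - 1) * (d powr (h - 1) - d powr (1 + 2 * h - b - 1))"
      unfolding e3 .
    thus ?thesis by (simp add: d_def k_def algebra_simps)
  qed
  have k: "set_integrable lborel {0<..<1} (k a)" "h * (LBINT y:{0<..<1}. k a y) = 1 + (h - a) * Beta (1 - h) a"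
    if "0 < a" "a \<le> 1" for a
    unfolding k_def using subtracted_beta_integral[of a h] that exponent_bounds by auto
  have a: "0 < h" "h \<le> 1" "0 < 1 + 2 * h - b" "1 + 2 * h - b \<le> 1" using exponent_bounds by auto
  have int: "set_integrable lborel {0<..<1} (\<lambda>y. k h y - k (1 + 2 * h - b) y)"
    using k(1) a by (intro set_integral_diff(1)) auto
  have "(LBINT x:{0<..}. f x) = (LBINT y:{0<..<1}. f (y / (1 - y)) / (1 - y)\<^sup>2)"
  proof (rule set_integral_half_line_substitution(2))
    show "continuous_on {0<..} f" unfolding f_def by (intro continuous_intros) auto
    show "0 \<le> f x" if "0 < x" for x
      using that exponent_bounds powr_mono[of "b - h - 1" 0 "1 + x"] by (simp add: f_def)
    show "set_integrable lborel {0<..<1} (\<lambda>y. f (y / (1 - y)) / (1 - y)\<^sup>2)"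
      by (rule set_integrable_cong[THEN iffD2, OF refl refl _ int]) (use eq in auto)
  qed
  also have "\<dots> = (LBINT y:{0<..<1}. k h y - k (1 + 2 * h - b) y)"
    by (intro set_lebesgue_integral_cong) (use eq in auto)
  also have "\<dots> = (LBINT y:{0<..<1}. k h y) - (LBINT y:{0<..<1}. k (1 + 2 * h - b) y)"
    using k(1) a by (intro set_integral_diff(2)) auto
  finally have "h * (LBINT x:{0<..}. f x) = h * (LBINT y:{0<..<1}. k h y) - h * (LBINT y:{0<..<1}. k (1 + 2 * h - b) y)"
    by (simp add: right_diff_distrib)
  also have "\<dots> = (1 + h - b) * Beta (1 - h) (1 + 2 * h - b)"
    unfolding k(2)[OF a(1,2)] k(2)[OF a(3,4)] by (simp add: algebra_simps)
  finally show ?thesis unfolding psi by simp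
qed

text \<open>
  The subtracted Beta integral with \<open>a = b - h\<close>; its constant term cancels against \<open>F2 1\<close>.
\<close>

lemma phi2_integral_diagonal:
  "f2 1 + h * (LBINT y:{0<..<1}. phi2_integrand 1 y) = f2 1 * ((b - 2 * h) * Beta (1 - h) (b - h))"
proof -
  define k where "k = (\<lambda>y::real. y powr (- h - 1) * ((1 - y) powr (b - h - 1) - 1))"
  have "phi2_integrand 1 y = - f2 1 * k y" for y
  proof -
    have e: "y powr (- h - 1) = 1 / y powr (h + 1)" using powr_minus_divide[of y "h + 1"] by simp
    show ?thesis unfolding phi2_integrand_def k_def e by (simp add: diff_divide_distrib algebra_simps)
  qed
  moreover have "h * (LBINT y:{0<..<1}. k y) = 1 + (h - (b - h)) * Beta (1 - h) (b - h)"
    unfolding k_def using exponent_bounds by (intro subtracted_beta_integral(2)) auto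
  moreover have "f2 1 + h * (- f2 1 * I) = f2 1 * (1 - h * I)" for I by (simp add: algebra_simps)
  ultimately show ?thesis
    by (simp only: set_integral_mult_right) (simp add: algebra_simps)
qed

lemma lambda_integral_diagonal:
  "(LBINT x:{0<..}. lambda_integrand G 1 x) = G 1 * Beta (b - h) (1 + 2 * h - b)"
proof -
  have "(LBINT x:{0<..}. lambda_integrand G 1 x)
      = (LBINT x:{0<..}. G 1 * (x powr (b - h - 1) * (1 + x) powr (- (b - h) - (1 + 2 * h - b))))"
    by (intro set_lebesgue_integral_cong) (auto simp: lambda_integrand_def yx_def)
  thus ?thesis using beta_prime(2)[of "b - h" "1 + 2 * h - b"] exponent_bounds by simp
qed

text \<open>
  \<open>F3 1\<close> is the value 1 of a hypergeometric function at 0, the term with \<open>F4\<close> carries the factor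
  \<open>1 - z\<close>, and \<open>F5 1\<close> is given by Gauss's summation formula.
\<close>

lemma G_at_1: "G 1 = Gamma b * (Gamma (1 - h) / Gamma (b - h) - Gamma (1 + h - b) / Gamma h)"
proof -
  have f3: "f3 1 = 1" using exponent_bounds by (simp add: hypergeometric_eqs' hyp2F1_at_0)
  have f5: "f5 1 = Gamma (1 + b - h) * Gamma (1 + h - b) / (Gamma (1 + h) * Gamma (1 - h))"
    unfolding hypergeometric_eqs(3)[OF order_refl]
    by (subst hyp2F1_at_1) (use exponent_bounds in \<open>simp_all add: algebra_simps\<close>)
  have gs: "Gamma (1 + b - h) = (b - h) * Gamma (b - h)" "Gamma (1 + h) = h * Gamma h"
    using Gamma_real_plus1[of "b - h"] Gamma_real_plus1[of h] exponent_bounds by (simp_all add: algebra_simps)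
  have nz: "Gamma (b - h) \<noteq> 0" "Gamma h \<noteq> 0" "Gamma (1 - h) \<noteq> 0"
    using exponent_bounds by (auto intro!: Gamma_real_neq_0)
  have B: "Beta (1 - h) b = Gamma (1 - h) * Gamma b / ((b - h) * Gamma (b - h))"
    unfolding Beta_def gs(1)[symmetric] by (simp add: algebra_simps)
  have "G 1 = (b - h) * Beta (1 - h) b - h * Beta (1 - h) b * f5 1"
    unfolding G_def f3 coefficient_eqs by (simp add: algebra_simps)
  also have "\<dots> = Gamma b * (Gamma (1 - h) / Gamma (b - h) - Gamma (1 + h - b) / Gamma h)"
  proof -
    have cancel: "k * (X * B' / (k * Y)) - j * (X * B' / (k * Y)) * ((k * Y) * P / ((j * H) * X)) = B' * (X / Y - P / H)"
      if "k \<noteq> 0" "j \<noteq> 0" "X \<noteq> 0" "Y \<noteq> 0" "H \<noteq> 0" for k j X Y H P B' :: real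
      using that by (simp add: field_simps)
    show ?thesis unfolding B f5 gs by (rule cancel) (use nz exponent_bounds in auto)
  qed
  finally show ?thesis .
qed

lemma f2_at_1: "d2 * f2 1 = Gamma (1 - h) * Gamma (1 + h - b) / Gamma (1 - b)"
proof -
  have f2: "f2 1 = Gamma (3 - 2 * h) * Gamma (1 + h - b) / (Gamma (2 - b) * Gamma (2 - h))"
    unfolding hypergeometric_eqs(2)[OF order_refl]
    by (subst hyp2F1_at_1) (use exponent_bounds in \<open>simp_all add: algebra_simps\<close>)
  have gs: "Gamma (3 - 2 * h) = (2 - 2 * h) * Gamma (2 - 2 * h)" "Gamma (2 - b) = (1 - b) * Gamma (1 - b)"
    "Gamma (2 - h) = (1 - h) * Gamma (1 - h)"
    using Gamma_real_plus1[of "2 - 2 * h"] Gamma_real_plus1[of "1 - b"] Gamma_real_plus1[of "1 - h"] exponent_bounds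
    by simp_all
  have nz: "Gamma (2 - 2 * h) \<noteq> 0" "Gamma (1 - b) \<noteq> 0" "Gamma (1 - h) \<noteq> 0" "1 - b \<noteq> 0" "1 - h \<noteq> 0"
    using exponent_bounds by (auto intro!: Gamma_real_neq_0)
  have B: "Beta (1 - h) (1 - h) = Gamma (1 - h) * Gamma (1 - h) / Gamma (2 - 2 * h)"
    unfolding Beta_def by simp
  have two: "2 - 2 * h = 2 * (1 - h)" by simp
  have cancel: "(B' / 2 * (X * X / Y)) * (2 * Z * Y * P / (B' * Q * (Z * X))) = X * P / Q"
    if "X \<noteq> 0" "Y \<noteq> 0" "Z \<noteq> 0" "B' \<noteq> 0" "Q \<noteq> 0" for X Y Z B' P Q :: real
    using that by (simp add: field_simps)
  show ?thesis unfolding coefficient_eqs B f2 gs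
    using cancel[OF nz(3,1,5,4,2), of "Gamma (1 + h - b)"] by (simp only: two[symmetric])
qed

text \<open>
  All terms are expressed by Gamma values.  The factor \<open>G 1\<close>
  is a difference of two Gamma quotients, and its two cofactors, collected on one side, add up to a
  multiple of the corresponding sum; the product is a difference of squares, which by reflection becomes a
  difference of squared sines and factorises.
\<close>

lemma diagonal_values_coincide:
  "G 1 * ((1 + h - b) * Beta (1 - h) (1 + 2 * h - b))
     = d2 * f2 1 * ((b - 2 * h) * Beta (1 - h) (b - h)) - h * (G 1 * Beta (b - h) (1 + 2 * h - b))"
proof -
  define X where "X = Gamma (1 - h)"
  define P where "P = Gamma (1 + h - b)"
  define Bh where "Bh = Gamma (b - h)"
  define H where "H = Gamma h"
  define Q where "Q = Gamma (1 + 2 * h - b)"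
  define R where "R = Gamma (b - 2 * h)"
  define B where "B = Gamma b"
  define B1 where "B1 = Gamma (1 - b)"
  have nz: "X \<noteq> 0" "P \<noteq> 0" "Bh \<noteq> 0" "H \<noteq> 0" "Q \<noteq> 0" "R \<noteq> 0" "B \<noteq> 0" "B1 \<noteq> 0"
    unfolding X_def P_def Bh_def H_def Q_def R_def B_def B1_def
    using exponent_bounds by (auto intro!: Gamma_real_neq_0)
  have 1: "(b - 2 * h) * Beta (1 - h) (b - h) = X * Bh / R"
  proof -
    have "1 - h + (b - h) = b - 2 * h + 1" by simp
    hence "Gamma (1 - h + (b - h)) = (b - 2 * h) * R"
      using Gamma_real_plus1[of "b - 2 * h"] exponent_bounds by (simp only: R_def)
    thus ?thesis using exponent_bounds by (simp add: Beta_def X_def Bh_def)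
  qed
  have 2: "(1 + h - b) * Beta (1 - h) (1 + 2 * h - b) = X * Q / P"
  proof -
    have "1 - h + (1 + 2 * h - b) = 1 + h - b + 1" by simp
    hence "Gamma (1 - h + (1 + 2 * h - b)) = (1 + h - b) * P"
      using Gamma_real_plus1[of "1 + h - b"] exponent_bounds by (simp only: P_def)
    thus ?thesis using exponent_bounds by (simp add: Beta_def X_def Q_def)
  qed
  have 3: "h * Beta (b - h) (1 + 2 * h - b) = Bh * Q / H"
    using Gamma_real_plus1[of h] exponent_bounds nz
    by (simp add: Beta_def Bh_def Q_def H_def algebra_simps)
  have r1: "Bh * P = pi / sin (pi * (b - h))"
    using Gamma_reflection_real'[of "b - h"] by (simp add: Bh_def P_def algebra_simps)
  have r2: "H * X = pi / sin (pi * h)"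
    using Gamma_reflection_real'[of h] by (simp add: H_def X_def)
  have r3: "B * B1 = pi / sin (pi * b)"
    using Gamma_reflection_real'[of b] by (simp add: B_def B1_def)
  have r4: "R * Q = pi / sin (pi * (b - 2 * h))"
    using Gamma_reflection_real'[of "b - 2 * h"] by (simp add: R_def Q_def algebra_simps)
  have "sin (pi * (b - h)) ^ 2 - sin (pi * h) ^ 2 = sin (pi * b) * sin (pi * (b - 2 * h))"
    unfolding sin_squares_diff by (simp add: algebra_simps)
  hence "(pi / (Bh * P)) ^ 2 - (pi / (H * X)) ^ 2 = (pi / (B * B1)) * (pi / (R * Q))"
    unfolding r1 r2 r3 r4 by simp
  hence "pi\<^sup>2 * (1 / (Bh * P) ^ 2 - 1 / (H * X) ^ 2) = pi\<^sup>2 * (1 / (B * B1 * R * Q))"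
    by (simp add: power_divide power2_eq_square right_diff_distrib)
  hence key: "1 / (Bh * P) ^ 2 - 1 / (H * X) ^ 2 = 1 / (B * B1 * R * Q)"
    by (simp only: mult_cancel_left) simp
  \<comment> \<open>The two mixed products both equal \<open>B * Q * X / H\<close> and cancel.\<close>
  have "B * (X / Bh - P / H) * (X * Q / P) + B * (X / Bh - P / H) * (Bh * Q / H)
      = X ^ 2 * B * Q * P * Bh * (1 / (Bh * P) ^ 2 - 1 / (H * X) ^ 2)"
    using nz by (simp add: field_simps power2_eq_square)
  also have "\<dots> = X * P / B1 * (X * Bh / R)"
    unfolding key using nz by (simp add: field_simps power2_eq_square)
  finally have "B * (X / Bh - P / H) * (X * Q / P) = X * P / B1 * (X * Bh / R) - B * (X / Bh - P / H) * (Bh * Q / H)"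
    by simp
  moreover have "h * (G 1 * Beta (b - h) (1 + 2 * h - b)) = G 1 * (h * Beta (b - h) (1 + 2 * h - b))" by simp
  ultimately show ?thesis
    unfolding 1 2 f2_at_1 by (simp only: 3) (simp add: G_at_1 X_def P_def Bh_def H_def B_def B1_def)
qed

definition diagonal_value :: real where
  "diagonal_value = G 1 * ((1 + h - b) * Beta (1 - h) (1 + 2 * h - b))"

lemma Lbar_diagonal:
  assumes "0 < t" "t < T"
  shows "Lbar_minus T (t, t) = diagonal_value" "Lbar_plus T (t, t) = diagonal_value"
proof -
  have S: "{x. 0 < x \<and> x * (t - t) < T - t} = {0<..}" using assms by auto
  have z: "t / t = 1" using assms by simp
  show "Lbar_minus T (t, t) = diagonal_value"
    unfolding Lbar_minus_def fst_conv snd_conv S z psi_integral_diagonal diagonal_value_def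
    using exponent_bounds by simp
  have "Lbar_plus T (t, t) = d2 * (f2 1 + h * (LBINT y:{0<..<1}. phi2_integrand 1 y))
     - h * (LBINT x:{0<..}. lambda_integrand G 1 x)"
    unfolding Lbar_plus_def fst_conv snd_conv S z using exponent_bounds by (simp add: algebra_simps)
  also have "\<dots> = diagonal_value"
    unfolding phi2_integral_diagonal lambda_integral_diagonal diagonal_value_def
    using diagonal_values_coincide by simp
  finally show "Lbar_plus T (t, t) = diagonal_value" .
qed

lemma L_tendsto_diagonal:
  assumes "0 < t" "t < T"
  shows "((\<lambda>(u, s). L_minus (h + 1/2) ((b + 1) / 2) T u s) \<longlongrightarrow> diagonal_value)
           (at (t, t) within {(u, s). 0 < s \<and> s < u \<and> u < T})"
    and "((\<lambda>(u, s). L_plus (h + 1/2) ((b + 1) / 2) T u s) \<longlongrightarrow> diagonal_value)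
           (at (t, t) within {(u, s). 0 < u \<and> u < s \<and> s < T})"
proof -
  have "(Lbar_minus T \<longlongrightarrow> Lbar_minus T (t, t)) (at (t, t) within {p. 0 < snd p \<and> snd p \<le> fst p \<and> fst p < T})"
    using continuous_Lbar_minus[of T] assms unfolding continuous_on_def by auto
  hence "(Lbar_minus T \<longlongrightarrow> diagonal_value) (at (t, t) within {(u, s). 0 < s \<and> s < u \<and> u < T})"
    unfolding Lbar_diagonal[OF assms] by (rule tendsto_within_subset) auto
  thus "((\<lambda>(u, s). L_minus (h + 1/2) ((b + 1) / 2) T u s) \<longlongrightarrow> diagonal_value)
           (at (t, t) within {(u, s). 0 < s \<and> s < u \<and> u < T})"
    by (rule Lim_transform_eventually) (auto simp: eventually_at_filter Lbar_minus_eq intro!: always_eventually)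
  have "(Lbar_plus T \<longlongrightarrow> Lbar_plus T (t, t)) (at (t, t) within {p. 0 < fst p \<and> fst p \<le> snd p \<and> snd p < T})"
    using continuous_Lbar_plus[of T] assms unfolding continuous_on_def by auto
  hence "(Lbar_plus T \<longlongrightarrow> diagonal_value) (at (t, t) within {(u, s). 0 < u \<and> u < s \<and> s < T})"
    unfolding Lbar_diagonal[OF assms] by (rule tendsto_within_subset) auto
  thus "((\<lambda>(u, s). L_plus (h + 1/2) ((b + 1) / 2) T u s) \<longlongrightarrow> diagonal_value)
           (at (t, t) within {(u, s). 0 < u \<and> u < s \<and> s < T})"
    by (rule Lim_transform_eventually) (auto simp: eventually_at_filter Lbar_plus_eq intro!: always_eventually)
qed

lemma L_continuous_extension:
  "\<exists>Lext :: real \<times> real \<Rightarrow> real. continuous_on ({0<..<T} \<times> {0<..<T}) Lext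
     \<and> (\<forall>u\<in>{0<..<T}. \<forall>s\<in>{0<..<T}. u \<noteq> s \<longrightarrow> Lext (u, s) = kernel_L (h + 1/2) ((b + 1) / 2) T u s)"
proof (intro exI[of _ "\<lambda>p. if snd p - fst p \<le> 0 then Lbar_minus T p else Lbar_plus T p"] conjI ballI impI)
  show "continuous_on ({0<..<T} \<times> {0<..<T}) (\<lambda>p. if snd p - fst p \<le> 0 then Lbar_minus T p else Lbar_plus T p)"
  proof (rule continuous_on_cases_le)
    show "continuous_on {p \<in> {0<..<T} \<times> {0<..<T}. snd p - fst p \<le> 0} (Lbar_minus T)"
      by (rule continuous_on_subset[OF continuous_Lbar_minus]) auto
    show "continuous_on {p \<in> {0<..<T} \<times> {0<..<T}. 0 \<le> snd p - fst p} (Lbar_plus T)"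
      by (rule continuous_on_subset[OF continuous_Lbar_plus]) auto
  qed (auto intro!: continuous_intros simp: Lbar_diagonal)
  fix u s assume "u \<in> {0<..<T}" "s \<in> {0<..<T}" "u \<noteq> s"
  thus "(if snd (u, s) - fst (u, s) \<le> 0 then Lbar_minus T (u, s) else Lbar_plus T (u, s))
        = kernel_L (h + 1/2) ((b + 1) / 2) T u s"
    by (auto simp: kernel_L_def Lbar_minus_eq Lbar_plus_eq)
qed

end

theorem theorem4p8:
  fixes T H1 H2 :: real
  assumes "T > 0" and "1/2 < H1" and "H1 < H2" and "H2 < 1"
  shows "(\<forall>u\<in>{0<..<T}. \<forall>s\<in>{0<..<T}. u \<noteq> s \<longrightarrow>
            kernel_K H1 H2 T u s
              = \<bar>u - s\<bar> powr (2 * H2 - 2 * H1 - 1) * kernel_L H1 H2 T u s)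
    \<and> (\<exists>l. \<forall>t\<in>{0<..<T}.
          ((\<lambda>(u, s). L_minus H1 H2 T u s) \<longlongrightarrow> l)
            (at (t, t) within {(u, s). 0 < s \<and> s < u \<and> u < T})
        \<and> ((\<lambda>(u, s). L_plus H1 H2 T u s) \<longlongrightarrow> l)
            (at (t, t) within {(u, s). 0 < u \<and> u < s \<and> s < T}))
    \<and> (\<exists>Lext :: real \<times> real \<Rightarrow> real.
          continuous_on ({0<..<T} \<times> {0<..<T}) Lext
        \<and> (\<forall>u\<in>{0<..<T}. \<forall>s\<in>{0<..<T}. u \<noteq> s \<longrightarrow>
              Lext (u, s) = kernel_L H1 H2 T u s))"
proof -
  define h b where "h = H1 - 1/2" and "b = 2 * H2 - 1"
  interpret kernel_exponents h b
    using assms by unfold_locales (auto simp: h_def b_def)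
  have H: "H1 = h + 1/2" "H2 = (b + 1) / 2" by (simp_all add: h_def b_def)
  have e: "2 * ((b + 1) / 2) - 2 * (h + 1/2) - 1 = b - 2 * h - 1" by (rule exponent_eqs)
  show ?thesis
    unfolding H e
  proof (intro conjI)
    show "\<forall>u\<in>{0<..<T}. \<forall>s\<in>{0<..<T}. u \<noteq> s \<longrightarrow>
            kernel_K (h + 1/2) ((b + 1) / 2) T u s
              = \<bar>u - s\<bar> powr (b - 2 * h - 1) * kernel_L (h + 1/2) ((b + 1) / 2) T u s"
      using kernel_K_eq by auto
    show "\<exists>l. \<forall>t\<in>{0<..<T}.
          ((\<lambda>(u, s). L_minus (h + 1/2) ((b + 1) / 2) T u s) \<longlongrightarrow> l)
            (at (t, t) within {(u, s). 0 < s \<and> s < u \<and> u < T})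
        \<and> ((\<lambda>(u, s). L_plus (h + 1/2) ((b + 1) / 2) T u s) \<longlongrightarrow> l)
            (at (t, t) within {(u, s). 0 < u \<and> u < s \<and> s < T})"
      using L_tendsto_diagonal by (intro exI[of _ diagonal_value]) auto
  qed (rule L_continuous_extension)
qed

end
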